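(* Let $\lambda>0$, $u\in L^1(\Gamma_-,\mu_-)$ and $g\in X:=L^1(\Omega,\mu)$ be given. Then the function $$f(x)=\int_0^{\tau_-(x)}e^{-\lambda t}g(\Phi(x,-t))\,dt+\chi_{\{\tau_-(x)<\infty\}}\,e^{-\lambda\tau_-(x)}\,u(\Phi(x,-\tau_-(x)))$$ is the unique solution $f\in\mathscr D(\mathcal T_{\max})$ of the boundary value problem $$(\lambda-\mathcal T_{\max})f=g,\qquad \mathsf B^-f=u .$$ Moreover, $\mathsf B^+f\in L^1(\Gamma_+,\mu_+)$ and $$\|\mathsf B^+f\|_{L^1(\Gamma_+,\mu_+)}+\lambda\|f\|_X\le\|u\|_{L^1(\Gamma_-,\mu_-)}+\|g\|_X,$$ with equality if $g\ge0$ and $u\ge0$.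
   Context: Setting. $\mu$ is a positive Radon measure on $\mathbb R^N$ (a Borel measure, or the completion of one, finite on compact sets). $F:\mathbb R^N\to\mathbb R^N$ is a globally Lipschitz vector field. For $x\in\mathbb R^N$, $t\mapsto\Phi(x,t)$, $t\in\mathbb R$, is the unique global solution of $\frac{d}{dt}X(t)=F(X(t))$, $X(0)=x$. Standing assumption: $\mu(\Phi(A,t))=\mu(A)$ for every measurable $A\subset\mathbb R^N$ and $t\in\mathbb R$. $\Omega\subset\mathbb R^N$ is a (sufficiently smooth) open set. For $x\in\Omega$, $\tau_\pm(x)=\inf\{s>0:\Phi(x,\pm s)\notin\Omega\}$, with $\inf\varnothing=\infty$. The incoming ($-$) and outgoing ($+$) boundaries are $\Gamma_\pm=\{y\in\partial\Omega:\exists x\in\Omega,\ \tau_\pm(x)<\infty,\ y=\Phi(x,\pm\tau_\pm(x))\}$. For $y\in\Gamma_-$ (resp. $y\in\Gamma_+$), $\tau_+(y)$ (resp. $\tau_-(y)$) is the length of the integral curve in $\Omega$ having $y$ as left (resp. right) endpoint, i.e. $\tau_-(x)+\tau_+(x)$ for any $x\in\Omega$ with $y=\Phi(x,-\tau_-(x))$ (resp. $y=\Phi(x,\tau_+(x))$). Boundary measures: $\mu_\pm$ are the unique positive Borel measures on $\Gamma_\pm$ such that for all $T>0$ and $f\in L^1(\Omega\times(0,T),\mu\otimes dt)$, with $\wedge$ denoting minimum, $\int_{\Omega\times(0,T)}f\,d\mu\,dt=\int_0^Tdt\int_{\Gamma_+}d\mu_+(y)\int_0^{\tau_-(y)\wedge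 t}f(\Phi(y,-s),t-s)ds+\int_\Omega d\mu(x)\int_0^{\tau_-(x)\wedge T}f(\Phi(x,-s),T-s)ds$ and $\int_{\Omega\times(0,T)}f\,d\mu\,dt=\int_0^Tdt\int_{\Gamma_-}d\mu_-(y)\int_0^{\tau_+(y)\wedge(T-t)}f(\Phi(y,s),t+s)ds+\int_\Omega d\mu(x)\int_0^{\tau_+(x)\wedge T}f(\Phi(x,s),s)ds$. Support: the support of a measurable function on $\Omega$ is $\Omega\setminus\omega$, where $\omega$ is the maximal open subset of $\Omega$ on which the function vanishes $\mu$-a.e. Test functions: $\mathfrak Y$ is the set of all measurable bounded functions $\psi:\Omega\to\mathbb R$ with compact support in $\Omega$ such that for any $x\in\Omega$ the map $s\in(-\tau_-(x),\tau_+(x))\mapsto\psi(\Phi(x,s))$ is continuously differentiable, and $x\mapsto\frac{d}{ds}\psi(\Phi(x,s))|_{s=0}$ is measurable and bounded on $\Omega$. Maximal transport operator: $\mathscr D(\mathcal T_{\max})$ is the set of all $f\in L^1(\Omega,\mu)$ for which there is $g\in L^1(\Omega,\mu)$ with $\int_\Omega g\psi\,d\mu=\int_\Omega f(x)\frac{d}{ds}\psi(\Phi(x,s))|_{s=0}\,d\mu(x)$ for all $\psi\in\mathfrak Y$; then $\mathcal T_{\max}f:=g$. Traces: each $f\in\mathscr D(\mathcal T_{\max})$ has a representative $f^\sharp$ such that for $\mu$-a.e. $x\in\Omega$ and all $-\tau_-(x)<t_1\le t_2<\tau_+(x)$, $f^\sharp(\Phi(x,t_1))-f^\sharp(\Phi(x,t_2))=\int_{t_1}^{t_2}[\mathcal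 T_{\max}f](\Phi(x,s))ds$; the traces are $\mathsf B^+f(y)=\lim_{t\to0+}f^\sharp(\Phi(y,-t))$ for $\mu_+$-a.e. $y\in\Gamma_+$ and $\mathsf B^-f(y)=\lim_{t\to0+}f^\sharp(\Phi(y,t))$ for $\mu_-$-a.e. $y\in\Gamma_-$ (these limits exist a.e.). $\chi$ denotes a characteristic function. *)

theory Defs
  imports "HOL-Analysis.Analysis"
begin

text \<open>
  Elements of an \<open>L\<^sup>1\<close> space are represented by functions, and their equality by equality almost
  everywhere. A function on \<open>\<Omega>\<close> is a function on the whole space whose values outside \<open>\<Omega>\<close> are never
  used; membership in \<open>L\<^sup>1(\<Omega>, \<mu>)\<close> is \<open>set_integrable \<mu> \<Omega>\<close>.
\<close>

definition radon_measure :: "'a::euclidean_space measure \<Rightarrow> bool" where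
  "radon_measure \<mu> \<longleftrightarrow>
     (\<exists>\<mu>0. sets \<mu>0 = sets borel \<and> (\<mu> = \<mu>0 \<or> \<mu> = completion \<mu>0)) \<and>
     (\<forall>K. compact K \<longrightarrow> emeasure \<mu> K < \<infinity>)"

definition globally_lipschitz :: "('a::euclidean_space \<Rightarrow> 'a) \<Rightarrow> bool" where
  "globally_lipschitz F \<longleftrightarrow> (\<exists>L. L-lipschitz_on UNIV F)"

text \<open>For a globally Lipschitz \<open>F\<close> there is exactly one \<open>\<Phi>\<close> with the following property.\<close>

definition is_flow_of :: "('a::euclidean_space \<Rightarrow> real \<Rightarrow> 'a) \<Rightarrow> ('a \<Rightarrow> 'a) \<Rightarrow> bool" where
  "is_flow_of \<Phi> F \<longleftrightarrow>
     (\<forall>x. \<Phi> x 0 = x \<and> (\<forall>t. (\<Phi> x has_vector_derivative F (\<Phi> x t)) (at t)))"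

definition flow_invariant :: "'a measure \<Rightarrow> ('a::euclidean_space \<Rightarrow> real \<Rightarrow> 'a) \<Rightarrow> bool" where
  "flow_invariant \<mu> \<Phi> \<longleftrightarrow>
     (\<forall>A\<in>sets \<mu>. \<forall>t. emeasure \<mu> ((\<lambda>x. \<Phi> x t) ` A) = emeasure \<mu> A)"

definition tau_p :: "('a::euclidean_space \<Rightarrow> real \<Rightarrow> 'a) \<Rightarrow> 'a set \<Rightarrow> 'a \<Rightarrow> ereal" where
  "tau_p \<Phi> \<Omega> x = Inf (ereal ` {s. 0 < s \<and> \<Phi> x s \<notin> \<Omega>})"

definition tau_m :: "('a::euclidean_space \<Rightarrow> real \<Rightarrow> 'a) \<Rightarrow> 'a set \<Rightarrow> 'a \<Rightarrow> ereal" where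
  "tau_m \<Phi> \<Omega> x = Inf (ereal ` {s. 0 < s \<and> \<Phi> x (- s) \<notin> \<Omega>})"

definition exit_point :: "('a::euclidean_space \<Rightarrow> real \<Rightarrow> 'a) \<Rightarrow> 'a set \<Rightarrow> 'a \<Rightarrow> 'a" where
  "exit_point \<Phi> \<Omega> x = \<Phi> x (real_of_ereal (tau_p \<Phi> \<Omega> x))"

definition entry_point :: "('a::euclidean_space \<Rightarrow> real \<Rightarrow> 'a) \<Rightarrow> 'a set \<Rightarrow> 'a \<Rightarrow> 'a" where
  "entry_point \<Phi> \<Omega> x = \<Phi> x (- real_of_ereal (tau_m \<Phi> \<Omega> x))"

definition Gamma_p :: "('a::euclidean_space \<Rightarrow> real \<Rightarrow> 'a) \<Rightarrow> 'a set \<Rightarrow> 'a set" where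
  "Gamma_p \<Phi> \<Omega> = {y \<in> frontier \<Omega>. \<exists>x\<in>\<Omega>. tau_p \<Phi> \<Omega> x < \<infinity> \<and> y = exit_point \<Phi> \<Omega> x}"

definition Gamma_m :: "('a::euclidean_space \<Rightarrow> real \<Rightarrow> 'a) \<Rightarrow> 'a set \<Rightarrow> 'a set" where
  "Gamma_m \<Phi> \<Omega> = {y \<in> frontier \<Omega>. \<exists>x\<in>\<Omega>. tau_m \<Phi> \<Omega> x < \<infinity> \<and> y = entry_point \<Phi> \<Omega> x}"

text \<open>
  The values \<open>\<tau>\<^sub>-(y)\<close> for \<open>y \<in> \<Gamma>\<^sub>+\<close> and \<open>\<tau>\<^sub>+(y)\<close> for \<open>y \<in> \<Gamma>\<^sub>-\<close>: the length of the integral curve in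
  \<open>\<Omega>\<close> that ends, respectively starts, at \<open>y\<close>. The number \<open>l\<close> does not depend on \<open>x\<close>.
\<close>

definition tau_m_bd :: "('a::euclidean_space \<Rightarrow> real \<Rightarrow> 'a) \<Rightarrow> 'a set \<Rightarrow> 'a \<Rightarrow> ereal" where
  "tau_m_bd \<Phi> \<Omega> y =
     (THE l. \<exists>x\<in>\<Omega>. tau_p \<Phi> \<Omega> x < \<infinity> \<and> y = exit_point \<Phi> \<Omega> x \<and> l = tau_m \<Phi> \<Omega> x + tau_p \<Phi> \<Omega> x)"

definition tau_p_bd :: "('a::euclidean_space \<Rightarrow> real \<Rightarrow> 'a) \<Rightarrow> 'a set \<Rightarrow> 'a \<Rightarrow> ereal" where
  "tau_p_bd \<Phi> \<Omega> y =
     (THE l. \<exists>x\<in>\<Omega>. tau_m \<Phi> \<Omega> x < \<infinity> \<and> y = entry_point \<Phi> \<Omega> x \<and> l = tau_m \<Phi> \<Omega> x + tau_p \<Phi> \<Omega> x)"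

text \<open>
  The boundary measures, characterised by their integration formulas. The formulas are required for
  the nonnegative \<open>f \<in> L\<^sup>1(\<Omega> \<times> (0,T), \<mu> \<otimes> dt)\<close>, as identities in \<open>[0,\<infinity>]\<close>; splitting a general \<open>f\<close>
  into its positive and negative parts shows that this is the formula for all \<open>f \<in> L\<^sup>1\<close>, including
  the absolute convergence of the iterated integrals. (Written with Bochner integrals, the formula
  would be affected by the convention that a divergent integral is \<open>0\<close>.)
\<close>

definition is_outgoing_measure ::
    "'a measure \<Rightarrow> ('a::euclidean_space \<Rightarrow> real \<Rightarrow> 'a) \<Rightarrow> 'a set \<Rightarrow> 'a measure \<Rightarrow> bool" where
  "is_outgoing_measure \<mu> \<Phi> \<Omega> \<mu>p \<longleftrightarrow>
     sets \<mu>p = sets (restrict_space borel (Gamma_p \<Phi> \<Omega>)) \<and>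
     (\<forall>T>0. \<forall>f :: 'a \<times> real \<Rightarrow> real.
        (\<forall>z. 0 \<le> f z) \<and> set_integrable (\<mu> \<Otimes>\<^sub>M lborel) (\<Omega> \<times> {0<..<T}) f \<longrightarrow>
        (\<integral>\<^sup>+z\<in>\<Omega> \<times> {0<..<T}. ennreal (f z) \<partial>(\<mu> \<Otimes>\<^sub>M lborel)) =
          (\<integral>\<^sup>+t\<in>{0<..<T}. (\<integral>\<^sup>+y.
             (\<integral>\<^sup>+s\<in>{s. 0 < s \<and> ereal s < min (tau_m_bd \<Phi> \<Omega> y) (ereal t)}.
                ennreal (f (\<Phi> y (- s), t - s)) \<partial>lborel) \<partial>\<mu>p) \<partial>lborel) +
          (\<integral>\<^sup>+x\<in>\<Omega>.
             (\<integral>\<^sup>+s\<in>{s. 0 < s \<and> ereal s < min (tau_m \<Phi> \<Omega> x) (ereal T)}.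
                ennreal (f (\<Phi> x (- s), T - s)) \<partial>lborel) \<partial>\<mu>))"

definition is_incoming_measure ::
    "'a measure \<Rightarrow> ('a::euclidean_space \<Rightarrow> real \<Rightarrow> 'a) \<Rightarrow> 'a set \<Rightarrow> 'a measure \<Rightarrow> bool" where
  "is_incoming_measure \<mu> \<Phi> \<Omega> \<mu>m \<longleftrightarrow>
     sets \<mu>m = sets (restrict_space borel (Gamma_m \<Phi> \<Omega>)) \<and>
     (\<forall>T>0. \<forall>f :: 'a \<times> real \<Rightarrow> real.
        (\<forall>z. 0 \<le> f z) \<and> set_integrable (\<mu> \<Otimes>\<^sub>M lborel) (\<Omega> \<times> {0<..<T}) f \<longrightarrow>
        (\<integral>\<^sup>+z\<in>\<Omega> \<times> {0<..<T}. ennreal (f z) \<partial>(\<mu> \<Otimes>\<^sub>M lborel)) =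
          (\<integral>\<^sup>+t\<in>{0<..<T}. (\<integral>\<^sup>+y.
             (\<integral>\<^sup>+s\<in>{s. 0 < s \<and> ereal s < min (tau_p_bd \<Phi> \<Omega> y) (ereal (T - t))}.
                ennreal (f (\<Phi> y s, t + s)) \<partial>lborel) \<partial>\<mu>m) \<partial>lborel) +
          (\<integral>\<^sup>+x\<in>\<Omega>.
             (\<integral>\<^sup>+s\<in>{s. 0 < s \<and> ereal s < min (tau_p \<Phi> \<Omega> x) (ereal T)}.
                ennreal (f (\<Phi> x s, s)) \<partial>lborel) \<partial>\<mu>))"

text \<open>
  By second countability, the union below is itself an open set on which \<open>\<psi>\<close> vanishes \<open>\<mu>\<close>-a.e., hence
  the maximal one.
\<close>

definition ess_support :: "'a::euclidean_space measure \<Rightarrow> 'a set \<Rightarrow> ('a \<Rightarrow> real) \<Rightarrow> 'a set" where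
  "ess_support \<mu> \<Omega> \<psi> = \<Omega> - \<Union>{W. open W \<and> W \<subseteq> \<Omega> \<and> (AE x\<in>W in \<mu>. \<psi> x = 0)}"

definition flow_deriv :: "('a::euclidean_space \<Rightarrow> real \<Rightarrow> 'a) \<Rightarrow> ('a \<Rightarrow> real) \<Rightarrow> 'a \<Rightarrow> real" where
  "flow_deriv \<Phi> \<psi> x = deriv (\<lambda>s. \<psi> (\<Phi> x s)) 0"

definition test_functions ::
    "'a measure \<Rightarrow> ('a::euclidean_space \<Rightarrow> real \<Rightarrow> 'a) \<Rightarrow> 'a set \<Rightarrow> ('a \<Rightarrow> real) set" where
  "test_functions \<mu> \<Phi> \<Omega> = {\<psi>.
     set_borel_measurable \<mu> \<Omega> \<psi> \<and> bounded (\<psi> ` \<Omega>) \<and> compact (ess_support \<mu> \<Omega> \<psi>) \<and>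
     (\<forall>x\<in>\<Omega>. (\<lambda>s. \<psi> (\<Phi> x s)) C1_differentiable_on
              {s. - tau_m \<Phi> \<Omega> x < ereal s \<and> ereal s < tau_p \<Phi> \<Omega> x}) \<and>
     set_borel_measurable \<mu> \<Omega> (flow_deriv \<Phi> \<psi>) \<and> bounded (flow_deriv \<Phi> \<psi> ` \<Omega>)}"

definition weak_transport ::
    "'a measure \<Rightarrow> ('a::euclidean_space \<Rightarrow> real \<Rightarrow> 'a) \<Rightarrow> 'a set \<Rightarrow> ('a \<Rightarrow> real) \<Rightarrow> ('a \<Rightarrow> real) \<Rightarrow> bool"
  where
  "weak_transport \<mu> \<Phi> \<Omega> f g \<longleftrightarrow>
     set_integrable \<mu> \<Omega> f \<and> set_integrable \<mu> \<Omega> g \<and>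
     (\<forall>\<psi>\<in>test_functions \<mu> \<Phi> \<Omega>.
        (LINT x:\<Omega>|\<mu>. g x * \<psi> x) = (LINT x:\<Omega>|\<mu>. f x * flow_deriv \<Phi> \<psi> x))"

definition dom_Tmax ::
    "'a measure \<Rightarrow> ('a::euclidean_space \<Rightarrow> real \<Rightarrow> 'a) \<Rightarrow> 'a set \<Rightarrow> ('a \<Rightarrow> real) set" where
  "dom_Tmax \<mu> \<Phi> \<Omega> = {f. \<exists>g. weak_transport \<mu> \<Phi> \<Omega> f g}"

text \<open>The choice picks a representative: \<open>g\<close> is determined \<open>\<mu>\<close>-a.e. on \<open>\<Omega>\<close>.\<close>

definition Tmax ::
    "'a measure \<Rightarrow> ('a::euclidean_space \<Rightarrow> real \<Rightarrow> 'a) \<Rightarrow> 'a set \<Rightarrow> ('a \<Rightarrow> real) \<Rightarrow> 'a \<Rightarrow> real" where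
  "Tmax \<mu> \<Phi> \<Omega> f = (SOME g. weak_transport \<mu> \<Phi> \<Omega> f g)"

text \<open>
  The representative \<open>f\<^sup>\<sharp>\<close>. Integrals along characteristics are taken with respect to \<open>lebesgue\<close>: if
  \<open>\<mu>\<close> is a completed measure, an element of \<open>L\<^sup>1(\<Omega>, \<mu>)\<close> is along almost every characteristic Lebesgue
  measurable, but not necessarily Borel measurable.
\<close>

definition sharp_rep ::
    "'a measure \<Rightarrow> ('a::euclidean_space \<Rightarrow> real \<Rightarrow> 'a) \<Rightarrow> 'a set \<Rightarrow> ('a \<Rightarrow> real) \<Rightarrow> ('a \<Rightarrow> real) \<Rightarrow> bool"
  where
  "sharp_rep \<mu> \<Phi> \<Omega> f fs \<longleftrightarrow>
     set_integrable \<mu> \<Omega> fs \<and> (AE x\<in>\<Omega> in \<mu>. fs x = f x) \<and>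
     (AE x\<in>\<Omega> in \<mu>. \<forall>t1 t2.
        - tau_m \<Phi> \<Omega> x < ereal t1 \<and> t1 \<le> t2 \<and> ereal t2 < tau_p \<Phi> \<Omega> x \<longrightarrow>
        fs (\<Phi> x t1) - fs (\<Phi> x t2) = (LINT s:{t1..t2}|lebesgue. Tmax \<mu> \<Phi> \<Omega> f (\<Phi> x s)))"

text \<open>
  \<open>trace_p \<dots> f v\<close> means \<open>B\<^sup>+ f = v\<close> and \<open>trace_m \<dots> f v\<close> means \<open>B\<^sup>- f = v\<close>, up to null sets of the
  boundary measure. The choice of \<open>f\<^sup>\<sharp>\<close> does not matter.
\<close>

definition trace_p ::
    "'a measure \<Rightarrow> ('a::euclidean_space \<Rightarrow> real \<Rightarrow> 'a) \<Rightarrow> 'a set \<Rightarrow> 'a measure \<Rightarrow>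
     ('a \<Rightarrow> real) \<Rightarrow> ('a \<Rightarrow> real) \<Rightarrow> bool" where
  "trace_p \<mu> \<Phi> \<Omega> \<mu>p f v \<longleftrightarrow>
     f \<in> dom_Tmax \<mu> \<Phi> \<Omega> \<and> v \<in> borel_measurable \<mu>p \<and>
     (\<exists>fs. sharp_rep \<mu> \<Phi> \<Omega> f fs \<and>
        (AE y in \<mu>p. ((\<lambda>t. fs (\<Phi> y (- t))) \<longlongrightarrow> v y) (at_right 0)))"

definition trace_m ::
    "'a measure \<Rightarrow> ('a::euclidean_space \<Rightarrow> real \<Rightarrow> 'a) \<Rightarrow> 'a set \<Rightarrow> 'a measure \<Rightarrow>
     ('a \<Rightarrow> real) \<Rightarrow> ('a \<Rightarrow> real) \<Rightarrow> bool" where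
  "trace_m \<mu> \<Phi> \<Omega> \<mu>m f v \<longleftrightarrow>
     f \<in> dom_Tmax \<mu> \<Phi> \<Omega> \<and> v \<in> borel_measurable \<mu>m \<and>
     (\<exists>fs. sharp_rep \<mu> \<Phi> \<Omega> f fs \<and>
        (AE y in \<mu>m. ((\<lambda>t. fs (\<Phi> y t)) \<longlongrightarrow> v y) (at_right 0)))"

definition solves_bvp ::
    "'a measure \<Rightarrow> ('a::euclidean_space \<Rightarrow> real \<Rightarrow> 'a) \<Rightarrow> 'a set \<Rightarrow> 'a measure \<Rightarrow> real \<Rightarrow>
     ('a \<Rightarrow> real) \<Rightarrow> ('a \<Rightarrow> real) \<Rightarrow> ('a \<Rightarrow> real) \<Rightarrow> bool" where
  "solves_bvp \<mu> \<Phi> \<Omega> \<mu>m lam g u f \<longleftrightarrow>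
     f \<in> dom_Tmax \<mu> \<Phi> \<Omega> \<and>
     (AE x\<in>\<Omega> in \<mu>. lam * f x - Tmax \<mu> \<Phi> \<Omega> f x = g x) \<and>
     trace_m \<mu> \<Phi> \<Omega> \<mu>m f u"

end

theory Submission
  imports Defs
begin

text \<open>
  Along an orbit \<open>s \<mapsto> \<Phi> x s\<close> inside \<open>\<Omega>\<close> the problem is the scalar equation \<open>w' = - lam w + g\<close>, whose
  initial value is prescribed by \<open>u\<close> where the orbit enters \<open>\<Omega>\<close>. The given \<open>f\<close> is the variation of
  constants formula for this equation. What has to be shown is that statements about single orbits and
  statements up to null sets of \<open>\<mu>\<close>, \<open>\<mu>\<^sub>-\<close> and \<open>\<mu>\<^sub>+\<close> can be exchanged.

  The exchange rests on one formula (\<open>incoming_formula\<close>), which follows from the characterisation of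
  \<open>\<mu>\<^sub>-\<close> by inserting \<open>f(x,t) = h(x)\<close> restricted to \<open>\<tau>\<^sub>-(x) < t < \<tau>\<^sub>-(x) + 1\<close>:
  the integral of \<open>h\<close> over \<open>{\<tau>\<^sub>- < \<infinity>}\<close> is the integral over \<open>y \<in> \<Gamma>\<^sub>-\<close>, with respect to \<open>\<mu>\<^sub>-\<close>, of the integral of
  \<open>h\<close> along the orbit that starts at \<open>y\<close>. Time reversal gives the same for \<open>\<mu>\<^sub>+\<close>. Comparing the two on
  orbits of finite length shows how \<open>\<mu>\<^sub>-\<close> is transported to \<open>\<mu>\<^sub>+\<close> (\<open>boundary_transfer\<close>).

  The solution formula makes sense at points of \<open>\<Gamma>\<^sub>+\<close> too, and there it gives the outgoing trace. Hence for
  nonnegative data everything is a computation with nonnegative integrals: testing the solution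
  with \<open>\<phi>\<close> amounts to testing \<open>g\<close> on \<open>\<Omega>\<close> and \<open>u\<close> on \<open>\<Gamma>\<^sub>-\<close> with the adjoint
  \<open>R\<^sup>*\<phi>(z)\<close>, the integral of \<open>exp (- lam t) \<phi>(\<Phi> z t)\<close> over \<open>0 < t < \<tau>\<^sub>+(z)\<close> (\<open>resolvent_duality\<close>), and the outflow is
  obtained by testing with \<open>exp (- lam \<tau>\<^sub>+)\<close> (\<open>resolvent_outflow\<close>). Since \<open>R\<^sup>* lam + exp (- lam \<tau>\<^sub>+) = 1\<close>, the two add up to
  the mass balance \<open>resolvent_balance\<close>, which is the norm identity; for signed data it
  becomes the inequality. Applied to indicator functions of null sets, \<open>incoming_formula\<close>, its mirror image and
  \<open>boundary_transfer\<close> provide the almost everywhere statements.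

  The weak equation is the duality for \<open>\<phi> = lam \<psi> - d\<psi>/ds\<close>, because then \<open>R\<^sup>*\<phi>\<close> is \<open>\<psi>\<close> on \<open>\<Omega>\<close> and \<open>0\<close> on \<open>\<Gamma>\<^sub>-\<close>
  by the fundamental theorem of calculus along the orbits. That the transport operator is determined
  by the weak equation requires enough test functions; averages of continuous functions along
  the flow suffice (\<open>forward_average_test_function\<close>). Finally, two solutions differ along almost
  every orbit by a multiple of \<open>exp (- lam s)\<close>, and this multiple is \<open>0\<close>, by the
  boundary condition if the orbit has a starting point and by integrability if it has none
  (\<open>solution_unique\<close>).

  If \<open>\<mu>\<close> is a completed measure, the data are only almost everywhere equal to Borel functions. All integrals are
  therefore taken with the underlying Borel measure \<open>\<nu>\<close> and Borel representatives, and
  the results are carried over to \<open>\<mu>\<close> at the end.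
\<close>

section \<open>The flow of a globally Lipschitz field\<close>

text \<open>Gronwall's inequality: the squared distance of two solutions, multiplied by \<open>exp (- 2 L t)\<close>, is
  nonincreasing.\<close>

lemma solutions_distance_bound_pos:
  fixes F :: "'a::euclidean_space \<Rightarrow> 'a" and X Y :: "real \<Rightarrow> 'a"
  assumes F: "L-lipschitz_on UNIV F"
    and X: "\<And>t. (X has_vector_derivative F (X t)) (at t)"
    and Y: "\<And>t. (Y has_vector_derivative F (Y t)) (at t)"
    and t: "0 \<le> t"
  shows "norm (X t - Y t) ^ 2 \<le> exp (2 * L * t) * norm (X 0 - Y 0) ^ 2"
proof -
  define q where "q s = (X s - Y s) \<bullet> (X s - Y s)" for s
  define d where "d s = exp (- (2 * L * s)) * q s" for s
  define d' where "d' s = exp (- (2 * L * s)) *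
    (2 * ((F (X s) - F (Y s)) \<bullet> (X s - Y s)) - 2 * L * q s)" for s
  have "(d has_real_derivative d' s) (at s)" for s
  proof -
    have "((\<lambda>s. X s - Y s) has_vector_derivative (F (X s) - F (Y s))) (at s)"
      by (intro derivative_intros X Y)
    then have D: "((\<lambda>s. X s - Y s) has_derivative (\<lambda>h. h *\<^sub>R (F (X s) - F (Y s)))) (at s)"
      by (simp add: has_vector_derivative_def)
    have "((\<lambda>s. (X s - Y s) \<bullet> (X s - Y s)) has_derivative
        (\<lambda>h. (X s - Y s) \<bullet> (h *\<^sub>R (F (X s) - F (Y s))) + (h *\<^sub>R (F (X s) - F (Y s))) \<bullet> (X s - Y s))) (at s)"
      by (rule has_derivative_inner[OF D D])
    then have q': "(q has_real_derivative 2 * ((F (X s) - F (Y s)) \<bullet> (X s - Y s))) (at s)"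
      unfolding has_field_derivative_def q_def[abs_def]
      by (rule has_derivative_eq_rhs) (auto simp: inner_commute algebra_simps)
    show ?thesis
      unfolding d_def[abs_def] d'_def
      by ((rule derivative_eq_intros q' refl)+, simp add: algebra_simps)
  qed
  moreover have "d' s \<le> 0" for s
  proof -
    have "(F (X s) - F (Y s)) \<bullet> (X s - Y s) \<le> norm (F (X s) - F (Y s)) * norm (X s - Y s)"
      by (rule norm_cauchy_schwarz)
    also have "\<dots> \<le> (L * norm (X s - Y s)) * norm (X s - Y s)"
      using lipschitz_onD[OF F, of "X s" "Y s"] by (intro mult_right_mono) (auto simp: dist_norm)
    also have "\<dots> = L * q s"
      by (simp add: q_def power2_norm_eq_inner[symmetric] power2_eq_square)
    finally show ?thesis
      unfolding d'_def by (intro mult_nonneg_nonpos) auto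
  qed
  ultimately have "d t \<le> d 0"
    using t by (intro DERIV_nonpos_imp_nonincreasing[of 0 t d]) auto
  then have "exp (2 * L * t) * d t \<le> exp (2 * L * t) * d 0"
    by simp
  moreover have "exp (2 * L * t) * d t = norm (X t - Y t) ^ 2"
    unfolding d_def q_def mult.assoc[symmetric] exp_add[symmetric] by (simp add: power2_norm_eq_inner)
  moreover have "d 0 = norm (X 0 - Y 0) ^ 2"
    by (simp add: d_def q_def power2_norm_eq_inner)
  ultimately show ?thesis by simp
qed

lemma solutions_distance_bound:
  fixes F :: "'a::euclidean_space \<Rightarrow> 'a" and X Y :: "real \<Rightarrow> 'a"
  assumes F: "L-lipschitz_on UNIV F"
    and X: "\<And>t. (X has_vector_derivative F (X t)) (at t)"
    and Y: "\<And>t. (Y has_vector_derivative F (Y t)) (at t)"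
  shows "norm (X t - Y t) ^ 2 \<le> exp (2 * L * \<bar>t\<bar>) * norm (X 0 - Y 0) ^ 2"
proof (cases "0 \<le> t")
  case True
  then show ?thesis
    using solutions_distance_bound_pos[OF F X Y] by simp
next
  case False
  have F': "L-lipschitz_on UNIV (\<lambda>x. - F x)"
    using F by (simp add: lipschitz_on_def dist_minus)
  have rev: "((\<lambda>t. Z (- t)) has_vector_derivative - F (Z (- t))) (at t)"
    if "\<And>t. (Z has_vector_derivative F (Z t)) (at t)" for Z t
  proof -
    have "(uminus has_vector_derivative - 1) (at t)"
      by (auto intro!: derivative_eq_intros)
    from vector_diff_chain_at[OF this that] show ?thesis by (simp add: o_def)
  qed
  show ?thesis
    using solutions_distance_bound_pos[OF F' rev[OF X] rev[OF Y], of "- t"] False by simp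
qed

lemma flow_add:
  assumes "globally_lipschitz F" "is_flow_of \<Phi> F"
  shows "\<Phi> (\<Phi> x s) t = \<Phi> x (s + t)"
proof -
  obtain L where L: "L-lipschitz_on UNIV F"
    using assms by (auto simp: globally_lipschitz_def)
  have sol: "\<Phi> x 0 = x" "(\<Phi> x has_vector_derivative F (\<Phi> x t)) (at t)" for x t
    using assms by (auto simp: is_flow_of_def)
  have "((\<lambda>t. \<Phi> x (s + t)) has_vector_derivative F (\<Phi> x (s + t))) (at t)" for t
  proof -
    have "((\<lambda>t. s + t) has_vector_derivative 1) (at t)"
      by (auto intro!: derivative_eq_intros)
    from vector_diff_chain_at[OF this sol(2)] show ?thesis by (simp add: o_def)
  qed
  from solutions_distance_bound[OF L sol(2) this, of "\<Phi> x s" t] show ?thesis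
    by (simp add: sol)
qed

lemma flow_jointly_continuous:
  assumes "globally_lipschitz F" "is_flow_of \<Phi> F"
  shows "continuous_on UNIV (\<lambda>(x, t). \<Phi> x t)"
proof -
  obtain L where L: "L-lipschitz_on UNIV F"
    using assms by (auto simp: globally_lipschitz_def)
  have sol: "\<Phi> x 0 = x" "(\<Phi> x has_vector_derivative F (\<Phi> x t)) (at t)" for x t
    using assms by (auto simp: is_flow_of_def)
  have close: "norm (\<Phi> x t - \<Phi> y t) ^ 2 \<le> exp (2 * L * \<bar>t\<bar>) * norm (x - y) ^ 2" for x y t
    using solutions_distance_bound[OF L sol(2) sol(2), of x t y] by (simp add: sol)
  have "((\<lambda>z. \<Phi> (fst z) (snd z)) \<longlongrightarrow> \<Phi> x t) (at (x, t))" for x t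
  proof -
    have "((\<lambda>z. exp (2 * L * \<bar>snd z\<bar>) * norm (fst z - x) ^ 2) \<longlongrightarrow>
        exp (2 * L * \<bar>snd (x, t)\<bar>) * norm (fst (x, t) - x) ^ 2) (at (x, t))"
      by (intro tendsto_intros)
    then have "((\<lambda>z. exp (2 * L * \<bar>snd z\<bar>) * norm (fst z - x) ^ 2) \<longlongrightarrow> 0) (at (x, t))"
      by simp
    then have "((\<lambda>z. norm (\<Phi> (fst z) (snd z) - \<Phi> x (snd z)) ^ 2) \<longlongrightarrow> 0) (at (x, t))"
      by (rule Lim_null_comparison[rotated]) (auto intro!: always_eventually simp: close)
    then have "((\<lambda>z. sqrt (norm (\<Phi> (fst z) (snd z) - \<Phi> x (snd z)) ^ 2)) \<longlongrightarrow> sqrt 0) (at (x, t))"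
      by (rule tendsto_real_sqrt)
    then have 1: "((\<lambda>z. \<Phi> (fst z) (snd z) - \<Phi> x (snd z)) \<longlongrightarrow> 0) (at (x, t))"
      by (simp add: tendsto_norm_zero_iff)
    have "isCont (\<Phi> x) t"
      using has_vector_derivative_continuous[OF sol(2)] .
    then have 2: "((\<lambda>z. \<Phi> x (snd z)) \<longlongrightarrow> \<Phi> x (snd (x, t))) (at (x, t))"
      by (intro isCont_tendsto_compose[of _ "\<Phi> x"] tendsto_intros) auto
    from tendsto_add[OF 1 2] show ?thesis
      by simp
  qed
  then show ?thesis
    by (auto simp: continuous_on_def case_prod_unfold intro: tendsto_within_subset)
qed

section \<open>Exit times of a continuous flow\<close>

lemma AE_lborel_ex_between:
  fixes a b :: real
  assumes "AE s in lborel. P s" "a < b"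
  shows "\<exists>s. a < s \<and> s < b \<and> P s"
proof (rule ccontr)
  assume no: "\<not> ?thesis"
  have "AE s in lborel. s \<notin> {a<..<b}"
    using assms(1) by eventually_elim (use no in auto)
  then have "emeasure lborel {a<..<b} = 0"
    by (subst (asm) AE_iff_measurable[of "{a<..<b}"]) auto
  then show False using assms(2) by auto
qed

text \<open>All assumptions of this locale, and of those that extend it by measures, are invariant under time reversal. Every fact
  about exit times, \<open>\<Gamma>\<^sub>+\<close> and \<open>\<mu>\<^sub>+\<close> therefore has a mirror image about entry times, \<open>\<Gamma>\<^sub>-\<close>
  and \<open>\<mu>\<^sub>-\<close>, which is obtained by instantiation.\<close>

locale continuous_flow =
  fixes \<Phi> :: "'a::euclidean_space \<Rightarrow> real \<Rightarrow> 'a" and \<Omega> :: "'a set"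
  assumes flow_continuous: "continuous_on UNIV (\<lambda>(x, t). \<Phi> x t)"
    and flow_zero [simp]: "\<Phi> x 0 = x"
    and flow_flow [simp]: "\<Phi> (\<Phi> x s) t = \<Phi> x (s + t)"
    and domain_open: "open \<Omega>"
begin

abbreviation "\<tau>p \<equiv> tau_p \<Phi> \<Omega>"
abbreviation "\<tau>m \<equiv> tau_m \<Phi> \<Omega>"
abbreviation "ahead x \<equiv> {t. 0 < t \<and> ereal t < \<tau>p x}"
abbreviation "behind x \<equiv> {t. 0 < t \<and> ereal t < \<tau>m x}"
abbreviation "on_orbit x s \<equiv> - \<tau>m x < ereal s \<and> ereal s < \<tau>p x"

lemma isCont_flow: "isCont (\<Phi> x) t"
proof -
  have "continuous_on UNIV (\<lambda>t. (\<lambda>(x, t). \<Phi> x t) (x, t))"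
    by (rule continuous_on_compose2[OF flow_continuous]) (auto intro!: continuous_intros)
  then show ?thesis
    by (simp add: continuous_on_eq_continuous_at)
qed

lemma continuous_on_flow [continuous_intros]:
  assumes "continuous_on S f" "continuous_on S g"
  shows "continuous_on S (\<lambda>z. \<Phi> (f z) (g z))"
proof -
  have "continuous_on S (\<lambda>z. (\<lambda>(x, t). \<Phi> x t) (f z, g z))"
    by (rule continuous_on_compose2[OF flow_continuous]) (auto intro!: continuous_intros assms)
  then show ?thesis by simp
qed

lemma measurable_flow [measurable (raw)]:
  assumes "f \<in> borel_measurable M" "g \<in> borel_measurable M"
  shows "(\<lambda>z. \<Phi> (f z) (g z)) \<in> borel_measurable M"
proof -
  have "(\<lambda>(x, t). \<Phi> x t) \<in> borel_measurable (borel \<Otimes>\<^sub>M borel)"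
    using borel_measurable_continuous_onI[OF flow_continuous] by (simp add: borel_prod)
  then have "(\<lambda>z. (\<lambda>(x, t). \<Phi> x t) (f z, g z)) \<in> borel_measurable M"
    using assms by measurable
  then show ?thesis by simp
qed

lemma open_times_in: "open W \<Longrightarrow> open {s. \<Phi> x s \<in> W}"
  using open_vimage[of W "\<Phi> x"] isCont_flow
  by (simp add: vimage_def continuous_on_eq_continuous_at)

lemma reversed: "continuous_flow (\<lambda>x t. \<Phi> x (- t)) \<Omega>"
  by unfold_locales (auto intro!: continuous_intros domain_open simp: case_prod_unfold)

lemma tau_reversed:
  "tau_p (\<lambda>x t. \<Phi> x (- t)) \<Omega> = tau_m \<Phi> \<Omega>"
  "tau_m (\<lambda>x t. \<Phi> x (- t)) \<Omega> = tau_p \<Phi> \<Omega>"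
  by (auto simp: tau_p_def tau_m_def fun_eq_iff)

lemma tau_p_nonneg: "0 \<le> \<tau>p x"
  unfolding tau_p_def by (rule Inf_greatest) auto

lemma tau_m_nonneg: "0 \<le> \<tau>m x"
  unfolding tau_m_def by (rule Inf_greatest) auto

lemma before_tau_p: "0 < s \<Longrightarrow> ereal s < \<tau>p x \<Longrightarrow> \<Phi> x s \<in> \<Omega>"
  by (rule ccontr) (auto simp: tau_p_def not_le[symmetric] intro: Inf_lower)

text \<open>Since \<open>\<Omega>\<close> is open, an orbit that stays in \<open>\<Omega>\<close> up to and including time \<open>c\<close> stays a little longer;
  this is why the strict inequality is the one with a pointwise characterisation.\<close>

lemma less_tau_p_iff:
  assumes "0 < c"
  shows "ereal c < \<tau>p x \<longleftrightarrow> (\<forall>s. 0 < s \<and> s \<le> c \<longrightarrow> \<Phi> x s \<in> \<Omega>)"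
proof
  assume "ereal c < \<tau>p x"
  then show "\<forall>s. 0 < s \<and> s \<le> c \<longrightarrow> \<Phi> x s \<in> \<Omega>"
    by (auto intro!: before_tau_p elim: le_less_trans[rotated])
next
  assume R: "\<forall>s. 0 < s \<and> s \<le> c \<longrightarrow> \<Phi> x s \<in> \<Omega>"
  then have "\<Phi> x c \<in> \<Omega>" using assms by auto
  then obtain e where e: "e > 0" "\<And>s. dist s c < e \<Longrightarrow> \<Phi> x s \<in> \<Omega>"
    using open_times_in[OF domain_open, of x] unfolding open_dist by auto
  have "\<Phi> x s \<in> \<Omega>" if "0 < s" "s < c + e" for s
    using that R e by (cases "s \<le> c") (auto simp: dist_real_def)
  then have "ereal (c + e) \<le> \<tau>p x"
    unfolding tau_p_def by (intro Inf_greatest) (auto simp: not_less[symmetric])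
  then show "ereal c < \<tau>p x"
    using e by (auto elim: less_le_trans[rotated])
qed

lemma tau_p_pos_iff: "0 < \<tau>p x \<longleftrightarrow> (\<exists>c>0. \<forall>s. 0 < s \<and> s \<le> c \<longrightarrow> \<Phi> x s \<in> \<Omega>)"
proof
  assume "0 < \<tau>p x"
  then obtain c where "0 < ereal c" "ereal c < \<tau>p x"
    by (metis ereal_dense2)
  then show "\<exists>c>0. \<forall>s. 0 < s \<and> s \<le> c \<longrightarrow> \<Phi> x s \<in> \<Omega>"
    using less_tau_p_iff[of c x] by auto
next
  assume "\<exists>c>0. \<forall>s. 0 < s \<and> s \<le> c \<longrightarrow> \<Phi> x s \<in> \<Omega>"
  then obtain c where "c > 0" "ereal c < \<tau>p x"
    using less_tau_p_iff by auto
  then show "0 < \<tau>p x"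
    by (metis ereal_less(2) less_trans)
qed

lemma tau_p_pos: "x \<in> \<Omega> \<Longrightarrow> 0 < \<tau>p x"
proof -
  assume "x \<in> \<Omega>"
  then obtain e where e: "e > 0" "\<And>s. dist s 0 < e \<Longrightarrow> \<Phi> x s \<in> \<Omega>"
    using open_times_in[OF domain_open, of x] unfolding open_dist
    by (metis (mono_tags, lifting) flow_zero mem_Collect_eq)
  then show ?thesis
    unfolding tau_p_pos_iff by (intro exI[of _ "e/2"]) auto
qed

lemma exit_point_not_in:
  assumes "0 < \<tau>p x" "\<tau>p x < \<infinity>"
  shows "\<Phi> x (real_of_ereal (\<tau>p x)) \<notin> \<Omega>"
proof
  assume in_\<Omega>: "\<Phi> x (real_of_ereal (\<tau>p x)) \<in> \<Omega>"
  obtain c where c: "\<tau>p x = ereal c" "c > 0"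
    using assms by (cases "\<tau>p x") auto
  have "\<Phi> x s \<in> \<Omega>" if "0 < s" "s \<le> c" for s
    using that in_\<Omega> before_tau_p[of s x] c by (cases "s = c") auto
  then have "ereal c < \<tau>p x"
    using less_tau_p_iff c by blast
  with c show False by simp
qed

end

text \<open>Exit times are compared through the real numbers below them, since that is what \<open>less_tau_p_iff\<close>
  describes.\<close>

lemma ereal_eqI_pos:
  fixes a b :: ereal
  assumes "0 \<le> a" "0 \<le> b" "\<And>c. 0 < c \<Longrightarrow> ereal c < a \<longleftrightarrow> ereal c < b"
  shows "a = b"
proof -
  have "a' \<le> b'" if "0 \<le> b'" "\<And>c. 0 < c \<Longrightarrow> ereal c < a' \<Longrightarrow> ereal c < b'" for a' b' :: ereal
  proof (rule ccontr)
    assume "\<not> a' \<le> b'"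
    then obtain c where "b' < ereal c" "ereal c < a'"
      by (metis ereal_dense2 not_le)
    moreover from this that(1) have "0 < c"
      by (metis ereal_less(2) le_less_trans)
    ultimately show False using that(2) by (meson less_asym)
  qed
  then show ?thesis using assms by (metis antisym)
qed

context continuous_flow
begin

lemma tau_p_shift:
  assumes "0 < s" "ereal s < \<tau>p x"
  shows "\<tau>p (\<Phi> x s) = \<tau>p x - ereal s"
proof (rule ereal_eqI_pos)
  show "0 \<le> \<tau>p (\<Phi> x s)" by (rule tau_p_nonneg)
  show "0 \<le> \<tau>p x - ereal s"
    using assms by (cases "\<tau>p x") auto
  fix c :: real assume c: "0 < c"
  have "ereal c < \<tau>p (\<Phi> x s) \<longleftrightarrow> (\<forall>r. 0 < r \<and> r \<le> c \<longrightarrow> \<Phi> x (s + r) \<in> \<Omega>)"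
    using less_tau_p_iff[OF c] by simp
  also have "\<dots> \<longleftrightarrow> (\<forall>r. 0 < r \<and> r \<le> s + c \<longrightarrow> \<Phi> x r \<in> \<Omega>)"
  proof safe
    fix r assume H: "\<forall>r. 0 < r \<and> r \<le> c \<longrightarrow> \<Phi> x (s + r) \<in> \<Omega>" and r: "0 < r" "r \<le> s + c"
    show "\<Phi> x r \<in> \<Omega>"
    proof (cases "r \<le> s")
      case True
      then show ?thesis using r assms less_tau_p_iff by blast
    next
      case False
      then show ?thesis using H[rule_format, of "r - s"] r by simp
    qed
  next
    fix r assume "\<forall>r. 0 < r \<and> r \<le> s + c \<longrightarrow> \<Phi> x r \<in> \<Omega>" "0 < r" "r \<le> c"
    then show "\<Phi> x (s + r) \<in> \<Omega>" using assms by simp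
  qed
  also have "\<dots> \<longleftrightarrow> ereal (s + c) < \<tau>p x"
    using less_tau_p_iff[of "s + c" x] c assms by simp
  also have "\<dots> \<longleftrightarrow> ereal c < \<tau>p x - ereal s"
    by (cases "\<tau>p x") auto
  finally show "ereal c < \<tau>p (\<Phi> x s) \<longleftrightarrow> ereal c < \<tau>p x - ereal s" .
qed

lemmas before_tau_m = continuous_flow.before_tau_p[OF reversed, unfolded tau_reversed]
lemmas less_tau_m_iff = continuous_flow.less_tau_p_iff[OF reversed, unfolded tau_reversed]
lemmas tau_m_pos = continuous_flow.tau_p_pos[OF reversed, unfolded tau_reversed]
lemmas entry_point_not_in = continuous_flow.exit_point_not_in[OF reversed, unfolded tau_reversed]
lemmas tau_m_shift_back = continuous_flow.tau_p_shift[OF reversed, unfolded tau_reversed]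

lemma tau_m_shift_inside:
  assumes "x \<in> \<Omega>" "0 < s" "ereal s < \<tau>p x"
  shows "\<tau>m (\<Phi> x s) = \<tau>m x + ereal s"
proof (rule ereal_eqI_pos)
  show "0 \<le> \<tau>m (\<Phi> x s)" by (rule tau_m_nonneg)
  show "0 \<le> \<tau>m x + ereal s"
    using tau_m_nonneg[of x] assms by simp
  fix c :: real assume c: "0 < c"
  have fwd: "\<Phi> x r \<in> \<Omega>" if "0 \<le> r" "r \<le> s" for r
    using that assms less_tau_p_iff[of s x] by (cases "r = 0") auto
  have "ereal c < \<tau>m (\<Phi> x s) \<longleftrightarrow> (\<forall>r. 0 < r \<and> r \<le> c \<longrightarrow> \<Phi> x (s - r) \<in> \<Omega>)"
    using less_tau_m_iff[OF c] by simp
  also have "\<dots> \<longleftrightarrow> (\<forall>r. 0 < r \<and> r \<le> c - s \<longrightarrow> \<Phi> x (- r) \<in> \<Omega>)"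
  proof safe
    fix r assume H: "\<forall>r. 0 < r \<and> r \<le> c \<longrightarrow> \<Phi> x (s - r) \<in> \<Omega>" and r: "0 < r" "r \<le> c - s"
    show "\<Phi> x (- r) \<in> \<Omega>"
      using H[rule_format, of "r + s"] r assms by simp
  next
    fix r assume H: "\<forall>r. 0 < r \<and> r \<le> c - s \<longrightarrow> \<Phi> x (- r) \<in> \<Omega>" and r: "0 < r" "r \<le> c"
    show "\<Phi> x (s - r) \<in> \<Omega>"
      using H[rule_format, of "r - s"] r fwd[of "s - r"] by (cases "r \<le> s") auto
  qed
  also have "\<dots> \<longleftrightarrow> ereal (c - s) < \<tau>m x"
  proof (cases "0 < c - s")
    case True
    then show ?thesis using less_tau_m_iff[OF True, of x] by simp
  next
    case False
    then have "ereal (c - s) \<le> 0" by simp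
    also have "0 < \<tau>m x" using tau_m_pos assms by blast
    finally show ?thesis using False by auto
  qed
  also have "\<dots> \<longleftrightarrow> ereal c < \<tau>m x + ereal s"
    using tau_m_nonneg[of x] by (cases "\<tau>m x") auto
  finally show "ereal c < \<tau>m (\<Phi> x s) \<longleftrightarrow> ereal c < \<tau>m x + ereal s" .
qed

lemma tau_m_shift_boundary:
  assumes "y \<notin> \<Omega>" "0 < s" "ereal s < \<tau>p y"
  shows "\<tau>m (\<Phi> y s) = ereal s"
proof (rule ereal_eqI_pos)
  show "0 \<le> \<tau>m (\<Phi> y s)" by (rule tau_m_nonneg)
  show "0 \<le> ereal s" using assms by simp
  fix c :: real assume c: "0 < c"
  have fwd: "\<Phi> y r \<in> \<Omega>" if "0 < r" "r \<le> s" for r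
    using that assms less_tau_p_iff[of s y] by auto
  have "ereal c < \<tau>m (\<Phi> y s) \<longleftrightarrow> (\<forall>r. 0 < r \<and> r \<le> c \<longrightarrow> \<Phi> y (s - r) \<in> \<Omega>)"
    using less_tau_m_iff[OF c] by simp
  also have "\<dots> \<longleftrightarrow> c < s"
  proof
    assume H: "\<forall>r. 0 < r \<and> r \<le> c \<longrightarrow> \<Phi> y (s - r) \<in> \<Omega>"
    show "c < s" using H[rule_format, of s] assms by (auto simp: not_less[symmetric])
  qed (auto intro: fwd)
  finally show "ereal c < \<tau>m (\<Phi> y s) \<longleftrightarrow> ereal c < ereal s" by simp
qed

text \<open>A description without reference to a point of \<open>\<Omega>\<close> on the orbit: the orbit of \<open>y\<close> enters \<open>\<Omega>\<close> at
  once. It shows that \<open>\<Gamma>\<^sub>-\<close> is a Borel set and that \<open>\<tau>\<^sub>+(y)\<close> can be computed from \<open>y\<close> itself.\<close>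

lemma Gamma_m_eq: "Gamma_m \<Phi> \<Omega> = {y. y \<notin> \<Omega> \<and> 0 < \<tau>p y}"
proof safe
  fix y assume "y \<in> Gamma_m \<Phi> \<Omega>" "y \<in> \<Omega>"
  then show False
    using domain_open by (auto simp: Gamma_m_def frontier_def interior_open)
next
  fix y assume "y \<in> Gamma_m \<Phi> \<Omega>"
  then obtain x where x: "x \<in> \<Omega>" "\<tau>m x < \<infinity>" "y = \<Phi> x (- real_of_ereal (\<tau>m x))"
    by (auto simp: Gamma_m_def entry_point_def)
  obtain c where c: "\<tau>m x = ereal c" "c > 0"
    using tau_m_pos[OF x(1)] x by (cases "\<tau>m x") auto
  have "\<Phi> y r \<in> \<Omega>" if "0 < r" "r \<le> c" for r
  proof (cases "r = c")
    case False
    then show ?thesis using before_tau_m[of "c - r" x] x c that by simp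
  qed (use x c in simp)
  then show "0 < \<tau>p y" unfolding tau_p_pos_iff using c by auto
next
  fix y assume y: "y \<notin> \<Omega>" "0 < \<tau>p y"
  then obtain c where c: "c > 0" "\<And>s. 0 < s \<Longrightarrow> s \<le> c \<Longrightarrow> \<Phi> y s \<in> \<Omega>"
    unfolding tau_p_pos_iff by auto
  then have lt: "ereal c < \<tau>p y" using less_tau_p_iff by auto
  have "((\<lambda>n. \<Phi> y (c / Suc n)) \<longlongrightarrow> \<Phi> y 0) sequentially"
    using LIMSEQ_Suc[OF lim_const_over_n[of c]]
    by (intro isCont_tendsto_compose[OF isCont_flow]) auto
  moreover have "\<Phi> y (c / Suc n) \<in> \<Omega>" for n
    using c by (auto simp: field_simps intro!: c(2))
  ultimately have "y \<in> closure \<Omega>"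
    unfolding closure_sequential
    by (intro exI[of _ "\<lambda>n. \<Phi> y (c / Suc n)"]) simp
  then have "y \<in> frontier \<Omega>"
    using y domain_open by (auto simp: frontier_def interior_open)
  moreover have "\<tau>m (\<Phi> y c) = ereal c"
    using tau_m_shift_boundary y c lt by auto
  then have "y = entry_point \<Phi> \<Omega> (\<Phi> y c)" "\<tau>m (\<Phi> y c) < \<infinity>"
    by (auto simp: entry_point_def)
  ultimately show "y \<in> Gamma_m \<Phi> \<Omega>"
    using c unfolding Gamma_m_def by blast
qed

lemma entry_point_shift:
  assumes "y \<in> Gamma_m \<Phi> \<Omega>" "0 < s" "ereal s < \<tau>p y"
  shows "entry_point \<Phi> \<Omega> (\<Phi> y s) = y"
  using assms tau_m_shift_boundary[of y s] by (simp add: Gamma_m_eq entry_point_def)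

lemma from_entry_point:
  assumes "x \<in> \<Omega>" "\<tau>m x < \<infinity>"
  obtains y s where "y = entry_point \<Phi> \<Omega> x" "y \<in> Gamma_m \<Phi> \<Omega>" "0 < s" "ereal s < \<tau>p y" "x = \<Phi> y s"
    "\<tau>m x = ereal s" "\<tau>p y = \<tau>m x + \<tau>p x"
proof -
  obtain s where s: "\<tau>m x = ereal s" "s > 0"
    using tau_m_pos[OF assms(1)] assms by (cases "\<tau>m x") auto
  define y where "y = entry_point \<Phi> \<Omega> x"
  have y: "y = \<Phi> x (- s)" by (simp add: y_def entry_point_def s)
  have "\<Phi> y r \<in> \<Omega>" if "0 < r" "r \<le> s" for r
    using before_tau_m[of "s - r" x] assms s that y by (cases "r = s") auto
  then have lt: "ereal s < \<tau>p y" using less_tau_p_iff s by blast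
  moreover have "y \<notin> \<Omega>"
    using entry_point_not_in[of x] assms s by (auto simp: y)
  ultimately have "y \<in> Gamma_m \<Phi> \<Omega>"
    using s by (auto simp: Gamma_m_eq elim: less_trans[rotated])
  moreover have "x = \<Phi> y s" by (simp add: y)
  moreover have "\<tau>p y = \<tau>m x + \<tau>p x"
    using tau_p_shift[OF s(2) lt] \<open>x = \<Phi> y s\<close> s tau_p_nonneg[of x]
    by (cases "\<tau>p y"; cases "\<tau>p x") auto
  ultimately show ?thesis using that s y_def lt by blast
qed

lemma tau_p_bd_eq:
  assumes "y \<in> Gamma_m \<Phi> \<Omega>"
  shows "tau_p_bd \<Phi> \<Omega> y = \<tau>p y"
  unfolding tau_p_bd_def
proof (rule the_equality)
  show "\<exists>x\<in>\<Omega>. \<tau>m x < \<infinity> \<and> y = entry_point \<Phi> \<Omega> x \<and> \<tau>p y = \<tau>m x + \<tau>p x"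
  proof -
    obtain x where "x \<in> \<Omega>" "\<tau>m x < \<infinity>" "y = entry_point \<Phi> \<Omega> x"
      using assms by (auto simp: Gamma_m_def)
    then show ?thesis by (metis from_entry_point)
  qed
qed (auto elim!: from_entry_point)

subsection \<open>Borel measurability\<close>

text \<open>Leaving \<open>\<Omega>\<close> during a compact time interval is a closed condition on the starting point, as the projection of
  a closed set along a compact factor.\<close>

lemma measurable_tau_p [measurable]: "\<tau>p \<in> borel_measurable borel"
proof (rule borel_measurableI_less)
  have closed: "closed {x. \<exists>s\<in>{a..b}. \<Phi> x s \<notin> \<Omega>}" for a b
  proof -
    have "continuous_on UNIV (\<lambda>z. \<Phi> (snd z) (fst z))"
      by (intro continuous_intros)
    then have "closed {z. \<Phi> (snd z) (fst z) \<in> - \<Omega>}"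
      using closed_vimage[of "- \<Omega>" "\<lambda>z. \<Phi> (snd z) (fst z)"] domain_open
      by (simp add: vimage_def closed_Compl)
    from closed_compact_projection[OF compact_Icc this, of a b] show ?thesis
      by (simp add: Bex_def)
  qed
  fix c :: ereal
  have "{x. \<tau>p x < c} = (\<Union>a\<in>{a\<in>\<rat>. 0 < a}. \<Union>b\<in>{b\<in>\<rat>. ereal b < c}. {x. \<exists>s\<in>{a..b}. \<Phi> x s \<notin> \<Omega>})"
  proof safe
    fix x assume "\<tau>p x < c"
    then obtain s where s: "0 < s" "\<Phi> x s \<notin> \<Omega>" "ereal s < c"
      by (auto simp: tau_p_def Inf_less_iff)
    obtain a where a: "a \<in> \<rat>" "0 < a" "a < s" using Rats_dense_in_real[OF s(1)] by auto
    obtain b' where b': "ereal s < ereal b'" "ereal b' < c" using s(3) by (metis ereal_dense2)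
    obtain b where "b \<in> \<rat>" "s < b" "b < b'" using Rats_dense_in_real[of s b'] b' by auto
    then have "ereal b < c" using b' by (metis less_ereal.simps(1) less_trans)
    then show "x \<in> (\<Union>a\<in>{a\<in>\<rat>. 0 < a}. \<Union>b\<in>{b\<in>\<rat>. ereal b < c}. {x. \<exists>s\<in>{a..b}. \<Phi> x s \<notin> \<Omega>})"
      using a s \<open>b \<in> \<rat>\<close> \<open>s < b\<close>
      by (intro UN_I[of a] UN_I[of b] CollectI bexI[of _ s]) auto
  next
    fix x a b s assume "(0::real) < a" "ereal b < c" "s \<in> {a..b}" "\<Phi> x s \<notin> \<Omega>"
    then have "\<tau>p x \<le> ereal s" unfolding tau_p_def by (intro Inf_lower) auto
    also have "\<dots> \<le> ereal b" using \<open>s \<in> {a..b}\<close> by simp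
    finally show "\<tau>p x < c" using \<open>ereal b < c\<close> by simp
  qed
  also have "\<dots> \<in> sets borel"
    using closed by (intro sets.countable_UN'' countable_subset[OF _ countable_rat] borel_closed) auto
  finally show "{x \<in> space borel. \<tau>p x < c} \<in> sets borel" by simp
qed

lemmas measurable_tau_m [measurable] = continuous_flow.measurable_tau_p[OF reversed, unfolded tau_reversed]

lemma domain_measurable [measurable]: "\<Omega> \<in> sets borel"
  using domain_open by auto

lemma measurable_entry_point [measurable]: "entry_point \<Phi> \<Omega> \<in> borel_measurable borel"
  unfolding entry_point_def[abs_def] by measurable

lemma Gamma_m_measurable [measurable]: "Gamma_m \<Phi> \<Omega> \<in> sets borel"
  unfolding Gamma_m_eq by measurable

lemma Gamma_reversed:
  "Gamma_m (\<lambda>x t. \<Phi> x (- t)) \<Omega> = Gamma_p \<Phi> \<Omega>"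
  "tau_p_bd (\<lambda>x t. \<Phi> x (- t)) \<Omega> = tau_m_bd \<Phi> \<Omega>"
  "entry_point (\<lambda>x t. \<Phi> x (- t)) \<Omega> = exit_point \<Phi> \<Omega>"
  by (auto simp: Gamma_m_def Gamma_p_def tau_p_bd_def tau_m_bd_def entry_point_def exit_point_def
      tau_reversed fun_eq_iff add.commute)

lemmas Gamma_p_eq = continuous_flow.Gamma_m_eq[OF reversed, unfolded tau_reversed Gamma_reversed]

end

section \<open>Integration along the orbits of a measure preserving flow\<close>

locale invariant_flow = continuous_flow \<Phi> \<Omega>
  for \<Phi> :: "'a::euclidean_space \<Rightarrow> real \<Rightarrow> 'a" and \<Omega> :: "'a set" +
  fixes \<nu> :: "'a measure"
  assumes sets_\<nu> [measurable_cong]: "sets \<nu> = sets borel"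
    and sigma_finite_\<nu>: "sigma_finite_measure \<nu>"
    and invariant: "A \<in> sets borel \<Longrightarrow> emeasure \<nu> ((\<lambda>x. \<Phi> x t) ` A) = emeasure \<nu> A"
begin

sublocale \<nu>: sigma_finite_measure \<nu>
  by (rule sigma_finite_\<nu>)

sublocale \<nu>_time: pair_sigma_finite \<nu> lborel
  by unfold_locales

lemma space_\<nu> [simp]: "space \<nu> = UNIV"
  using sets_eq_imp_space_eq[OF sets_\<nu>] by simp

lemma borel_\<nu>: "borel_measurable \<nu> = borel_measurable borel"
  by (rule measurable_cong_sets[OF sets_\<nu> refl])

lemma invariant_flow_reversed: "invariant_flow (\<lambda>x t. \<Phi> x (- t)) \<Omega> \<nu>"
  by (intro invariant_flow.intro reversed invariant_flow_axioms.intro sets_\<nu> sigma_finite_\<nu> invariant)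

lemma distr_flow: "distr \<nu> \<nu> (\<lambda>x. \<Phi> x t) = \<nu>"
proof (rule measure_eqI)
  fix A assume "A \<in> sets (distr \<nu> \<nu> (\<lambda>x. \<Phi> x t))"
  then have A [measurable]: "A \<in> sets borel" by (simp add: sets_\<nu>)
  have "(\<lambda>x. \<Phi> x t) -` A = (\<lambda>x. \<Phi> x (- t)) ` A"
  proof safe
    fix x assume "\<Phi> x t \<in> A"
    then show "x \<in> (\<lambda>x. \<Phi> x (- t)) ` A"
      by (intro image_eqI[of _ _ "\<Phi> x t"]) auto
  qed simp
  then show "emeasure (distr \<nu> \<nu> (\<lambda>x. \<Phi> x t)) A = emeasure \<nu> A"
    using invariant[OF A, of "- t"] by (subst emeasure_distr) auto
qed (simp add: sets_\<nu>)

lemma nn_integral_flow: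
  assumes [measurable]: "h \<in> borel_measurable borel"
  shows "(\<integral>\<^sup>+x. h (\<Phi> x t) \<partial>\<nu>) = (\<integral>\<^sup>+x. h x \<partial>\<nu>)"
  by (subst (2) distr_flow[of t, symmetric], subst nn_integral_distr) auto

lemma AE_along_orbits:
  assumes "AE x in \<nu>. P x"
  shows "AE x in \<nu>. AE s in lborel. P (\<Phi> x s)"
proof -
  obtain N where N: "{x. \<not> P x} \<subseteq> N" "emeasure \<nu> N = 0" and [measurable]: "N \<in> sets borel"
    using AE_E[OF assms] by (auto simp: sets_\<nu>)
  have "(\<integral>\<^sup>+x. \<integral>\<^sup>+s. indicator N (\<Phi> x s) \<partial>lborel \<partial>\<nu>) = (\<integral>\<^sup>+s. \<integral>\<^sup>+x. indicator N (\<Phi> x s) \<partial>\<nu> \<partial>lborel)"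
    by (rule \<nu>_time.Fubini'[symmetric]) measurable
  also have "\<dots> = 0"
    by (subst nn_integral_flow) (auto simp: nn_integral_indicator sets_\<nu> N)
  finally have "AE x in \<nu>. (\<integral>\<^sup>+s. indicator N (\<Phi> x s) \<partial>lborel) = 0"
    by (subst (asm) nn_integral_0_iff_AE) measurable
  then show ?thesis
  proof eventually_elim
    case (elim x)
    then have "AE s in lborel. indicator N (\<Phi> x s) = (0::ennreal)"
      by (subst (asm) nn_integral_0_iff_AE) measurable
    then show ?case
      by eventually_elim (use N in \<open>auto simp: indicator_eq_0_iff\<close>)
  qed
qed

text \<open>Both sides say that the orbit segment from \<open>\<Phi> x (- t)\<close> to \<open>x\<close> lies in \<open>\<Omega>\<close>.\<close>

lemma segment_iff:
  assumes "0 < t"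
  shows "x \<in> \<Omega> \<and> ereal t < \<tau>m x \<longleftrightarrow> \<Phi> x (- t) \<in> \<Omega> \<and> ereal t < \<tau>p (\<Phi> x (- t))"
proof -
  have split0: "(\<forall>s. 0 \<le> s \<and> s \<le> t \<longrightarrow> P s) \<longleftrightarrow> P 0 \<and> (\<forall>s. 0 < s \<and> s \<le> t \<longrightarrow> P s)" for P :: "real \<Rightarrow> bool"
    using assms by (auto simp: le_less)
  have "x \<in> \<Omega> \<and> ereal t < \<tau>m x \<longleftrightarrow> (\<forall>s. 0 \<le> s \<and> s \<le> t \<longrightarrow> \<Phi> x (- s) \<in> \<Omega>)"
    unfolding less_tau_m_iff[OF assms] split0 by simp
  also have "\<dots> \<longleftrightarrow> (\<forall>s. 0 \<le> s \<and> s \<le> t \<longrightarrow> \<Phi> x (s - t) \<in> \<Omega>)"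
  proof safe
    fix s assume H: "\<forall>s. 0 \<le> s \<and> s \<le> t \<longrightarrow> \<Phi> x (- s) \<in> \<Omega>" and "0 \<le> s" "s \<le> t"
    then show "\<Phi> x (s - t) \<in> \<Omega>" using H[rule_format, of "t - s"] by simp
  next
    fix s assume H: "\<forall>s. 0 \<le> s \<and> s \<le> t \<longrightarrow> \<Phi> x (s - t) \<in> \<Omega>" and "0 \<le> s" "s \<le> t"
    then show "\<Phi> x (- s) \<in> \<Omega>" using H[rule_format, of "t - s"] by simp
  qed
  also have "\<dots> \<longleftrightarrow> \<Phi> x (- t) \<in> \<Omega> \<and> ereal t < \<tau>p (\<Phi> x (- t))"
    unfolding less_tau_p_iff[OF assms] split0 by simp
  finally show ?thesis .
qed

text \<open>The change of variables \<open>z = \<Phi> x (-t)\<close> on the set of orbit segments inside \<open>\<Omega>\<close>.\<close>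

lemma nn_integral_segments:
  fixes G :: "'a \<Rightarrow> real \<Rightarrow> ennreal"
  assumes [measurable]: "case_prod G \<in> borel_measurable (borel \<Otimes>\<^sub>M borel)"
  shows "(\<integral>\<^sup>+x\<in>\<Omega>. (\<integral>\<^sup>+t\<in>behind x. G (\<Phi> x (- t)) t \<partial>lborel) \<partial>\<nu>) =
    (\<integral>\<^sup>+x\<in>\<Omega>. (\<integral>\<^sup>+t\<in>ahead x. G x t \<partial>lborel) \<partial>\<nu>)"
proof -
  define J where "J x t = G x t * indicator (ahead x) t * indicator \<Omega> x" for x t
  have J [measurable]: "case_prod J \<in> borel_measurable (borel \<Otimes>\<^sub>M borel)"
    unfolding J_def[abs_def] by measurable
  have "(\<integral>\<^sup>+x\<in>\<Omega>. (\<integral>\<^sup>+t\<in>behind x. G (\<Phi> x (- t)) t \<partial>lborel) \<partial>\<nu>) =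
      (\<integral>\<^sup>+x. \<integral>\<^sup>+t. J (\<Phi> x (- t)) t \<partial>lborel \<partial>\<nu>)"
  proof (rule nn_integral_cong)
    fix x
    have "(\<integral>\<^sup>+t\<in>behind x. G (\<Phi> x (- t)) t \<partial>lborel) * indicator \<Omega> x =
        (\<integral>\<^sup>+t. G (\<Phi> x (- t)) t * indicator (behind x) t * indicator \<Omega> x \<partial>lborel)"
      by (rule nn_integral_multc[symmetric]) measurable
    also have "\<dots> = (\<integral>\<^sup>+t. J (\<Phi> x (- t)) t \<partial>lborel)"
    proof (rule nn_integral_cong)
      fix t
      show "G (\<Phi> x (- t)) t * indicator (behind x) t * indicator \<Omega> x = J (\<Phi> x (- t)) t"
        unfolding J_def using segment_iff[of t x] by (auto split: split_indicator)
    qed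
    finally show "(\<integral>\<^sup>+t\<in>behind x. G (\<Phi> x (- t)) t \<partial>lborel) * indicator \<Omega> x =
        (\<integral>\<^sup>+t. J (\<Phi> x (- t)) t \<partial>lborel)" .
  qed
  also have "\<dots> = (\<integral>\<^sup>+t. \<integral>\<^sup>+x. J (\<Phi> x (- t)) t \<partial>\<nu> \<partial>lborel)"
    by (rule \<nu>_time.Fubini'[symmetric]) measurable
  also have "\<dots> = (\<integral>\<^sup>+t. \<integral>\<^sup>+x. J x t \<partial>\<nu> \<partial>lborel)"
    by (intro nn_integral_cong nn_integral_flow) measurable
  also have "\<dots> = (\<integral>\<^sup>+x. \<integral>\<^sup>+t. J x t \<partial>lborel \<partial>\<nu>)"
    by (rule \<nu>_time.Fubini') measurable
  also have "\<dots> = (\<integral>\<^sup>+x\<in>\<Omega>. (\<integral>\<^sup>+t\<in>ahead x. G x t \<partial>lborel) \<partial>\<nu>)"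
    unfolding J_def by (intro nn_integral_cong nn_integral_multc) measurable
  finally show ?thesis .
qed

subsection \<open>The boundary measures\<close>

lemma borel_measurable_of_completion:
  assumes "\<mu> = \<nu> \<or> \<mu> = completion \<nu>" "h \<in> borel_measurable borel"
  shows "h \<in> borel_measurable \<mu>"
proof -
  have "h \<in> borel_measurable \<nu>" using assms(2) borel_\<nu> by simp
  then show ?thesis using assms(1) measurable_completion[of h \<nu>] by metis
qed

lemma nn_integral_of_completion:
  assumes "\<mu> = \<nu> \<or> \<mu> = completion \<nu>"
  shows "(\<integral>\<^sup>+x. h x \<partial>\<mu>) = (\<integral>\<^sup>+x. h x \<partial>\<nu>)"
  using assms by (auto simp: nn_integral_completion)

lemma measurable_pair_of_completion:
  assumes "\<mu> = \<nu> \<or> \<mu> = completion \<nu>" "h \<in> borel_measurable (borel \<Otimes>\<^sub>M borel)"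
  shows "h \<in> borel_measurable (\<mu> \<Otimes>\<^sub>M lborel)"
proof -
  have [measurable]: "(\<lambda>x. x) \<in> borel_measurable \<mu>"
    by (rule borel_measurable_of_completion[OF assms(1)]) simp
  have "fst \<in> borel_measurable (\<mu> \<Otimes>\<^sub>M lborel)"
    using measurable_compose[OF measurable_fst \<open>(\<lambda>x. x) \<in> borel_measurable \<mu>\<close>] by simp
  then have "(\<lambda>z. (fst z, snd z)) \<in> (\<mu> \<Otimes>\<^sub>M lborel) \<rightarrow>\<^sub>M (borel \<Otimes>\<^sub>M borel)"
    by measurable
  from measurable_compose[OF this assms(2)] show ?thesis by simp
qed

lemma measurable_on_Gamma_m:
  assumes "sets \<mu>m = sets (restrict_space borel (Gamma_m \<Phi> \<Omega>))" "h \<in> borel_measurable borel"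
  shows "h \<in> borel_measurable \<mu>m"
  unfolding measurable_cong_sets[OF assms(1) refl] by (intro measurable_restrict_space1 assms)

lemma space_Gamma_m:
  assumes "sets \<mu>m = sets (restrict_space borel (Gamma_m \<Phi> \<Omega>))"
  shows "space \<mu>m = Gamma_m \<Phi> \<Omega>"
  using sets_eq_imp_space_eq[OF assms] by (simp add: space_restrict_space)

lemma sets_incoming:
  "is_incoming_measure \<mu> \<Phi> \<Omega> \<mu>m \<Longrightarrow> sets \<mu>m = sets (restrict_space borel (Gamma_m \<Phi> \<Omega>))"
  by (simp add: is_incoming_measure_def)

text \<open>The time window of length one in the test function selects each orbit that starts at \<open>\<Gamma>\<^sub>-\<close> with total weight
  one. The cutoff of \<open>\<tau>\<^sub>-\<close> ensures that the window closes before time \<open>T\<close>.\<close>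

lemma incoming_formula_cutoff:
  fixes h :: "'a \<Rightarrow> real"
  assumes \<mu>: "\<mu> = \<nu> \<or> \<mu> = completion \<nu>" and inc: "is_incoming_measure \<mu> \<Phi> \<Omega> \<mu>m"
    and h [measurable]: "h \<in> borel_measurable borel" and nonneg: "\<And>x. 0 \<le> h x"
    and finite: "(\<integral>\<^sup>+x\<in>\<Omega>. ennreal (h x) \<partial>\<nu>) < \<infinity>"
    and T: "\<And>x. x \<in> \<Omega> \<Longrightarrow> h x \<noteq> 0 \<Longrightarrow> \<tau>m x \<le> ereal (T - 1)" "1 < T"
  shows "(\<integral>\<^sup>+x\<in>\<Omega>. ennreal (h x) \<partial>\<nu>) = (\<integral>\<^sup>+y. (\<integral>\<^sup>+s\<in>ahead y. ennreal (h (\<Phi> y s)) \<partial>lborel) \<partial>\<mu>m)"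
proof -
  \<comment> \<open>Along the orbit that starts at \<open>y\<close> at time \<open>t\<close>, the condition below reads \<open>0 < t < 1\<close>; on orbits
    that are inside \<open>\<Omega>\<close> at time \<open>0\<close> it fails.\<close>
  define f where "f z = h (fst z) * indicator {z. \<tau>m (fst z) < ereal (snd z) \<and> ereal (snd z) < \<tau>m (fst z) + 1} z"
    for z :: "'a \<times> real"
  have f_meas [measurable]: "f \<in> borel_measurable (borel \<Otimes>\<^sub>M borel)"
    unfolding f_def[abs_def] by measurable
  have f_nonneg: "0 \<le> f z" for z by (simp add: f_def nonneg)
  let ?D = "\<Omega> \<times> {0<..<T}"
  have ind_meas: "(\<lambda>z. indicator ?D z *\<^sub>R f z) \<in> borel_measurable (borel \<Otimes>\<^sub>M borel)"
    by measurable
  have lhs: "(\<integral>\<^sup>+z\<in>?D. ennreal (f z) \<partial>(\<mu> \<Otimes>\<^sub>M lborel)) = (\<integral>\<^sup>+x\<in>\<Omega>. ennreal (h x) \<partial>\<nu>)"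
  proof -
    have "(\<lambda>z. ennreal (f z) * indicator ?D z) \<in> borel_measurable (\<mu> \<Otimes>\<^sub>M lborel)"
      by (rule measurable_pair_of_completion[OF \<mu>]) measurable
    from lborel.nn_integral_fst[OF this, symmetric]
    have "(\<integral>\<^sup>+z\<in>?D. ennreal (f z) \<partial>(\<mu> \<Otimes>\<^sub>M lborel)) =
        (\<integral>\<^sup>+x. \<integral>\<^sup>+t. ennreal (f (x, t)) * indicator ?D (x, t) \<partial>lborel \<partial>\<mu>)" .
    also have "\<dots> = (\<integral>\<^sup>+x\<in>\<Omega>. ennreal (h x) \<partial>\<mu>)"
    proof (rule nn_integral_cong)
      fix x
      show "(\<integral>\<^sup>+t. ennreal (f (x, t)) * indicator ?D (x, t) \<partial>lborel) = ennreal (h x) * indicator \<Omega> x"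
      proof (cases "x \<in> \<Omega> \<and> h x \<noteq> 0")
        case True
        then obtain c where c: "\<tau>m x = ereal c" "0 < c" "c \<le> T - 1"
          using T(1)[of x] tau_m_pos[of x] by (cases "\<tau>m x") auto
        have "(\<integral>\<^sup>+t. ennreal (f (x, t)) * indicator ?D (x, t) \<partial>lborel) =
            (\<integral>\<^sup>+t. ennreal (h x) * indicator {c<..<c+1} t \<partial>lborel)"
          using c True by (intro nn_integral_cong) (auto simp: f_def one_ereal_def split: split_indicator)
        also have "\<dots> = h x" by (subst nn_integral_cmult_indicator) auto
        finally show ?thesis using True by simp
      qed (auto simp: f_def)
    qed
    finally show ?thesis using nn_integral_of_completion[OF \<mu>] by simp
  qed
  have "integrable (\<mu> \<Otimes>\<^sub>M lborel) (\<lambda>z. indicator ?D z *\<^sub>R f z)"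
  proof (rule integrableI_nonneg)
    show "(\<lambda>z. indicator ?D z *\<^sub>R f z) \<in> borel_measurable (\<mu> \<Otimes>\<^sub>M lborel)"
      by (rule measurable_pair_of_completion[OF \<mu> ind_meas])
    have "(\<integral>\<^sup>+z. ennreal (indicator ?D z *\<^sub>R f z) \<partial>(\<mu> \<Otimes>\<^sub>M lborel)) =
        (\<integral>\<^sup>+z\<in>?D. ennreal (f z) \<partial>(\<mu> \<Otimes>\<^sub>M lborel))"
      by (intro nn_integral_cong) (auto split: split_indicator)
    then show "(\<integral>\<^sup>+z. ennreal (indicator ?D z *\<^sub>R f z) \<partial>(\<mu> \<Otimes>\<^sub>M lborel)) < \<infinity>"
      using lhs finite by simp
  qed (auto simp: f_nonneg)
  then have int: "set_integrable (\<mu> \<Otimes>\<^sub>M lborel) ?D f"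
    by (simp add: set_integrable_def)
  define J where "J y = (\<integral>\<^sup>+s\<in>ahead y. ennreal (h (\<Phi> y s)) \<partial>lborel)" for y
  have 2: "(\<integral>\<^sup>+y. (\<integral>\<^sup>+s\<in>{s. 0 < s \<and> ereal s < min (tau_p_bd \<Phi> \<Omega> y) (ereal (T - t))}.
        ennreal (f (\<Phi> y s, t + s)) \<partial>lborel) \<partial>\<mu>m) = (\<integral>\<^sup>+y. J y \<partial>\<mu>m) * indicator {..<1} t"
    if "0 < t" for t
  proof -
    have "(\<integral>\<^sup>+s\<in>{s. 0 < s \<and> ereal s < min (tau_p_bd \<Phi> \<Omega> y) (ereal (T - t))}.
        ennreal (f (\<Phi> y s, t + s)) \<partial>lborel) = J y * indicator {..<1} t" if y: "y \<in> space \<mu>m" for y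
    proof -
      have y: "y \<in> Gamma_m \<Phi> \<Omega>" "y \<notin> \<Omega>" using y space_Gamma_m[OF sets_incoming[OF inc]] by (auto simp: Gamma_m_eq)
      have "ennreal (f (\<Phi> y s, t + s)) * indicator {s. 0 < s \<and> ereal s < min (tau_p_bd \<Phi> \<Omega> y) (ereal (T - t))} s =
          ennreal (h (\<Phi> y s)) * indicator (ahead y) s * indicator {..<1} t" for s
      proof (cases "0 < s \<and> ereal s < \<tau>p y")
        case True
        then have s: "\<tau>m (\<Phi> y s) = ereal s" "\<Phi> y s \<in> \<Omega>"
          using tau_m_shift_boundary y before_tau_p by auto
        have "h (\<Phi> y s) \<noteq> 0 \<Longrightarrow> s \<le> T - 1"
          using T(1)[OF s(2)] s by simp
        then show ?thesis
          using True \<open>0 < t\<close> by (cases "h (\<Phi> y s) = 0") (auto simp: f_def s tau_p_bd_eq[OF y(1)] one_ereal_def split: split_indicator)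
      qed (auto simp: tau_p_bd_eq[OF y(1)] split: split_indicator)
      then show ?thesis
        unfolding J_def by (subst nn_integral_multc[symmetric]) (auto simp: mult.assoc)
    qed
    then have "(\<integral>\<^sup>+y. (\<integral>\<^sup>+s\<in>{s. 0 < s \<and> ereal s < min (tau_p_bd \<Phi> \<Omega> y) (ereal (T - t))}.
        ennreal (f (\<Phi> y s, t + s)) \<partial>lborel) \<partial>\<mu>m) = (\<integral>\<^sup>+y. J y * indicator {..<1} t \<partial>\<mu>m)"
      by (intro nn_integral_cong) auto
    also have "\<dots> = (\<integral>\<^sup>+y. J y \<partial>\<mu>m) * indicator {..<1} t"
      by (intro nn_integral_multc measurable_on_Gamma_m[OF sets_incoming[OF inc]]) (unfold J_def, measurable)
    finally show ?thesis .
  qed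
  have 3: "(\<integral>\<^sup>+s\<in>{s. 0 < s \<and> ereal s < min (\<tau>p x) (ereal T)}. ennreal (f (\<Phi> x s, s)) \<partial>lborel) = 0"
    if "x \<in> \<Omega>" for x
  proof -
    have "ennreal (f (\<Phi> x s, s)) * indicator {s. 0 < s \<and> ereal s < min (\<tau>p x) (ereal T)} s = 0" for s
    proof (cases "0 < s \<and> ereal s < \<tau>p x")
      case True
      then have "\<tau>m (\<Phi> x s) = \<tau>m x + ereal s" using tau_m_shift_inside that by simp
      moreover have "0 < \<tau>m x" using that by (rule tau_m_pos)
      ultimately have "\<not> \<tau>m (\<Phi> x s) < ereal s" by (cases "\<tau>m x") auto
      then show ?thesis by (simp add: f_def)
    qed (auto split: split_indicator)
    then show ?thesis by (simp only: nn_integral_const mult_zero_left)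
  qed
  have "0 < T" using T by simp
  then have "(\<integral>\<^sup>+z\<in>?D. ennreal (f z) \<partial>(\<mu> \<Otimes>\<^sub>M lborel)) =
      (\<integral>\<^sup>+t\<in>{0<..<T}. (\<integral>\<^sup>+y.
         (\<integral>\<^sup>+s\<in>{s. 0 < s \<and> ereal s < min (tau_p_bd \<Phi> \<Omega> y) (ereal (T - t))}.
            ennreal (f (\<Phi> y s, t + s)) \<partial>lborel) \<partial>\<mu>m) \<partial>lborel) +
      (\<integral>\<^sup>+x\<in>\<Omega>.
         (\<integral>\<^sup>+s\<in>{s. 0 < s \<and> ereal s < min (\<tau>p x) (ereal T)}.
            ennreal (f (\<Phi> x s, s)) \<partial>lborel) \<partial>\<mu>)"
    using inc int f_nonneg unfolding is_incoming_measure_def by blast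
  also have "(\<integral>\<^sup>+x\<in>\<Omega>. (\<integral>\<^sup>+s\<in>{s. 0 < s \<and> ereal s < min (\<tau>p x) (ereal T)}.
      ennreal (f (\<Phi> x s, s)) \<partial>lborel) \<partial>\<mu>) = (\<integral>\<^sup>+x. 0 \<partial>\<mu>)"
    using 3 by (intro nn_integral_cong) (auto split: split_indicator)
  also have "(\<integral>\<^sup>+t\<in>{0<..<T}. (\<integral>\<^sup>+y.
         (\<integral>\<^sup>+s\<in>{s. 0 < s \<and> ereal s < min (tau_p_bd \<Phi> \<Omega> y) (ereal (T - t))}.
            ennreal (f (\<Phi> y s, t + s)) \<partial>lborel) \<partial>\<mu>m) \<partial>lborel) =
      (\<integral>\<^sup>+t. (\<integral>\<^sup>+y. J y \<partial>\<mu>m) * indicator {0<..<1::real} t \<partial>lborel)"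
  proof (rule nn_integral_cong)
    fix t
    show "(\<integral>\<^sup>+y. (\<integral>\<^sup>+s\<in>{s. 0 < s \<and> ereal s < min (tau_p_bd \<Phi> \<Omega> y) (ereal (T - t))}.
            ennreal (f (\<Phi> y s, t + s)) \<partial>lborel) \<partial>\<mu>m) * indicator {0<..<T} t =
        (\<integral>\<^sup>+y. J y \<partial>\<mu>m) * indicator {0<..<1} t"
    proof (cases "0 < t")
      case True
      show ?thesis unfolding 2[OF True] using True T by (auto split: split_indicator)
    qed auto
  qed
  also have "\<dots> = (\<integral>\<^sup>+y. J y \<partial>\<mu>m)"
    by (subst nn_integral_cmult_indicator) auto
  finally show ?thesis
    unfolding lhs by (simp add: J_def)
qed

text \<open>The part of \<open>\<Omega>\<close> that is reached from \<open>\<Gamma>\<^sub>-\<close> is foliated by the orbits starting there. The truncations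
  in height, in space and in \<open>\<tau>\<^sub>-\<close> are removed by monotone convergence.\<close>

lemma incoming_formula:
  fixes h :: "'a \<Rightarrow> ennreal"
  assumes \<mu>: "\<mu> = \<nu> \<or> \<mu> = completion \<nu>" and inc: "is_incoming_measure \<mu> \<Phi> \<Omega> \<mu>m"
    and h [measurable]: "h \<in> borel_measurable borel"
  shows "(\<integral>\<^sup>+x\<in>{x \<in> \<Omega>. \<tau>m x < \<infinity>}. h x \<partial>\<nu>) =
    (\<integral>\<^sup>+y. (\<integral>\<^sup>+s\<in>ahead y. h (\<Phi> y s) \<partial>lborel) \<partial>\<mu>m)"
proof -
  obtain A :: "nat \<Rightarrow> 'a set" where A: "range A \<subseteq> sets \<nu>" "(\<Union>i. A i) = space \<nu>"
    "\<And>i. emeasure \<nu> (A i) \<noteq> \<infinity>" "incseq A"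
    using \<nu>.sigma_finite_incseq by blast
  have A_meas [measurable]: "A n \<in> sets borel" for n using A(1) by (auto simp: sets_\<nu>)
  define H where "H n x = min (h x) (of_nat n) * indicator (A n) x * indicator {x. \<tau>m x \<le> ereal (real n)} x" for n x
  have H_meas [measurable]: "H n \<in> borel_measurable borel" for n
    unfolding H_def[abs_def] by measurable
  have H_le: "H n x \<le> of_nat n * indicator (A n) x" for n x
    by (auto simp: H_def split: split_indicator)
  have H_fin: "H n x < \<infinity>" for n x
    using H_le[of n x] by (rule le_less_trans) (auto simp: ennreal_of_nat_eq_real_of_nat split: split_indicator)
  have step: "(\<integral>\<^sup>+x\<in>\<Omega>. H n x \<partial>\<nu>) =
      (\<integral>\<^sup>+y. (\<integral>\<^sup>+s\<in>ahead y. H n (\<Phi> y s) \<partial>lborel) \<partial>\<mu>m)" for n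
  proof -
    have eq: "ennreal (enn2real (H n x)) = H n x" for x
      using H_fin[of n x] by simp
    have "(\<integral>\<^sup>+x\<in>\<Omega>. H n x \<partial>\<nu>) \<le> (\<integral>\<^sup>+x. of_nat n * indicator (A n) x \<partial>\<nu>)"
    proof (rule nn_integral_mono)
      fix x show "H n x * indicator \<Omega> x \<le> of_nat n * indicator (A n) x"
        using H_le[of n x] by (cases "x \<in> \<Omega>") simp_all
    qed
    also have "\<dots> = of_nat n * emeasure \<nu> (A n)"
      by (subst nn_integral_cmult_indicator) (auto simp: sets_\<nu>)
    also have "\<dots> < \<infinity>"
      using A(3)[of n] by (auto simp: ennreal_mult_less_top less_top ennreal_of_nat_eq_real_of_nat)
    finally have fin: "(\<integral>\<^sup>+x\<in>\<Omega>. H n x \<partial>\<nu>) < \<infinity>" .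
    have "(\<integral>\<^sup>+x\<in>\<Omega>. ennreal (enn2real (H n x)) \<partial>\<nu>) =
      (\<integral>\<^sup>+y. (\<integral>\<^sup>+s\<in>ahead y. ennreal (enn2real (H n (\<Phi> y s))) \<partial>lborel) \<partial>\<mu>m)"
    proof (rule incoming_formula_cutoff[OF \<mu> inc, of _ "real n + 2"])
      fix x assume "enn2real (H n x) \<noteq> 0"
      then have "H n x \<noteq> 0" by auto
      then have "\<tau>m x \<le> ereal (real n)" by (auto simp: H_def split: split_indicator_asm)
      also have "\<dots> \<le> ereal (real n + 2 - 1)" by simp
      finally show "\<tau>m x \<le> ereal (real n + 2 - 1)" .
    qed (use fin in \<open>auto simp: eq\<close>)
    then show ?thesis by (simp add: eq)
  qed
  have inc_H: "incseq (\<lambda>n. H n x)" for x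
  proof (rule incseq_SucI)
    fix n
    have "A n \<subseteq> A (Suc n)" using A(4) by (simp add: incseq_Suc_iff)
    moreover have "min (h x) (of_nat n) \<le> min (h x) (of_nat (Suc n))"
      by (intro min.mono) (auto simp: ennreal_of_nat_eq_real_of_nat)
    moreover have "\<tau>m x \<le> ereal (real n) \<Longrightarrow> \<tau>m x \<le> ereal (real (Suc n))"
      by (erule order_trans) simp
    ultimately show "H n x \<le> H (Suc n) x"
      unfolding H_def by (auto split: split_indicator)
  qed
  have SUP_H: "(SUP n. H n x) = h x * indicator {x. \<tau>m x < \<infinity>} x" for x
  proof (cases "\<tau>m x < \<infinity>")
    case True
    then obtain c where c: "\<tau>m x = ereal c" using tau_m_nonneg[of x] by (cases "\<tau>m x") auto
    obtain n0 where n0: "c \<le> real n0" using real_arch_simple by blast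
    obtain n1 where n1: "x \<in> A n1" using A(2) by auto
    have "H n x = min (h x) (of_nat n)" if "n \<ge> max n0 n1" for n
    proof -
      have "x \<in> A n" using n1 that A(4) by (auto simp: incseq_def)
      moreover have "c \<le> real n" using n0 that by (meson max.boundedE of_nat_mono order_trans)
      ultimately show ?thesis by (simp add: H_def c)
    qed
    then have "eventually (\<lambda>n. H n x = min (h x) (of_nat n)) sequentially"
      unfolding eventually_sequentially by blast
    moreover have "(\<lambda>n. min (h x) (of_nat n)) \<longlonglongrightarrow> min (h x) top"
      by (intro tendsto_min tendsto_const of_nat_tendsto_top_ennreal)
    ultimately have "(\<lambda>n. H n x) \<longlonglongrightarrow> h x"
      by (simp add: tendsto_cong)
    moreover have "(\<lambda>n. H n x) \<longlonglongrightarrow> (SUP n. H n x)"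
      by (rule LIMSEQ_SUP[OF inc_H])
    ultimately show ?thesis using True LIMSEQ_unique by auto
  next
    case False
    then have "H n x = 0" for n by (auto simp: H_def)
    then show ?thesis using False by simp
  qed
  have inc_ind: "incseq (\<lambda>n. H n x * c)" for x c
    using inc_H by (auto simp: incseq_def intro!: mult_right_mono)
  have "(\<integral>\<^sup>+x\<in>{x \<in> \<Omega>. \<tau>m x < \<infinity>}. h x \<partial>\<nu>) = (\<integral>\<^sup>+x. (SUP n. H n x * indicator \<Omega> x) \<partial>\<nu>)"
    by (intro nn_integral_cong)
       (auto simp: SUP_mult_right_ennreal[symmetric] SUP_H split: split_indicator)
  also have "\<dots> = (SUP n. \<integral>\<^sup>+x\<in>\<Omega>. H n x \<partial>\<nu>)"
    using inc_ind by (intro nn_integral_monotone_convergence_SUP) (auto simp: incseq_def le_fun_def)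
  also have "\<dots> = (SUP n. \<integral>\<^sup>+y. (\<integral>\<^sup>+s\<in>ahead y. H n (\<Phi> y s) \<partial>lborel) \<partial>\<mu>m)"
    by (simp add: step)
  also have "\<dots> = (\<integral>\<^sup>+y. (SUP n. \<integral>\<^sup>+s\<in>ahead y. H n (\<Phi> y s) \<partial>lborel) \<partial>\<mu>m)"
    using inc_ind
    by (intro nn_integral_monotone_convergence_SUP[symmetric] measurable_on_Gamma_m[OF sets_incoming[OF inc]])
       (auto simp: incseq_def le_fun_def intro!: nn_integral_mono)
  also have "\<dots> = (\<integral>\<^sup>+y. (\<integral>\<^sup>+s. (SUP n. H n (\<Phi> y s) * indicator (ahead y) s) \<partial>lborel) \<partial>\<mu>m)"
    using inc_ind
    by (intro nn_integral_cong nn_integral_monotone_convergence_SUP[symmetric])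
       (auto simp: incseq_def le_fun_def)
  also have "\<dots> = (\<integral>\<^sup>+y. (\<integral>\<^sup>+s\<in>ahead y. h (\<Phi> y s) \<partial>lborel) \<partial>\<mu>m)"
  proof (intro nn_integral_cong)
    fix y s assume "y \<in> space \<mu>m"
    then have "y \<notin> \<Omega>" using space_Gamma_m[OF sets_incoming[OF inc]] by (auto simp: Gamma_m_eq)
    then show "(SUP n. H n (\<Phi> y s) * indicator (ahead y) s) =
        h (\<Phi> y s) * indicator (ahead y) s"
      using tau_m_shift_boundary[of y s]
      by (auto simp: SUP_mult_right_ennreal[symmetric] SUP_H split: split_indicator)
  qed
  finally show ?thesis .
qed

end

text \<open>Measurability of \<open>G\<close> is not available where this is applied: the characterisation of the boundary
  measures quantifies over integrands whose integral over the boundary need not depend measurably on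
  time. The integral of an arbitrary function is a supremum over simple functions, which are reflected
  one by one.\<close>

lemma nn_integral_reflect:
  fixes G :: "real \<Rightarrow> ennreal"
  shows "(\<integral>\<^sup>+t. G (T - t) \<partial>lborel) = (\<integral>\<^sup>+t. G t \<partial>lborel)"
proof -
  have le: "(\<integral>\<^sup>+t. G (T - t) \<partial>lborel) \<le> (\<integral>\<^sup>+t. G t \<partial>lborel)" for G :: "real \<Rightarrow> ennreal"
    unfolding nn_integral_def[of lborel "\<lambda>t. G (T - t)"]
  proof (rule SUP_least, clarify)
    fix g :: "real \<Rightarrow> ennreal" assume g: "simple_function lborel g" "g \<le> (\<lambda>t. G (T - t))"
    have "integral\<^sup>S lborel g = (\<integral>\<^sup>+t. g t \<partial>lborel)"
      using g(1) by (simp add: nn_integral_eq_simple_integral)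
    also have "\<dots> = (\<integral>\<^sup>+t. g (T + (- 1) * t) \<partial>lborel)"
      using borel_measurable_simple_function[OF g(1)]
      by (subst nn_integral_real_affine[of g "-1" T]) auto
    also have "\<dots> \<le> (\<integral>\<^sup>+t. G t \<partial>lborel)"
      using g(2) by (intro nn_integral_mono) (auto simp: le_fun_def dest: spec[of _ "T - _"])
    finally show "integral\<^sup>S lborel g \<le> (\<integral>\<^sup>+t. G t \<partial>lborel)" .
  qed
  from le[of G] le[of "\<lambda>t. G (T - t)"] show ?thesis by simp
qed

context invariant_flow
begin

text \<open>The formula for \<open>\<mu>\<^sub>+\<close> applied to \<open>f(x, T - t)\<close> is the formula for \<open>\<mu>\<^sub>-\<close> of the reversed flow applied to \<open>f\<close>.\<close>

lemma outgoing_reversed: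
  assumes out: "is_outgoing_measure \<mu> \<Phi> \<Omega> \<mu>p"
  shows "is_incoming_measure \<mu> (\<lambda>x t. \<Phi> x (- t)) \<Omega> \<mu>p"
  unfolding is_incoming_measure_def tau_reversed Gamma_reversed
proof (intro conjI allI impI)
  show "sets \<mu>p = sets (restrict_space borel (Gamma_p \<Phi> \<Omega>))"
    using out by (simp add: is_outgoing_measure_def)
next
  fix T :: real and f :: "'a \<times> real \<Rightarrow> real"
  let ?D = "\<Omega> \<times> {0<..<T}"
  assume T: "0 < T" and f: "(\<forall>z. 0 \<le> f z) \<and> set_integrable (\<mu> \<Otimes>\<^sub>M lborel) ?D f"
  define f' where "f' z = f (fst z, T - snd z)" for z
  have meas: "(\<lambda>z. indicator ?D z *\<^sub>R f z) \<in> borel_measurable (\<mu> \<Otimes>\<^sub>M lborel)"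
    using f by (auto simp: set_integrable_def)
  then have meas_nn: "(\<lambda>z. ennreal (f z) * indicator ?D z) \<in> borel_measurable (\<mu> \<Otimes>\<^sub>M lborel)"
  proof -
    have "(\<lambda>z. ennreal (indicator ?D z *\<^sub>R f z)) \<in> borel_measurable (\<mu> \<Otimes>\<^sub>M lborel)"
      using meas by measurable
    then show ?thesis
      by (rule measurable_cong[THEN iffD1, rotated]) (auto split: split_indicator)
  qed
  have flip: "(\<lambda>z. (fst z, T - snd z)) \<in> (\<mu> \<Otimes>\<^sub>M lborel) \<rightarrow>\<^sub>M (\<mu> \<Otimes>\<^sub>M lborel)"
    by measurable
  have ind: "indicator ?D (fst z, T - snd z) = (indicator ?D z :: 'b::zero_neq_one)" for z :: "'a \<times> real"
    by (cases z) (auto split: split_indicator)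
  have meas': "(\<lambda>z. indicator ?D z *\<^sub>R f' z) \<in> borel_measurable (\<mu> \<Otimes>\<^sub>M lborel)"
    using measurable_compose[OF flip meas] by (simp add: f'_def ind)
  have meas_nn': "(\<lambda>z. ennreal (f' z) * indicator ?D z) \<in> borel_measurable (\<mu> \<Otimes>\<^sub>M lborel)"
    using measurable_compose[OF flip meas_nn] by (simp add: f'_def ind)
  have same: "(\<integral>\<^sup>+z\<in>?D. ennreal (f' z) \<partial>(\<mu> \<Otimes>\<^sub>M lborel)) = (\<integral>\<^sup>+z\<in>?D. ennreal (f z) \<partial>(\<mu> \<Otimes>\<^sub>M lborel))"
  proof -
    have "(\<integral>\<^sup>+z\<in>?D. ennreal (f' z) \<partial>(\<mu> \<Otimes>\<^sub>M lborel)) =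
        (\<integral>\<^sup>+x. \<integral>\<^sup>+t. ennreal (f (x, T - t)) * indicator ?D (x, T - t) \<partial>lborel \<partial>\<mu>)"
      unfolding ind[of "(_, _)", simplified] by (subst lborel.nn_integral_fst[OF meas_nn', symmetric]) (simp add: f'_def)
    also have "\<dots> = (\<integral>\<^sup>+x. \<integral>\<^sup>+t. ennreal (f (x, t)) * indicator ?D (x, t) \<partial>lborel \<partial>\<mu>)"
      by (subst nn_integral_reflect[of "\<lambda>t. ennreal (f (_, t)) * indicator ?D (_, t)"]) simp
    also have "\<dots> = (\<integral>\<^sup>+z\<in>?D. ennreal (f z) \<partial>(\<mu> \<Otimes>\<^sub>M lborel))"
      by (subst lborel.nn_integral_fst[OF meas_nn, symmetric]) simp
    finally show ?thesis .
  qed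
  have "integrable (\<mu> \<Otimes>\<^sub>M lborel) (\<lambda>z. indicator ?D z *\<^sub>R f' z)"
  proof (rule integrableI_nonneg[OF meas'])
    have "(\<integral>\<^sup>+z\<in>?D. ennreal (f z) \<partial>(\<mu> \<Otimes>\<^sub>M lborel)) = (\<integral>\<^sup>+z. norm (indicator ?D z *\<^sub>R f z) \<partial>(\<mu> \<Otimes>\<^sub>M lborel))"
      using f by (intro nn_integral_cong) (auto split: split_indicator)
    also have "\<dots> < \<infinity>"
      using f by (auto simp: set_integrable_def integrable_iff_bounded)
    also have "(\<integral>\<^sup>+z\<in>?D. ennreal (f z) \<partial>(\<mu> \<Otimes>\<^sub>M lborel)) = (\<integral>\<^sup>+z. ennreal (indicator ?D z *\<^sub>R f' z) \<partial>(\<mu> \<Otimes>\<^sub>M lborel))"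
      unfolding same[symmetric] by (intro nn_integral_cong) (auto split: split_indicator)
    finally show "(\<integral>\<^sup>+z. ennreal (indicator ?D z *\<^sub>R f' z) \<partial>(\<mu> \<Otimes>\<^sub>M lborel)) < \<infinity>" .
  qed (use f in \<open>auto simp: f'_def\<close>)
  then have int': "(\<forall>z. 0 \<le> f' z) \<and> set_integrable (\<mu> \<Otimes>\<^sub>M lborel) ?D f'"
    using f by (auto simp: set_integrable_def f'_def)
  define K where "K t = (\<integral>\<^sup>+y. (\<integral>\<^sup>+s\<in>{s. 0 < s \<and> ereal s < min (tau_m_bd \<Phi> \<Omega> y) (ereal (T - t))}.
      ennreal (f (\<Phi> y (- s), t + s)) \<partial>lborel) \<partial>\<mu>p) * indicator {0<..<T} t" for t
  have "(\<integral>\<^sup>+z\<in>?D. ennreal (f' z) \<partial>(\<mu> \<Otimes>\<^sub>M lborel)) =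
      (\<integral>\<^sup>+t\<in>{0<..<T}. (\<integral>\<^sup>+y.
         (\<integral>\<^sup>+s\<in>{s. 0 < s \<and> ereal s < min (tau_m_bd \<Phi> \<Omega> y) (ereal t)}.
            ennreal (f' (\<Phi> y (- s), t - s)) \<partial>lborel) \<partial>\<mu>p) \<partial>lborel) +
      (\<integral>\<^sup>+x\<in>\<Omega>. (\<integral>\<^sup>+s\<in>{s. 0 < s \<and> ereal s < min (\<tau>m x) (ereal T)}.
            ennreal (f' (\<Phi> x (- s), T - s)) \<partial>lborel) \<partial>\<mu>)"
    using out T int' unfolding is_outgoing_measure_def by blast
  also have "(\<integral>\<^sup>+t\<in>{0<..<T}. (\<integral>\<^sup>+y.
         (\<integral>\<^sup>+s\<in>{s. 0 < s \<and> ereal s < min (tau_m_bd \<Phi> \<Omega> y) (ereal t)}.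
            ennreal (f' (\<Phi> y (- s), t - s)) \<partial>lborel) \<partial>\<mu>p) \<partial>lborel) = (\<integral>\<^sup>+t. K (T - t) \<partial>lborel)"
    unfolding K_def f'_def
    by (intro nn_integral_cong arg_cong2[where f = "(*)"]) (auto simp: algebra_simps split: split_indicator)
  finally show "(\<integral>\<^sup>+z\<in>?D. ennreal (f z) \<partial>(\<mu> \<Otimes>\<^sub>M lborel)) =
      (\<integral>\<^sup>+t\<in>{0<..<T}. (\<integral>\<^sup>+y.
         (\<integral>\<^sup>+s\<in>{s. 0 < s \<and> ereal s < min (tau_m_bd \<Phi> \<Omega> y) (ereal (T - t))}.
            ennreal (f (\<Phi> y (- s), t + s)) \<partial>lborel) \<partial>\<mu>p) \<partial>lborel) +
      (\<integral>\<^sup>+x\<in>\<Omega>. (\<integral>\<^sup>+s\<in>{s. 0 < s \<and> ereal s < min (\<tau>m x) (ereal T)}.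
            ennreal (f (\<Phi> x (- s), s)) \<partial>lborel) \<partial>\<mu>)"
    unfolding nn_integral_reflect same by (simp add: K_def[abs_def] f'_def)
qed

end

section \<open>Exchange of mass between the domain and its boundary\<close>

locale flow_with_boundary = invariant_flow \<Phi> \<Omega> \<nu>
  for \<Phi> :: "'a::euclidean_space \<Rightarrow> real \<Rightarrow> 'a" and \<Omega> :: "'a set" and \<nu> :: "'a measure" +
  fixes \<mu>m \<mu>p :: "'a measure"
  assumes sets_\<mu>m: "sets \<mu>m = sets (restrict_space borel (Gamma_m \<Phi> \<Omega>))"
    and sets_\<mu>p: "sets \<mu>p = sets (restrict_space borel (Gamma_p \<Phi> \<Omega>))"
    and incoming: "\<And>h. h \<in> borel_measurable borel \<Longrightarrow>
      (\<integral>\<^sup>+x\<in>{x \<in> \<Omega>. tau_m \<Phi> \<Omega> x < \<infinity>}. h x \<partial>\<nu>) =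
        (\<integral>\<^sup>+y. (\<integral>\<^sup>+s\<in>{s. 0 < s \<and> ereal s < tau_p \<Phi> \<Omega> y}. h (\<Phi> y s) \<partial>lborel) \<partial>\<mu>m)"
    and outgoing: "\<And>h. h \<in> borel_measurable borel \<Longrightarrow>
      (\<integral>\<^sup>+x\<in>{x \<in> \<Omega>. tau_p \<Phi> \<Omega> x < \<infinity>}. h x \<partial>\<nu>) =
        (\<integral>\<^sup>+y. (\<integral>\<^sup>+s\<in>{s. 0 < s \<and> ereal s < tau_m \<Phi> \<Omega> y}. h (\<Phi> y (- s)) \<partial>lborel) \<partial>\<mu>p)"

context flow_with_boundary
begin

lemma boundary_reversed: "flow_with_boundary (\<lambda>x t. \<Phi> x (- t)) \<Omega> \<nu> \<mu>p \<mu>m"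
proof (intro flow_with_boundary.intro flow_with_boundary_axioms.intro invariant_flow_reversed)
  have "Gamma_p (\<lambda>x t. \<Phi> x (- t)) \<Omega> = Gamma_m \<Phi> \<Omega>"
    using continuous_flow.Gamma_reversed(1)[OF reversed] by simp
  then show "sets \<mu>m = sets (restrict_space borel (Gamma_p (\<lambda>x t. \<Phi> x (- t)) \<Omega>))"
    using sets_\<mu>m by simp
qed (use sets_\<mu>p incoming outgoing in \<open>simp_all add: tau_reversed Gamma_reversed\<close>)

lemmas measurable_\<mu>m = measurable_on_Gamma_m[OF sets_\<mu>m]
lemmas space_\<mu>m = space_Gamma_m[OF sets_\<mu>m]
lemmas measurable_\<mu>p = invariant_flow.measurable_on_Gamma_m[OF invariant_flow_reversed, unfolded Gamma_reversed, OF sets_\<mu>p]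
lemmas space_\<mu>p = invariant_flow.space_Gamma_m[OF invariant_flow_reversed, unfolded Gamma_reversed, OF sets_\<mu>p]

lemma sets_\<mu>m_imp_borel: "N \<in> sets \<mu>m \<Longrightarrow> N \<in> sets borel"
  using sets_\<mu>m by (simp add: sets_restrict_space_iff)

text \<open>Null sets of \<open>\<mu>\<^sub>-\<close> are not seen in \<open>\<Omega>\<close>: the orbits that start in such a set fill a null set, by
  \<open>incoming_formula\<close> for the indicator function of the union of these orbits.\<close>

lemma AE_entry_point:
  assumes "AE y in \<mu>m. P y"
  shows "AE x in \<nu>. x \<in> \<Omega> \<and> \<tau>m x < \<infinity> \<longrightarrow> P (entry_point \<Phi> \<Omega> x)"
proof -
  obtain N where N: "{y \<in> space \<mu>m. \<not> P y} \<subseteq> N" "emeasure \<mu>m N = 0" "N \<in> sets \<mu>m"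
    using AE_E[OF assms] by blast
  have [measurable]: "N \<in> sets borel" using N(3) by (rule sets_\<mu>m_imp_borel)
  have "(\<integral>\<^sup>+x\<in>{x \<in> \<Omega>. \<tau>m x < \<infinity>}. indicator N (entry_point \<Phi> \<Omega> x) \<partial>\<nu>) =
      (\<integral>\<^sup>+y. (\<integral>\<^sup>+s\<in>ahead y. indicator N (entry_point \<Phi> \<Omega> (\<Phi> y s)) \<partial>lborel) \<partial>\<mu>m)"
    by (rule incoming) measurable
  also have "\<dots> = (\<integral>\<^sup>+y. 0 \<partial>\<mu>m)"
  proof (rule nn_integral_cong_AE)
    have "AE y in \<mu>m. y \<notin> N" using N by (intro AE_not_in) (auto intro: null_setsI)
    with AE_space show "AE y in \<mu>m. (\<integral>\<^sup>+s\<in>ahead y.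
        indicator N (entry_point \<Phi> \<Omega> (\<Phi> y s)) \<partial>lborel) = (0::ennreal)"
    proof eventually_elim
      case (elim y)
      have "indicator N (entry_point \<Phi> \<Omega> (\<Phi> y s)) * indicator (ahead y) s = (0::ennreal)" for s
        using elim entry_point_shift[of y s] by (auto simp: space_\<mu>m split: split_indicator)
      then show ?case by (simp only: nn_integral_const mult_zero_left)
    qed
  qed
  also have "\<dots> = 0" by simp
  finally have "AE x in \<nu>. indicator N (entry_point \<Phi> \<Omega> x) * indicator {x \<in> \<Omega>. \<tau>m x < \<infinity>} x = (0::ennreal)"
    by (subst (asm) nn_integral_0_iff_AE) auto
  then show ?thesis
  proof eventually_elim
    case (elim x)
    show ?case
    proof
      assume x: "x \<in> \<Omega> \<and> \<tau>m x < \<infinity>"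
      then have "entry_point \<Phi> \<Omega> x \<notin> N" using elim by (auto split: split_indicator_asm)
      moreover have "entry_point \<Phi> \<Omega> x \<in> space \<mu>m"
        unfolding space_\<mu>m using x by (metis from_entry_point)
      ultimately show "P (entry_point \<Phi> \<Omega> x)" using N(1) by auto
    qed
  qed
qed

text \<open>The indicator function of a null set in \<open>\<Omega>\<close> has integral zero on the left of \<open>incoming_formula\<close>, hence
  along almost every orbit from \<open>\<Gamma>\<^sub>-\<close>.\<close>

lemma AE_incoming_orbits:
  assumes "AE x in \<nu>. x \<in> \<Omega> \<longrightarrow> P x"
  shows "AE y in \<mu>m. AE s in lborel. 0 < s \<and> ereal s < \<tau>p y \<longrightarrow> P (\<Phi> y s)"
proof -
  obtain N where N: "{x. \<not> (x \<in> \<Omega> \<longrightarrow> P x)} \<subseteq> N" "emeasure \<nu> N = 0" and [measurable]: "N \<in> sets borel"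
    using AE_E[OF assms] by (auto simp: sets_\<nu>)
  have meas: "(\<lambda>y. \<integral>\<^sup>+s\<in>ahead y. indicator N (\<Phi> y s) \<partial>lborel) \<in> borel_measurable \<mu>m"
    by (rule measurable_\<mu>m) measurable
  have "(\<integral>\<^sup>+y. (\<integral>\<^sup>+s\<in>ahead y. indicator N (\<Phi> y s) \<partial>lborel) \<partial>\<mu>m) =
      (\<integral>\<^sup>+x\<in>{x \<in> \<Omega>. \<tau>m x < \<infinity>}. indicator N x \<partial>\<nu>)"
    by (rule incoming[symmetric]) measurable
  also have "\<dots> \<le> (\<integral>\<^sup>+x. indicator N x \<partial>\<nu>)"
    by (intro nn_integral_mono) (auto split: split_indicator)
  also have "\<dots> = 0" using N by (simp add: sets_\<nu>)
  finally have "AE y in \<mu>m. (\<integral>\<^sup>+s\<in>ahead y. indicator N (\<Phi> y s) \<partial>lborel) = 0"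
    using nn_integral_0_iff_AE[OF meas] by simp
  with AE_space show ?thesis
  proof eventually_elim
    case (elim y)
    then have "AE s in lborel. indicator N (\<Phi> y s) * indicator (ahead y) s = (0::ennreal)"
      by (subst (asm) nn_integral_0_iff_AE) auto
    then show ?case
    proof eventually_elim
      case (elim s)
      show ?case
      proof
        assume s: "0 < s \<and> ereal s < \<tau>p y"
        then have "\<Phi> y s \<notin> N" using elim by (auto split: split_indicator_asm)
        then show "P (\<Phi> y s)" using N(1) before_tau_p s by blast
      qed
    qed
  qed
qed

lemma AE_incoming_orbits_ex:
  assumes "AE x in \<nu>. x \<in> \<Omega> \<longrightarrow> P x"
  shows "AE y in \<mu>m. \<exists>s. 0 < s \<and> ereal s < \<tau>p y \<and> P (\<Phi> y s)"
  using AE_space AE_incoming_orbits[OF assms]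
proof eventually_elim
  case (elim y)
  then have "0 < \<tau>p y" by (auto simp: space_\<mu>m Gamma_m_eq)
  then obtain c where c: "0 < ereal c" "ereal c < \<tau>p y" by (metis ereal_dense2)
  have "0 < c" using c(1) by simp
  then obtain s where s: "0 < s" "s < c" "0 < s \<and> ereal s < \<tau>p y \<longrightarrow> P (\<Phi> y s)"
    using AE_lborel_ex_between[OF elim(2)] by blast
  moreover have "ereal s < \<tau>p y"
    using s(2) c(2) by (meson less_ereal.simps(1) less_trans)
  ultimately show ?case by blast
qed

lemmas AE_outgoing_orbits =
  flow_with_boundary.AE_incoming_orbits[OF boundary_reversed, unfolded tau_reversed]

subsection \<open>Transfer between the two boundaries\<close>

lemma entry_point_shift_back:
  assumes "0 < s" "ereal s < \<tau>m x"
  shows "entry_point \<Phi> \<Omega> (\<Phi> x (- s)) = (if \<tau>m x < \<infinity> then entry_point \<Phi> \<Omega> x else entry_point \<Phi> \<Omega> (\<Phi> x (- s)))"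
  using tau_m_shift_back[OF assms] assms by (cases "\<tau>m x") (auto simp: entry_point_def)

lemma tau_p_shift_boundary:
  assumes "y \<notin> \<Omega>" "0 < s" "ereal s < \<tau>m y"
  shows "\<tau>p (\<Phi> y (- s)) = ereal s"
  using continuous_flow.tau_m_shift_boundary[OF reversed, unfolded tau_reversed, OF assms] .

lemma tau_p_entry_of_exit:
  assumes "y \<notin> \<Omega>" "0 < \<tau>m y" "\<tau>m y < \<infinity>"
  shows "\<tau>p (entry_point \<Phi> \<Omega> y) = \<tau>m y" "entry_point \<Phi> \<Omega> y \<in> Gamma_m \<Phi> \<Omega>"
proof -
  obtain c where c: "\<tau>m y = ereal c" "0 < c" using assms by (cases "\<tau>m y") auto
  let ?x = "\<Phi> y (- (c/2))"
  have "?x \<in> \<Omega>" using before_tau_m[of "c/2" y] c by simp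
  moreover have m: "\<tau>m ?x = ereal (c/2)" using tau_m_shift_back[of "c/2" y] c by simp
  moreover have "\<tau>p ?x = ereal (c/2)" using tau_p_shift_boundary[of y "c/2"] c assms by simp
  moreover have "entry_point \<Phi> \<Omega> ?x = entry_point \<Phi> \<Omega> y"
    using entry_point_shift_back[of "c/2" y] c by simp
  ultimately show "\<tau>p (entry_point \<Phi> \<Omega> y) = \<tau>m y" "entry_point \<Phi> \<Omega> y \<in> Gamma_m \<Phi> \<Omega>"
    using c by (auto elim!: from_entry_point)
qed

lemma nn_integral_const_time:
  "(\<integral>\<^sup>+s\<in>{s. 0 < s \<and> s < c}. a \<partial>lborel) = a * ennreal c"
proof -
  have "{s. 0 < s \<and> s < c} = {0<..<c}" by auto
  then show ?thesis
    by (cases "0 \<le> c") (simp_all add: nn_integral_cmult_indicator ennreal_neg)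
qed

text \<open>Both sides equal the integral over the orbits of finite length of \<open>k\<close>, spread uniformly along each
  orbit.\<close>

lemma boundary_transfer:
  assumes [measurable]: "k \<in> borel_measurable borel"
  shows "(\<integral>\<^sup>+y\<in>{y. \<tau>p y < \<infinity>}. k y \<partial>\<mu>m) = (\<integral>\<^sup>+y\<in>{y. \<tau>m y < \<infinity>}. k (entry_point \<Phi> \<Omega> y) \<partial>\<mu>p)"
proof -
  define h where "h x = k (entry_point \<Phi> \<Omega> x) *
    ennreal (1 / (real_of_ereal (\<tau>m x) + real_of_ereal (\<tau>p x))) *
    indicator {x. \<tau>m x < \<infinity> \<and> \<tau>p x < \<infinity>} x" for x
  have [measurable]: "h \<in> borel_measurable borel" unfolding h_def[abs_def] by measurable
  have "(\<integral>\<^sup>+y\<in>{y. \<tau>p y < \<infinity>}. k y \<partial>\<mu>m) =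
      (\<integral>\<^sup>+y. (\<integral>\<^sup>+s\<in>ahead y. h (\<Phi> y s) \<partial>lborel) \<partial>\<mu>m)"
  proof (rule nn_integral_cong)
    fix y assume "y \<in> space \<mu>m"
    then have y: "y \<in> Gamma_m \<Phi> \<Omega>" "y \<notin> \<Omega>" "0 < \<tau>p y" by (auto simp: space_\<mu>m Gamma_m_eq)
    show "k y * indicator {y. \<tau>p y < \<infinity>} y = (\<integral>\<^sup>+s\<in>ahead y. h (\<Phi> y s) \<partial>lborel)"
    proof (cases "\<tau>p y")
      case (real c)
      have "(\<integral>\<^sup>+s\<in>ahead y. h (\<Phi> y s) \<partial>lborel) =
          (\<integral>\<^sup>+s\<in>{s. 0 < s \<and> s < c}. k y * ennreal (1 / c) \<partial>lborel)"
        using real y tau_m_shift_boundary[of y] tau_p_shift[of _ y] entry_point_shift[of y]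
        by (intro nn_integral_cong) (auto simp: h_def split: split_indicator)
      also have "\<dots> = k y"
        unfolding nn_integral_const_time
        using y real by (simp add: mult.assoc ennreal_mult'[symmetric])
      finally show ?thesis using real by simp
    next
      case PInf
      have "h (\<Phi> y s) * indicator (ahead y) s = 0" for s
        using PInf tau_p_shift[of s y] by (auto simp: h_def split: split_indicator)
      then show ?thesis by (simp only: nn_integral_const mult_zero_left, simp add: PInf)
    qed (use y in auto)
  qed
  also have "\<dots> = (\<integral>\<^sup>+x\<in>{x \<in> \<Omega>. \<tau>m x < \<infinity>}. h x \<partial>\<nu>)"
    by (rule incoming[symmetric]) measurable
  also have "\<dots> = (\<integral>\<^sup>+x\<in>{x \<in> \<Omega>. \<tau>p x < \<infinity>}. h x \<partial>\<nu>)"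
    by (intro nn_integral_cong) (auto simp: h_def split: split_indicator)
  also have "\<dots> = (\<integral>\<^sup>+y. (\<integral>\<^sup>+s\<in>behind y. h (\<Phi> y (- s)) \<partial>lborel) \<partial>\<mu>p)"
    by (rule outgoing) measurable
  also have "\<dots> = (\<integral>\<^sup>+y\<in>{y. \<tau>m y < \<infinity>}. k (entry_point \<Phi> \<Omega> y) \<partial>\<mu>p)"
  proof (rule nn_integral_cong)
    fix y assume "y \<in> space \<mu>p"
    then have y: "y \<notin> \<Omega>" "0 < \<tau>m y" by (auto simp: space_\<mu>p Gamma_p_eq)
    show "(\<integral>\<^sup>+s\<in>behind y. h (\<Phi> y (- s)) \<partial>lborel) =
        k (entry_point \<Phi> \<Omega> y) * indicator {y. \<tau>m y < \<infinity>} y"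
    proof (cases "\<tau>m y")
      case (real c)
      have "(\<integral>\<^sup>+s\<in>behind y. h (\<Phi> y (- s)) \<partial>lborel) =
          (\<integral>\<^sup>+s\<in>{s. 0 < s \<and> s < c}. k (entry_point \<Phi> \<Omega> y) * ennreal (1 / c) \<partial>lborel)"
        using real y tau_p_shift_boundary[of y] tau_m_shift_back[of _ y] entry_point_shift_back[of _ y]
        by (intro nn_integral_cong) (auto simp: h_def split: split_indicator)
      also have "\<dots> = k (entry_point \<Phi> \<Omega> y)"
        unfolding nn_integral_const_time
        using y real by (simp add: mult.assoc ennreal_mult'[symmetric])
      finally show ?thesis using real by simp
    next
      case PInf
      have "h (\<Phi> y (- s)) * indicator (behind y) s = 0" for s
        using PInf tau_m_shift_back[of s y] by (auto simp: h_def split: split_indicator)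
      then show ?thesis by (simp only: nn_integral_const mult_zero_left, simp add: PInf)
    qed (use y in auto)
  qed
  finally show ?thesis .
qed

end

section \<open>The resolvent along the orbits\<close>

text \<open>The solution formula for nonnegative data with values in \<open>[0,\<infinity>]\<close>, where no integrability has to be
  checked; evaluated on \<open>\<Gamma>\<^sub>+\<close> it is the outgoing trace.\<close>

definition resolvent_nn ::
  "('a::euclidean_space \<Rightarrow> real \<Rightarrow> 'a) \<Rightarrow> 'a set \<Rightarrow> real \<Rightarrow> ('a \<Rightarrow> ennreal) \<Rightarrow> ('a \<Rightarrow> ennreal) \<Rightarrow> 'a \<Rightarrow> ennreal" where
  "resolvent_nn \<Phi> \<Omega> lam g u x =
    (\<integral>\<^sup>+t\<in>{t. 0 < t \<and> ereal t < tau_m \<Phi> \<Omega> x}. ennreal (exp (- lam * t)) * g (\<Phi> x (- t)) \<partial>lborel) +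
    (if tau_m \<Phi> \<Omega> x < \<infinity>
     then ennreal (exp (- lam * real_of_ereal (tau_m \<Phi> \<Omega> x))) * u (entry_point \<Phi> \<Omega> x) else 0)"

definition adjoint_resolvent_nn ::
  "('a::euclidean_space \<Rightarrow> real \<Rightarrow> 'a) \<Rightarrow> 'a set \<Rightarrow> real \<Rightarrow> ('a \<Rightarrow> ennreal) \<Rightarrow> 'a \<Rightarrow> ennreal" where
  "adjoint_resolvent_nn \<Phi> \<Omega> lam \<phi> x =
    (\<integral>\<^sup>+t\<in>{t. 0 < t \<and> ereal t < tau_p \<Phi> \<Omega> x}. ennreal (exp (- lam * t)) * \<phi> (\<Phi> x t) \<partial>lborel)"

context flow_with_boundary
begin

lemma measurable_resolvent_nn [measurable]:
  assumes [measurable]: "g \<in> borel_measurable borel" "u \<in> borel_measurable borel"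
  shows "resolvent_nn \<Phi> \<Omega> lam g u \<in> borel_measurable borel"
  unfolding resolvent_nn_def[abs_def] by measurable

lemma measurable_adjoint_resolvent_nn [measurable]:
  assumes [measurable]: "\<phi> \<in> borel_measurable borel"
  shows "adjoint_resolvent_nn \<Phi> \<Omega> lam \<phi> \<in> borel_measurable borel"
  unfolding adjoint_resolvent_nn_def[abs_def] by measurable

text \<open>For the part driven by \<open>g\<close> this is the change of variables along orbit segments, for the part driven by
  \<open>u\<close> it is \<open>incoming_formula\<close>.\<close>

lemma resolvent_duality:
  assumes [measurable]: "g \<in> borel_measurable borel" "u \<in> borel_measurable borel" "\<phi> \<in> borel_measurable borel"
  shows "(\<integral>\<^sup>+x\<in>\<Omega>. resolvent_nn \<Phi> \<Omega> lam g u x * \<phi> x \<partial>\<nu>) =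
    (\<integral>\<^sup>+x\<in>\<Omega>. g x * adjoint_resolvent_nn \<Phi> \<Omega> lam \<phi> x \<partial>\<nu>) +
    (\<integral>\<^sup>+y. u y * adjoint_resolvent_nn \<Phi> \<Omega> lam \<phi> y \<partial>\<mu>m)"
proof -
  let ?k = "\<lambda>t. ennreal (exp (- lam * t))"
  define A where "A x = (\<integral>\<^sup>+t\<in>behind x. ?k t * g (\<Phi> x (- t)) \<partial>lborel)" for x
  define B where "B x = ?k (real_of_ereal (\<tau>m x)) * u (entry_point \<Phi> \<Omega> x)" for x
  have [measurable]: "A \<in> borel_measurable borel" "B \<in> borel_measurable borel"
    unfolding A_def[abs_def] B_def[abs_def] by measurable
  have "(\<integral>\<^sup>+x\<in>\<Omega>. resolvent_nn \<Phi> \<Omega> lam g u x * \<phi> x \<partial>\<nu>) =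
      (\<integral>\<^sup>+x. A x * \<phi> x * indicator \<Omega> x + B x * \<phi> x * indicator {x \<in> \<Omega>. \<tau>m x < \<infinity>} x \<partial>\<nu>)"
    unfolding resolvent_nn_def A_def B_def
    by (intro nn_integral_cong) (auto simp: distrib_right split: split_indicator)
  also have "\<dots> = (\<integral>\<^sup>+x\<in>\<Omega>. A x * \<phi> x \<partial>\<nu>) + (\<integral>\<^sup>+x\<in>{x \<in> \<Omega>. \<tau>m x < \<infinity>}. B x * \<phi> x \<partial>\<nu>)"
    by (rule nn_integral_add) measurable
  also have "(\<integral>\<^sup>+x\<in>\<Omega>. A x * \<phi> x \<partial>\<nu>) =
      (\<integral>\<^sup>+x\<in>\<Omega>. (\<integral>\<^sup>+t\<in>behind x.
        ?k t * g (\<Phi> x (- t)) * \<phi> (\<Phi> (\<Phi> x (- t)) t) \<partial>lborel) \<partial>\<nu>)"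
    unfolding A_def
    by (intro nn_integral_cong, subst nn_integral_multc[symmetric])
       (auto simp: ac_simps intro!: nn_integral_cong arg_cong2[where f = "(*)"])
  also have "\<dots> = (\<integral>\<^sup>+x\<in>\<Omega>. (\<integral>\<^sup>+t\<in>ahead x. ?k t * g x * \<phi> (\<Phi> x t) \<partial>lborel) \<partial>\<nu>)"
    by (rule nn_integral_segments[of "\<lambda>z t. ?k t * g z * \<phi> (\<Phi> z t)"]) measurable
  also have "\<dots> = (\<integral>\<^sup>+x\<in>\<Omega>. g x * adjoint_resolvent_nn \<Phi> \<Omega> lam \<phi> x \<partial>\<nu>)"
    unfolding adjoint_resolvent_nn_def
    by (intro nn_integral_cong, subst nn_integral_cmult[symmetric])
       (auto simp: ac_simps intro!: nn_integral_cong arg_cong2[where f = "(*)"])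
  also have "(\<integral>\<^sup>+x\<in>{x \<in> \<Omega>. \<tau>m x < \<infinity>}. B x * \<phi> x \<partial>\<nu>) =
      (\<integral>\<^sup>+y. (\<integral>\<^sup>+s\<in>ahead y. B (\<Phi> y s) * \<phi> (\<Phi> y s) \<partial>lborel) \<partial>\<mu>m)"
    by (rule incoming) measurable
  also have "\<dots> = (\<integral>\<^sup>+y. u y * adjoint_resolvent_nn \<Phi> \<Omega> lam \<phi> y \<partial>\<mu>m)"
  proof (rule nn_integral_cong)
    fix y assume "y \<in> space \<mu>m"
    then have y: "y \<in> Gamma_m \<Phi> \<Omega>" "y \<notin> \<Omega>" by (auto simp: space_\<mu>m Gamma_m_eq)
    show "(\<integral>\<^sup>+s\<in>ahead y. B (\<Phi> y s) * \<phi> (\<Phi> y s) \<partial>lborel) =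
        u y * adjoint_resolvent_nn \<Phi> \<Omega> lam \<phi> y"
      unfolding adjoint_resolvent_nn_def
      using y tau_m_shift_boundary[of y] entry_point_shift[of y]
      by (subst nn_integral_cmult[symmetric])
         (auto simp: B_def ac_simps intro!: nn_integral_cong split: split_indicator)
  qed
  finally show ?thesis .
qed

text \<open>Mass created at \<open>x\<close> leaves with the weight \<open>exp (- lam \<tau>\<^sub>+(x))\<close>. For \<open>g\<close> this is the formula for
  \<open>\<mu>\<^sub>+\<close>, for \<open>u\<close> the transport of \<open>\<mu>\<^sub>-\<close> to \<open>\<mu>\<^sub>+\<close>.\<close>

lemma resolvent_outflow:
  fixes lam :: real
  assumes [measurable]: "g \<in> borel_measurable borel" "u \<in> borel_measurable borel"
  defines "E \<equiv> \<lambda>x. ennreal (exp (- lam * real_of_ereal (\<tau>p x))) * indicator {x. \<tau>p x < \<infinity>} x"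
  shows "(\<integral>\<^sup>+y. resolvent_nn \<Phi> \<Omega> lam g u y \<partial>\<mu>p) =
    (\<integral>\<^sup>+x\<in>\<Omega>. g x * E x \<partial>\<nu>) + (\<integral>\<^sup>+y. u y * E y \<partial>\<mu>m)"
proof -
  let ?k = "\<lambda>t. ennreal (exp (- lam * t))"
  have [measurable]: "E \<in> borel_measurable borel" unfolding E_def by measurable
  define A where "A x = (\<integral>\<^sup>+t\<in>behind x. ?k t * g (\<Phi> x (- t)) \<partial>lborel)" for x
  have [measurable]: "A \<in> borel_measurable borel" unfolding A_def[abs_def] by measurable
  define k where "k y = ?k (real_of_ereal (\<tau>p y)) * u y" for y
  have [measurable]: "k \<in> borel_measurable borel" unfolding k_def[abs_def] by measurable
  have "(\<integral>\<^sup>+y. resolvent_nn \<Phi> \<Omega> lam g u y \<partial>\<mu>p) =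
      (\<integral>\<^sup>+y. A y + k (entry_point \<Phi> \<Omega> y) * indicator {y. \<tau>m y < \<infinity>} y \<partial>\<mu>p)"
  proof (rule nn_integral_cong)
    fix y assume "y \<in> space \<mu>p"
    then have y: "y \<notin> \<Omega>" "0 < \<tau>m y" by (auto simp: space_\<mu>p Gamma_p_eq)
    show "resolvent_nn \<Phi> \<Omega> lam g u y = A y + k (entry_point \<Phi> \<Omega> y) * indicator {y. \<tau>m y < \<infinity>} y"
      using tau_p_entry_of_exit[of y] y by (auto simp: resolvent_nn_def A_def k_def)
  qed
  also have "\<dots> = (\<integral>\<^sup>+y. A y \<partial>\<mu>p) + (\<integral>\<^sup>+y\<in>{y. \<tau>m y < \<infinity>}. k (entry_point \<Phi> \<Omega> y) \<partial>\<mu>p)"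
    by (intro nn_integral_add measurable_\<mu>p) measurable
  also have "(\<integral>\<^sup>+y\<in>{y. \<tau>m y < \<infinity>}. k (entry_point \<Phi> \<Omega> y) \<partial>\<mu>p) = (\<integral>\<^sup>+y\<in>{y. \<tau>p y < \<infinity>}. k y \<partial>\<mu>m)"
    by (rule boundary_transfer[symmetric]) measurable
  also have "\<dots> = (\<integral>\<^sup>+y. u y * E y \<partial>\<mu>m)"
    by (intro nn_integral_cong) (simp add: k_def E_def ac_simps)
  also have "(\<integral>\<^sup>+y. A y \<partial>\<mu>p) =
      (\<integral>\<^sup>+y. (\<integral>\<^sup>+s\<in>behind y. g (\<Phi> y (- s)) * E (\<Phi> y (- s)) \<partial>lborel) \<partial>\<mu>p)"
  proof (rule nn_integral_cong)
    fix y assume "y \<in> space \<mu>p"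
    then have y: "y \<notin> \<Omega>" "0 < \<tau>m y" by (auto simp: space_\<mu>p Gamma_p_eq)
    show "A y = (\<integral>\<^sup>+s\<in>behind y. g (\<Phi> y (- s)) * E (\<Phi> y (- s)) \<partial>lborel)"
      unfolding A_def using y tau_p_shift_boundary[of y]
      by (intro nn_integral_cong) (auto simp: E_def ac_simps split: split_indicator)
  qed
  also have "\<dots> = (\<integral>\<^sup>+x\<in>{x \<in> \<Omega>. \<tau>p x < \<infinity>}. g x * E x \<partial>\<nu>)"
    by (rule outgoing[symmetric]) measurable
  also have "\<dots> = (\<integral>\<^sup>+x\<in>\<Omega>. g x * E x \<partial>\<nu>)"
    by (intro nn_integral_cong) (auto simp: E_def split: split_indicator)
  finally show ?thesis .
qed

lemma survival_plus_absorption: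
  assumes "0 < lam" "0 < \<tau>p x"
  shows "adjoint_resolvent_nn \<Phi> \<Omega> lam (\<lambda>_. ennreal lam) x +
    ennreal (exp (- lam * real_of_ereal (\<tau>p x))) * indicator {x. \<tau>p x < \<infinity>} x = 1"
proof (cases "\<tau>p x")
  case (real c)
  have F: "((\<lambda>t. - exp (- lam * t)) has_real_derivative lam * exp (- lam * t)) (at t)" for t
    by (auto intro!: derivative_eq_intros)
  have "c > 0" using real assms by simp
  have "adjoint_resolvent_nn \<Phi> \<Omega> lam (\<lambda>_. ennreal lam) x =
      (\<integral>\<^sup>+t. ennreal (lam * exp (- lam * t)) * indicator {0..c} t \<partial>lborel)"
    unfolding adjoint_resolvent_nn_def using assms real
    by (intro nn_integral_cong_AE AE_mp[OF AE_lborel_singleton[of 0] AE_mp[OF AE_lborel_singleton[of c] AE_I2]])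
       (auto simp: ennreal_mult'[symmetric] mult.commute split: split_indicator)
  also have "\<dots> = ennreal (- exp (- lam * c) - (- exp (- lam * 0)))"
    using assms \<open>c > 0\<close> F by (intro nn_integral_FTC_Icc[OF _ has_field_derivative_at_within[OF F]]) auto
  also have "\<dots> = ennreal (1 - exp (- lam * c))" by simp
  also have "\<dots> + ennreal (exp (- lam * c)) = 1"
    using assms \<open>c > 0\<close> by (subst ennreal_plus[symmetric]) auto
  finally show ?thesis using real by simp
next
  case PInf
  have F: "((\<lambda>t. - exp (- lam * t)) has_real_derivative lam * exp (- lam * t)) (at t)" for t
    by (auto intro!: derivative_eq_intros)
  have "adjoint_resolvent_nn \<Phi> \<Omega> lam (\<lambda>_. ennreal lam) x =
      (\<integral>\<^sup>+t. ennreal (lam * exp (- lam * t)) * indicator {0..} t \<partial>lborel)"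
    unfolding adjoint_resolvent_nn_def using assms PInf
    by (intro nn_integral_cong_AE AE_mp[OF AE_lborel_singleton[of 0] AE_I2])
       (auto simp: ennreal_mult'[symmetric] mult.commute split: split_indicator)
  also have "\<dots> = ennreal (0 - (- exp (- lam * 0)))"
  proof (intro nn_integral_FTC_atLeast[OF _ F])
    have "((\<lambda>t. - exp (- (lam * t))) \<longlongrightarrow> - 0) at_top"
      using assms(1)
      by (intro tendsto_minus filterlim_compose[OF exp_at_bot] filterlim_uminus_at_bot[THEN iffD2])
         (auto intro!: filterlim_tendsto_pos_mult_at_top[OF tendsto_const] filterlim_ident)
    then show "((\<lambda>t. - exp (- lam * t)) \<longlongrightarrow> 0) at_top" by simp
  qed (use assms in auto)
  finally show ?thesis using PInf by simp
qed (use assms in auto)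

text \<open>Conservation of mass: what enters is either absorbed, at rate \<open>lam\<close>, or leaves through \<open>\<Gamma>\<^sub>+\<close>.\<close>

lemma resolvent_balance:
  assumes lam: "0 < lam" and [measurable]: "g \<in> borel_measurable borel" "u \<in> borel_measurable borel"
  shows "ennreal lam * (\<integral>\<^sup>+x\<in>\<Omega>. resolvent_nn \<Phi> \<Omega> lam g u x \<partial>\<nu>) + (\<integral>\<^sup>+y. resolvent_nn \<Phi> \<Omega> lam g u y \<partial>\<mu>p) =
    (\<integral>\<^sup>+x\<in>\<Omega>. g x \<partial>\<nu>) + (\<integral>\<^sup>+y. u y \<partial>\<mu>m)"
proof -
  define E where "E x = ennreal (exp (- lam * real_of_ereal (\<tau>p x))) * indicator {x. \<tau>p x < \<infinity>} x" for x
  let ?D = "adjoint_resolvent_nn \<Phi> \<Omega> lam (\<lambda>_. ennreal lam)"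
  have [measurable]: "E \<in> borel_measurable borel" unfolding E_def[abs_def] by measurable
  have one: "?D x + E x = 1" if "0 < \<tau>p x" for x
    using survival_plus_absorption[OF lam that] by (simp add: E_def)
  have "ennreal lam * (\<integral>\<^sup>+x\<in>\<Omega>. resolvent_nn \<Phi> \<Omega> lam g u x \<partial>\<nu>) =
      (\<integral>\<^sup>+x\<in>\<Omega>. resolvent_nn \<Phi> \<Omega> lam g u x * ennreal lam \<partial>\<nu>)"
    by (subst nn_integral_cmult[symmetric]) (auto simp: ac_simps intro!: nn_integral_cong)
  also have "\<dots> = (\<integral>\<^sup>+x\<in>\<Omega>. g x * ?D x \<partial>\<nu>) + (\<integral>\<^sup>+y. u y * ?D y \<partial>\<mu>m)"
    by (rule resolvent_duality) measurable
  finally have 1: "ennreal lam * (\<integral>\<^sup>+x\<in>\<Omega>. resolvent_nn \<Phi> \<Omega> lam g u x \<partial>\<nu>) =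
      (\<integral>\<^sup>+x\<in>\<Omega>. g x * ?D x \<partial>\<nu>) + (\<integral>\<^sup>+y. u y * ?D y \<partial>\<mu>m)" .
  have 2: "(\<integral>\<^sup>+y. resolvent_nn \<Phi> \<Omega> lam g u y \<partial>\<mu>p) = (\<integral>\<^sup>+x\<in>\<Omega>. g x * E x \<partial>\<nu>) + (\<integral>\<^sup>+y. u y * E y \<partial>\<mu>m)"
    unfolding E_def by (rule resolvent_outflow) measurable
  have "(\<integral>\<^sup>+x\<in>\<Omega>. g x * ?D x \<partial>\<nu>) + (\<integral>\<^sup>+x\<in>\<Omega>. g x * E x \<partial>\<nu>) = (\<integral>\<^sup>+x. g x * ?D x * indicator \<Omega> x + g x * E x * indicator \<Omega> x \<partial>\<nu>)"
    by (rule nn_integral_add[symmetric]) measurable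
  also have "\<dots> = (\<integral>\<^sup>+x\<in>\<Omega>. g x \<partial>\<nu>)"
    using one[OF tau_p_pos]
    by (intro nn_integral_cong) (auto simp: distrib_left[symmetric] split: split_indicator)
  finally have 3: "(\<integral>\<^sup>+x\<in>\<Omega>. g x * ?D x \<partial>\<nu>) + (\<integral>\<^sup>+x\<in>\<Omega>. g x * E x \<partial>\<nu>) = (\<integral>\<^sup>+x\<in>\<Omega>. g x \<partial>\<nu>)" .
  have "(\<integral>\<^sup>+y. u y * ?D y \<partial>\<mu>m) + (\<integral>\<^sup>+y. u y * E y \<partial>\<mu>m) = (\<integral>\<^sup>+y. u y * ?D y + u y * E y \<partial>\<mu>m)"
    by (intro nn_integral_add[symmetric] measurable_\<mu>m) measurable
  also have "\<dots> = (\<integral>\<^sup>+y. u y \<partial>\<mu>m)"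
    using one by (intro nn_integral_cong) (auto simp: distrib_left[symmetric] space_\<mu>m Gamma_m_eq)
  finally have 4: "(\<integral>\<^sup>+y. u y * ?D y \<partial>\<mu>m) + (\<integral>\<^sup>+y. u y * E y \<partial>\<mu>m) = (\<integral>\<^sup>+y. u y \<partial>\<mu>m)" .
  show ?thesis
    unfolding 1 2 3[symmetric] 4[symmetric] by (simp add: ac_simps)
qed

end

section \<open>Scalar linear equations with integrable data\<close>

lemma isCont_integral_upper_limit:
  fixes q :: "real \<Rightarrow> real"
  assumes q: "integrable lborel q"
  shows "isCont (\<lambda>c. LINT t:{0<..c}|lborel. q t) c"
  unfolding continuous_at_sequentially
proof (intro allI impI)
  fix X :: "nat \<Rightarrow> real" assume X: "X \<longlonglongrightarrow> c"
  have [measurable]: "q \<in> borel_measurable lborel" using q by auto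
  have "(\<lambda>n. \<integral>t. indicator {0<..X n} t *\<^sub>R q t \<partial>lborel) \<longlonglongrightarrow> (\<integral>t. indicator {0<..c} t *\<^sub>R q t \<partial>lborel)"
  proof (rule integral_dominated_convergence[where w = "\<lambda>t. norm (q t)"])
    show "AE t in lborel. (\<lambda>n. indicator {0<..X n} t *\<^sub>R q t) \<longlonglongrightarrow> indicator {0<..c} t *\<^sub>R q t"
      using AE_lborel_singleton[of c]
    proof eventually_elim
      case (elim t)
      have "eventually (\<lambda>n. indicator {0<..X n} t = (indicator {0<..c} t :: real)) sequentially"
      proof (cases "t < c")
        case True
        show ?thesis using order_tendstoD(1)[OF X True]
          by eventually_elim (use True in \<open>auto split: split_indicator\<close>)
      next
        case False
        then have "c < t" using elim by simp
        show ?thesis using order_tendstoD(2)[OF X \<open>c < t\<close>]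
          by eventually_elim (use \<open>c < t\<close> in \<open>auto split: split_indicator\<close>)
      qed
      then show ?case by (intro tendsto_scaleR tendsto_const) (simp add: tendsto_eventually)
    qed
  qed (use q in \<open>auto split: split_indicator\<close>)
  then show "((\<lambda>c. LINT t:{0<..c}|lborel. q t) \<circ> X) \<longlonglongrightarrow> (LINT t:{0<..c}|lborel. q t)"
    by (simp add: set_lebesgue_integral_def o_def)
qed

text \<open>The variation of constants formula implies the integrated equation; Fubini's theorem on the
  triangle \<open>a \<le> r < s \<le> b\<close> replaces a derivative, which exists only almost everywhere.\<close>

lemma variation_of_constants_integrated:
  fixes k w :: "real \<Rightarrow> real"
  assumes lam: "0 < lam" and ab: "a \<le> b" and k: "set_integrable lborel {a..b} k"
    and w: "\<And>s. a \<le> s \<Longrightarrow> s \<le> b \<Longrightarrow>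
      w s = exp (- lam * (s - a)) * (w a + (LINT r:{a..<s}|lborel. exp (lam * (r - a)) * k r))"
  shows "set_integrable lborel {a..b} w"
    and "(LINT s:{a..b}|lborel. lam * w s - k s) = w a - w b"
proof -
  define k' where "k' r = indicator {a..b} r * k r" for r
  have k'_int: "integrable lborel k'" using k by (simp add: set_integrable_def k'_def[abs_def])
  then have [measurable]: "k' \<in> borel_measurable borel" by auto
  define H where "H s r = (if a \<le> r \<and> r < s \<and> s \<le> b then lam * exp (- lam * (s - a)) * (exp (lam * (r - a)) * k' r) else 0)" for s r
  have H_meas [measurable]: "case_prod H \<in> borel_measurable (lborel \<Otimes>\<^sub>M lborel)"
    unfolding H_def[abs_def] by measurable
  have H_bound: "norm (H s r) \<le> lam * indicator {a..b} s * norm (k' r)" for s r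
  proof (cases "a \<le> r \<and> r < s \<and> s \<le> b")
    case True
    have "norm (H s r) = lam * (exp (- lam * (s - r)) * norm (k' r))"
      using True lam by (simp add: H_def abs_mult mult.assoc[symmetric] exp_add[symmetric] right_diff_distrib)
    also have "\<dots> \<le> lam * (1 * norm (k' r))"
      using True lam by (intro mult_left_mono mult_right_mono) auto
    finally show ?thesis using True by simp
  qed (use lam in \<open>auto simp: H_def\<close>)
  have "integrable (lborel \<Otimes>\<^sub>M lborel) (case_prod H)"
  proof (rule lborel_pair.Fubini_integrable)
    have *: "integrable lborel (\<lambda>r. norm (H s r))" for s
      by (rule Bochner_Integration.integrable_bound[OF integrable_mult_right[OF integrable_norm[OF k'_int], of "lam * indicator {a..b} s"]])
         (use H_bound[of s] lam in \<open>auto\<close>)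
    have "H s \<in> borel_measurable lborel" for s
      unfolding H_def[abs_def] by measurable
    then have "integrable lborel (H s)" for s
      using * integrable_norm_cancel by blast
    then show "AE s in lborel. integrable lborel (\<lambda>r. case (s, r) of (s, r) \<Rightarrow> H s r)"
      by simp
    show "integrable lborel (\<lambda>s. LINT r|lborel. norm (case (s, r) of (s, r) \<Rightarrow> H s r))"
    proof (rule Bochner_Integration.integrable_bound)
      show "integrable lborel (\<lambda>s. (lam * (LINT r|lborel. norm (k' r))) * indicator {a..b} s)"
        by (intro integrable_mult_right integrable_real_indicator) (auto simp: emeasure_lborel_Icc_eq)
      have "(LINT r|lborel. norm (H s r)) \<le> (LINT r|lborel. lam * indicator {a..b} s * norm (k' r))" for s
        using * H_bound k'_int by (intro integral_mono) auto
      then show "AE s in lborel. norm (LINT r|lborel. norm (case (s, r) of (s, r) \<Rightarrow> H s r))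
          \<le> norm (lam * (LINT r|lborel. norm (k' r)) * indicator {a..b} s)"
        using lam by (intro AE_I2) (auto simp: ac_simps integral_nonneg_AE)
    qed measurable
  qed measurable
  note H_int = this
  define K where "K s = (LINT r:{a..<s}|lborel. exp (lam * (r - a)) * k r)" for s
  have Hs: "(LINT r|lborel. H s r) = indicator {a..b} s * (lam * (exp (- lam * (s - a)) * K s))" for s
  proof (cases "a \<le> s \<and> s \<le> b")
    case True
    have "(LINT r|lborel. H s r) = (LINT r|lborel. (lam * exp (- lam * (s - a))) * (indicator {a..<s} r *\<^sub>R (exp (lam * (r - a)) * k r)))"
      using True by (intro Bochner_Integration.integral_cong) (auto simp: H_def k'_def split: split_indicator)
    then show ?thesis using True by (simp add: K_def set_lebesgue_integral_def)
  next
    case False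
    then have "H s r = 0" for r by (auto simp: H_def)
    with False show ?thesis by auto
  qed
  have Hs_int: "integrable lborel (\<lambda>s. LINT r|lborel. H s r)"
    using lborel_pair.integrable_fst[OF H_int] .
  have w_eq: "indicator {a..b} s * (lam * w s) =
      indicator {a..b} s * (lam * exp (- lam * (s - a)) * w a) + (LINT r|lborel. H s r)" for s
  proof (cases "s \<in> {a..b}")
    case True
    then have "w s = exp (- lam * (s - a)) * (w a + K s)"
      using w[of s] by (simp add: K_def)
    then show ?thesis using True by (simp add: Hs distrib_left)
  qed (simp add: Hs)
  have e_int: "integrable lborel (\<lambda>s. indicator {a..b} s * (lam * exp (- lam * (s - a)) * w a))"
  proof -
    have "continuous_on {a..b} (\<lambda>s. lam * exp (- lam * (s - a)) * w a)"
      by (intro continuous_intros)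
    from borel_integrable_atLeastAtMost'[OF this] show ?thesis
      by (simp add: set_integrable_def)
  qed
  have lw_int: "integrable lborel (\<lambda>s. indicator {a..b} s * (lam * w s))"
    unfolding w_eq by (intro Bochner_Integration.integrable_add e_int Hs_int)
  then have "integrable lborel (\<lambda>s. (1 / lam) * (indicator {a..b} s * (lam * w s)))"
    by (rule integrable_mult_right)
  then show w_int: "set_integrable lborel {a..b} w"
    using lam by (simp add: set_integrable_def)
  have F: "((\<lambda>s. - exp (- lam * (s - a))) has_real_derivative lam * exp (- lam * (s - a))) (at s within S)" for s S
    by (auto intro!: derivative_eq_intros)
  have exp_int: "(LINT s|lborel. indicator {r..b} s * (lam * exp (- lam * (s - a)))) =
      exp (- lam * (r - a)) - exp (- lam * (b - a))" if "r \<le> b" for r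
  proof -
    have "continuous_on {r..b} (\<lambda>s. lam * exp (- lam * (s - a)))"
      by (intro continuous_intros)
    from integral_FTC_Icc[OF that F[THEN has_real_derivative_iff_has_vector_derivative[THEN iffD1]] this]
    show ?thesis by simp
  qed
  have k_k': "indicator {a..<b} r *\<^sub>R (exp (lam * (r - a)) * k r) = indicator {a..<b} r *\<^sub>R (exp (lam * (r - a)) * k' r)" for r
    by (auto simp: k'_def split: split_indicator)
  have "(LINT s|lborel. LINT r|lborel. H s r) = (LINT r|lborel. LINT s|lborel. H s r)"
    by (rule lborel_pair.Fubini_integral[OF H_int, symmetric])
  also have "\<dots> = (LINT r|lborel. k' r - exp (- lam * (b - a)) * (indicator {a..<b} r *\<^sub>R (exp (lam * (r - a)) * k r)))"
  proof (rule integral_cong_AE)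
    show "AE r in lborel. (LINT s|lborel. H s r) =
        k' r - exp (- lam * (b - a)) * (indicator {a..<b} r *\<^sub>R (exp (lam * (r - a)) * k r))"
      using AE_lborel_singleton[of b]
    proof eventually_elim
      case (elim r)
      show ?case
      proof (cases "a \<le> r \<and> r < b")
        case True
        have "(LINT s|lborel. H s r) =
            (LINT s|lborel. (exp (lam * (r - a)) * k' r) * (indicator {r..b} s * (lam * exp (- lam * (s - a)))))"
          using True AE_lborel_singleton[of r]
          by (intro integral_cong_AE) (auto simp: H_def split: split_indicator)
        also have "\<dots> = (exp (lam * (r - a)) * k' r) * (exp (- lam * (r - a)) - exp (- lam * (b - a)))"
          using True exp_int[of r] by simp
        also have "\<dots> = (exp (lam * (r - a)) * exp (- lam * (r - a))) * k' r - exp (- lam * (b - a)) * (exp (lam * (r - a)) * k' r)"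
          by (simp only: right_diff_distrib ac_simps)
        also have "exp (lam * (r - a)) * exp (- lam * (r - a)) = 1"
          by (simp add: exp_add[symmetric])
        finally show ?thesis using True by (simp add: k'_def)
      next
        case False
        then have "H s r = 0" for s by (auto simp: H_def)
        with False elim show ?thesis by (auto simp: k'_def)
      qed
    qed
    show "(\<lambda>r. k' r - exp (- lam * (b - a)) * (indicator {a..<b} r *\<^sub>R (exp (lam * (r - a)) * k r))) \<in> borel_measurable lborel"
      unfolding k_k' by measurable
  qed measurable
  also have "\<dots> = (LINT r|lborel. k' r) - exp (- lam * (b - a)) * K b"
  proof -
    have "integrable lborel (\<lambda>r. indicator {a..<b} r *\<^sub>R (exp (lam * (r - a)) * k' r))"
    proof (rule Bochner_Integration.integrable_bound[OF integrable_mult_right[OF integrable_norm[OF k'_int], of "exp (lam * (b - a))"]])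
      show "AE r in lborel. norm (indicator {a..<b} r *\<^sub>R (exp (lam * (r - a)) * k' r)) \<le> norm (exp (lam * (b - a)) * norm (k' r))"
        using lam by (intro AE_I2) (auto simp: abs_mult split: split_indicator intro!: mult_right_mono)
    qed measurable
    then have "integrable lborel (\<lambda>r. indicator {a..<b} r *\<^sub>R (exp (lam * (r - a)) * k r))"
      unfolding k_k' .
    then show ?thesis using k'_int by (simp add: K_def set_lebesgue_integral_def)
  qed
  finally have fub: "(LINT s|lborel. LINT r|lborel. H s r) = (LINT r|lborel. k' r) - exp (- lam * (b - a)) * K b" .
  have "(LINT s:{a..b}|lborel. lam * w s - k s) = (LINT s|lborel. indicator {a..b} s * (lam * w s) - k' s)"
    unfolding set_lebesgue_integral_def by (intro Bochner_Integration.integral_cong) (auto simp: k'_def algebra_simps)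
  also have "\<dots> = (LINT s|lborel. indicator {a..b} s * (lam * w s)) - (LINT s|lborel. k' s)"
    by (rule Bochner_Integration.integral_diff[OF lw_int k'_int])
  also have "(LINT s|lborel. indicator {a..b} s * (lam * w s)) =
      (LINT s|lborel. indicator {a..b} s * (lam * exp (- lam * (s - a)) * w a)) + (LINT s|lborel. LINT r|lborel. H s r)"
    unfolding w_eq by (rule Bochner_Integration.integral_add[OF e_int Hs_int])
  also have "(LINT s|lborel. indicator {a..b} s * (lam * exp (- lam * (s - a)) * w a)) = (1 - exp (- lam * (b - a))) * w a"
    using exp_int[OF ab] by (simp add: mult.assoc[symmetric])
  finally show "(LINT s:{a..b}|lborel. lam * w s - k s) = w a - w b"
    using w[of b, folded K_def] ab by (simp add: fub k'_def set_lebesgue_integral_def algebra_simps)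
qed

text \<open>The function \<open>D\<close> need not be Borel, which is why the right-hand side is stated for a Borel version
  \<open>E\<close> of it; a posteriori \<open>D\<close> is continuous.\<close>

lemma homogeneous_equation_solution:
  fixes D E :: "real \<Rightarrow> real"
  assumes ab: "a \<le> b"
    and int: "set_integrable lborel {a..b} E"
    and ED: "AE s in lborel. a \<le> s \<and> s \<le> b \<longrightarrow> E s = D s"
    and eq: "\<And>s. a \<le> s \<Longrightarrow> s \<le> b \<Longrightarrow> D a - D s = (LINT r:{a..s}|lborel. lam * E r)"
  shows "D b = exp (- lam * (b - a)) * D a"
proof -
  have sub: "set_integrable lborel {a..s} E" if "s \<le> b" for s
    using that by (intro set_integrable_subset[OF int]) auto
  have D_eq: "D s = D a - lam * integral {a..s} E" if "a \<le> s" "s \<le> b" for s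
    using eq[OF that] set_borel_integral_eq_integral(2)[OF sub[OF that(2)]] by simp
  have "continuous_on {a..b} (\<lambda>s. D a - lam * integral {a..s} E)"
    using set_borel_integral_eq_integral(1)[OF int]
    by (intro continuous_intros indefinite_integral_continuous_1)
  then have cont: "continuous_on {a..b} D"
    by (rule continuous_on_eq) (metis D_eq atLeastAtMost_iff)
  have ints: "integral {a..s} E = integral {a..s} D" if "s \<le> b" for s
  proof -
    have D_int: "set_integrable lborel {a..s} D"
      using that by (intro borel_integrable_atLeastAtMost' continuous_on_subset[OF cont]) auto
    have "(LINT r:{a..s}|lborel. E r) = (LINT r:{a..s}|lborel. D r)"
      unfolding set_lebesgue_integral_def
    proof (rule integral_cong_AE)
      show "AE r in lborel. indicator {a..s} r *\<^sub>R E r = indicator {a..s} r *\<^sub>R D r"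
        using ED by eventually_elim (use that in \<open>auto split: split_indicator\<close>)
    qed (use D_int sub[OF that] in \<open>auto simp: set_integrable_def\<close>)
    then show ?thesis
      using set_borel_integral_eq_integral(2)[OF D_int] set_borel_integral_eq_integral(2)[OF sub[OF that]] by simp
  qed
  have deriv: "(D has_real_derivative - lam * D s) (at s within {a..b})" if "s \<in> {a..b}" for s
  proof -
    have "((\<lambda>s. D a - lam * integral {a..s} D) has_real_derivative - lam * D s) (at s within {a..b})"
      by (auto intro!: derivative_eq_intros integral_has_real_derivative[OF cont that])
    then show ?thesis
      by (rule has_field_derivative_transform_within[OF _ zero_less_one that]) (metis D_eq ints atLeastAtMost_iff)
  qed
  have "((\<lambda>s. exp (lam * (s - a)) * D s) has_real_derivative 0) (at s within {a..b})" if "s \<in> {a..b}" for s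
    by (rule derivative_eq_intros deriv[OF that] refl | simp)+
  then have "\<exists>c. \<forall>s\<in>{a..b}. exp (lam * (s - a)) * D s = c"
    by (intro has_field_derivative_zero_constant) auto
  then have "exp (lam * (b - a)) * D b = exp (lam * (a - a)) * D a"
    using ab by (metis atLeastAtMost_iff order_refl)
  then have "exp (- lam * (b - a)) * (exp (lam * (b - a)) * D b) = exp (- lam * (b - a)) * D a"
    by simp
  then show ?thesis by (simp add: mult.assoc[symmetric] exp_add[symmetric])
qed

section \<open>The solution formula along a single orbit\<close>

definition resolvent ::
  "('a::euclidean_space \<Rightarrow> real \<Rightarrow> 'a) \<Rightarrow> 'a set \<Rightarrow> real \<Rightarrow> ('a \<Rightarrow> real) \<Rightarrow> ('a \<Rightarrow> real) \<Rightarrow> 'a \<Rightarrow> real" where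
  "resolvent \<Phi> \<Omega> lam g u x =
    (LINT t:{t. 0 < t \<and> ereal t < tau_m \<Phi> \<Omega> x}|lborel. exp (- lam * t) * g (\<Phi> x (- t))) +
    (if tau_m \<Phi> \<Omega> x < \<infinity>
     then exp (- lam * real_of_ereal (tau_m \<Phi> \<Omega> x)) * u (entry_point \<Phi> \<Omega> x) else 0)"

text \<open>The integral in \<open>resolvent\<close> is \<open>0\<close> by convention when it diverges. This condition excludes that case.\<close>

definition past_integrable ::
  "('a::euclidean_space \<Rightarrow> real \<Rightarrow> 'a) \<Rightarrow> 'a set \<Rightarrow> real \<Rightarrow> ('a \<Rightarrow> real) \<Rightarrow> 'a \<Rightarrow> bool" where
  "past_integrable \<Phi> \<Omega> lam g x \<longleftrightarrow>
    set_integrable lborel {t. 0 < t \<and> ereal t < tau_m \<Phi> \<Omega> x} (\<lambda>t. exp (- lam * t) * g (\<Phi> x (- t)))"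

context continuous_flow
begin

lemma orbit_shift:
  assumes "x \<in> \<Omega>" "- \<tau>m x < ereal s" "ereal s < \<tau>p x"
  shows "\<Phi> x s \<in> \<Omega>" "\<tau>m (\<Phi> x s) = \<tau>m x + ereal s" "\<tau>p (\<Phi> x s) = \<tau>p x - ereal s"
proof -
  have "\<Phi> x s \<in> \<Omega> \<and> \<tau>m (\<Phi> x s) = \<tau>m x + ereal s \<and> \<tau>p (\<Phi> x s) = \<tau>p x - ereal s"
  proof (cases s "0::real" rule: linorder_cases)
    case equal
    then show ?thesis using assms tau_m_nonneg[of x] tau_p_nonneg[of x]
      by (simp add: zero_ereal_def[symmetric])
  next
    case greater
    then show ?thesis using assms before_tau_p tau_m_shift_inside tau_p_shift by auto
  next
    case less
    then have s: "0 < - s" "ereal (- s) < \<tau>m x"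
      using assms by (auto simp: ereal_uminus_less_reorder)
    have "\<tau>p (\<Phi> x (- (- s))) = \<tau>p x + ereal (- s)"
      using continuous_flow.tau_m_shift_inside[OF reversed, unfolded tau_reversed, OF assms(1) s] .
    then show ?thesis
      using before_tau_m[OF s] tau_m_shift_back[OF s] by (auto simp: minus_ereal_def)
  qed
  then show "\<Phi> x s \<in> \<Omega>" "\<tau>m (\<Phi> x s) = \<tau>m x + ereal s" "\<tau>p (\<Phi> x s) = \<tau>p x - ereal s"
    by auto
qed

text \<open>The integral over the past is split at time \<open>s\<close>; the older part is, up to the factor
  \<open>exp (- lam s)\<close>, the formula at \<open>\<Phi> z (- s)\<close>. The point \<open>z\<close> may lie on \<open>\<Gamma>\<^sub>+\<close>.\<close>

lemma Duhamel:
  fixes lam :: real and g u :: "'a \<Rightarrow> real"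
  assumes s: "0 < s" "ereal s < \<tau>m z" and int: "past_integrable \<Phi> \<Omega> lam g z"
  shows "past_integrable \<Phi> \<Omega> lam g (\<Phi> z (- s))"
    and "set_integrable lborel {0<..s} (\<lambda>t. exp (- lam * t) * g (\<Phi> z (- t)))"
    and "resolvent \<Phi> \<Omega> lam g u z = exp (- lam * s) * resolvent \<Phi> \<Omega> lam g u (\<Phi> z (- s)) +
      (LINT t:{0<..s}|lborel. exp (- lam * t) * g (\<Phi> z (- t)))"
proof -
  let ?q = "\<lambda>t. exp (- lam * t) * g (\<Phi> z (- t))"
  let ?z = "\<Phi> z (- s)"
  let ?q' = "\<lambda>t. exp (- lam * t) * g (\<Phi> ?z (- t))"
  define S where "S = (behind z)"
  define B where "B = {t. s < t \<and> ereal t < \<tau>m z}"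
  define S' where "S' = (behind ?z)"
  have meas: "S \<in> sets lborel" "B \<in> sets lborel" "S' \<in> sets lborel"
    unfolding S_def B_def S'_def by measurable
  have "t \<le> s \<Longrightarrow> ereal t < \<tau>m z" for t
    using s(2) by (meson ereal_less_eq(3) le_less_trans)
  then have split: "S = {0<..s} \<union> B" "{0<..s} \<inter> B = {}"
    using s by (auto simp: S_def B_def)
  have S_int: "set_integrable lborel S ?q"
    using int by (simp add: past_integrable_def S_def)
  show A_int: "set_integrable lborel {0<..s} ?q"
    using split by (intro set_integrable_subset[OF S_int]) auto
  have B_int: "set_integrable lborel B ?q"
    using split meas by (intro set_integrable_subset[OF S_int]) auto
  have tau': "\<tau>m ?z = \<tau>m z - ereal s" using tau_m_shift_back[OF s] .
  have ind: "indicator B (s + 1 * t) *\<^sub>R ?q (s + 1 * t) = exp (- lam * s) * (indicator S' t *\<^sub>R ?q' t)" for t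
  proof -
    have "s + t \<in> B \<longleftrightarrow> t \<in> S'"
      using s by (cases "\<tau>m z") (auto simp: B_def S'_def tau')
    then show ?thesis
      by (auto simp: exp_add[symmetric] algebra_simps split: split_indicator)
  qed
  have "integrable lborel (\<lambda>t. exp (- lam * s) * (indicator S' t *\<^sub>R ?q' t))"
    using lborel_integrable_real_affine[of "\<lambda>t. indicator B t *\<^sub>R ?q t" 1 s] B_int
    unfolding ind set_integrable_def by simp
  then have "integrable lborel (\<lambda>t. exp (lam * s) * (exp (- lam * s) * (indicator S' t *\<^sub>R ?q' t)))"
    by (rule integrable_mult_right)
  then show "past_integrable \<Phi> \<Omega> lam g ?z"
    unfolding past_integrable_def set_integrable_def S'_def[symmetric]
    by (simp add: mult.assoc[symmetric] exp_add[symmetric])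
  have B_eq: "(LINT t:B|lborel. ?q t) = exp (- lam * s) * (LINT t:S'|lborel. ?q' t)"
    using lborel_integral_real_affine[of 1 "\<lambda>t. indicator B t *\<^sub>R ?q t" s]
    unfolding ind set_lebesgue_integral_def by simp
  have "(LINT t:S|lborel. ?q t) = (LINT t:{0<..s}|lborel. ?q t) + exp (- lam * s) * (LINT t:S'|lborel. ?q' t)"
    unfolding split(1) B_eq[symmetric] by (rule set_integral_Un[OF split(2) A_int B_int])
  moreover have "(if \<tau>m z < \<infinity> then exp (- lam * real_of_ereal (\<tau>m z)) * u (entry_point \<Phi> \<Omega> z) else 0) =
      exp (- lam * s) * (if \<tau>m ?z < \<infinity> then exp (- lam * real_of_ereal (\<tau>m ?z)) * u (entry_point \<Phi> \<Omega> ?z) else 0)"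
  proof (cases "\<tau>m z")
    case (real c)
    then show ?thesis
      using s unfolding tau' by (simp add: entry_point_def tau' mult.assoc[symmetric] exp_add[symmetric] algebra_simps)
  qed (use s in \<open>auto simp: tau'\<close>)
  ultimately show "resolvent \<Phi> \<Omega> lam g u z = exp (- lam * s) * resolvent \<Phi> \<Omega> lam g u ?z +
      (LINT t:{0<..s}|lborel. ?q t)"
    unfolding resolvent_def S_def[symmetric] S'_def[symmetric] by (simp add: algebra_simps)
qed

text \<open>Integrability is required as seen from every point of the orbit, because the arguments below compare
  the values of the solution formula at different points.\<close>

definition good_orbit :: "real \<Rightarrow> ('a \<Rightarrow> real) \<Rightarrow> 'a \<Rightarrow> bool" where
  "good_orbit lam g x \<longleftrightarrow>
    (\<forall>s. on_orbit x s \<longrightarrow> past_integrable \<Phi> \<Omega> lam g (\<Phi> x s))"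

lemma resolvent_integrated_equation:
  fixes g u :: "'a \<Rightarrow> real"
  assumes lam: "0 < lam" and [measurable]: "g \<in> borel_measurable borel"
    and x: "x \<in> \<Omega>" and good: "good_orbit lam g x"
    and t: "- \<tau>m x < ereal t1" "t1 \<le> t2" "ereal t2 < \<tau>p x"
  shows "set_integrable lborel {t1..t2} (\<lambda>s. g (\<Phi> x s))"
    and "set_integrable lborel {t1..t2} (\<lambda>s. resolvent \<Phi> \<Omega> lam g u (\<Phi> x s))"
    and "(LINT s:{t1..t2}|lborel. lam * resolvent \<Phi> \<Omega> lam g u (\<Phi> x s) - g (\<Phi> x s)) =
      resolvent \<Phi> \<Omega> lam g u (\<Phi> x t1) - resolvent \<Phi> \<Omega> lam g u (\<Phi> x t2)"
proof -
  let ?w = "\<lambda>s. resolvent \<Phi> \<Omega> lam g u (\<Phi> x s)"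
  let ?k = "\<lambda>s. g (\<Phi> x s)"
  have in_I: "- \<tau>m x < ereal s" "ereal s < \<tau>p x" if "t1 \<le> s" "s \<le> t2" for s
  proof -
    show "- \<tau>m x < ereal s" using t(1) that(1) by (meson ereal_less_eq(3) less_le_trans)
    show "ereal s < \<tau>p x" using t(3) that(2) by (meson ereal_less_eq(3) le_less_trans)
  qed
  have step: "ereal (s - t1) < \<tau>m (\<Phi> x s)" if "t1 \<le> s" "s \<le> t2" for s
    using orbit_shift(2)[OF x in_I[OF that]] t(1) by (cases "\<tau>m x") auto
  have reflect: "indicator {0<..s - t1} (s + (-1) * r) *\<^sub>R (exp (- lam * (s + (-1) * r)) * g (\<Phi> (\<Phi> x s) (- (s + (-1) * r)))) =
      exp (- lam * (s - t1)) * (indicator {t1..<s} r *\<^sub>R (exp (lam * (r - t1)) * ?k r))" for s r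
    by (auto simp: exp_add[symmetric] algebra_simps split: split_indicator)
  have w_eq: "?w s = exp (- lam * (s - t1)) * (?w t1 + (LINT r:{t1..<s}|lborel. exp (lam * (r - t1)) * ?k r))"
    if "t1 \<le> s" "s \<le> t2" for s
  proof (cases "s = t1")
    case True
    then show ?thesis by (simp add: set_lebesgue_integral_def)
  next
    case False
    then have "0 < s - t1" using that by simp
    have "past_integrable \<Phi> \<Omega> lam g (\<Phi> x s)"
      using good in_I[OF that] by (auto simp: good_orbit_def)
    from Duhamel(3)[OF \<open>0 < s - t1\<close> step[OF that] this, of u]
    have "?w s = exp (- lam * (s - t1)) * ?w t1 + (LINT t:{0<..s - t1}|lborel. exp (- lam * t) * g (\<Phi> (\<Phi> x s) (- t)))"
      by simp
    also have "(LINT t:{0<..s - t1}|lborel. exp (- lam * t) * g (\<Phi> (\<Phi> x s) (- t))) =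
        exp (- lam * (s - t1)) * (LINT r:{t1..<s}|lborel. exp (lam * (r - t1)) * ?k r)"
      unfolding set_lebesgue_integral_def
      by (subst lborel_integral_real_affine[of "-1" _ s], simp, unfold reflect, simp)
    finally show ?thesis by (simp add: algebra_simps)
  qed
  show k_int: "set_integrable lborel {t1..t2} ?k"
  proof (cases "t1 = t2")
    case True
    have "AE r in lborel. 0 = indicator {t1..t2} r *\<^sub>R ?k r"
      using AE_lborel_singleton[of t1] by eventually_elim (use True in simp)
    then have "integrable lborel (\<lambda>r. indicator {t1..t2} r *\<^sub>R ?k r)"
      by (rule integrable_cong_AE_imp[OF integrable_zero, rotated]) measurable
    then show ?thesis by (simp add: set_integrable_def)
  next
    case False
    then have "0 < t2 - t1" using t by simp
    have st: "ereal (t2 - t1) < \<tau>m (\<Phi> x t2)" using step[of t2] t by blast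
    have past: "past_integrable \<Phi> \<Omega> lam g (\<Phi> x t2)"
      using good in_I[of t2] t(2) unfolding good_orbit_def by blast
    have *: "integrable lborel (\<lambda>t. indicator {0<..t2 - t1} t *\<^sub>R (exp (- lam * t) * g (\<Phi> (\<Phi> x t2) (- t))))"
      using Duhamel(2)[OF \<open>0 < t2 - t1\<close> st past] unfolding set_integrable_def .
    have i: "integrable lborel (\<lambda>r. exp (- lam * (t2 - t1)) * (indicator {t1..<t2} r *\<^sub>R (exp (lam * (r - t1)) * ?k r)))"
      using lborel_integrable_real_affine[OF *, of "-1" t2] unfolding reflect by simp
    have k1: "integrable lborel (\<lambda>r. indicator {t1..<t2} r *\<^sub>R ?k r)"
    proof (rule Bochner_Integration.integrable_bound[OF integrable_mult_right[OF i, of "exp (lam * (t2 - t1))"]])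
      show "AE r in lborel. norm (indicator {t1..<t2} r *\<^sub>R ?k r) \<le>
        norm (exp (lam * (t2 - t1)) * (exp (- lam * (t2 - t1)) * (indicator {t1..<t2} r *\<^sub>R (exp (lam * (r - t1)) * ?k r))))"
      proof (rule AE_I2)
        fix r
        have cancel: "exp (lam * (t2 - t1)) * (exp (- lam * (t2 - t1)) * z) = z" for z
          by (simp add: mult.assoc[symmetric] exp_add[symmetric])
        have "1 * \<bar>?k r\<bar> \<le> exp (lam * (r - t1)) * \<bar>?k r\<bar>" if "t1 \<le> r"
          using lam that by (intro mult_right_mono) auto
        then show "norm (indicator {t1..<t2} r *\<^sub>R ?k r) \<le>
          norm (exp (lam * (t2 - t1)) * (exp (- lam * (t2 - t1)) * (indicator {t1..<t2} r *\<^sub>R (exp (lam * (r - t1)) * ?k r))))"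
          unfolding cancel by (auto simp: abs_mult split: split_indicator)
      qed
    qed measurable
    have k2: "AE r in lborel. indicator {t1..<t2} r *\<^sub>R ?k r = indicator {t1..t2} r *\<^sub>R ?k r"
      using AE_lborel_singleton[of t2] by eventually_elim (auto split: split_indicator)
    have "integrable lborel (\<lambda>r. indicator {t1..t2} r *\<^sub>R ?k r)"
      by (rule integrable_cong_AE_imp[OF k1 _ k2]) measurable
    then show ?thesis by (simp add: set_integrable_def)
  qed
  show "set_integrable lborel {t1..t2} ?w" "(LINT s:{t1..t2}|lborel. lam * ?w s - ?k s) = ?w t1 - ?w t2"
    using variation_of_constants_integrated[OF lam t(2) k_int w_eq] by auto
qed

subsection \<open>Boundary values\<close>

text \<open>In \<open>Duhamel\<close> at \<open>y\<close> the integral over \<open>(0, s]\<close> tends to \<open>0\<close>.\<close>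

lemma resolvent_outgoing_limit:
  assumes pos: "0 < \<tau>m y" and int: "past_integrable \<Phi> \<Omega> lam g y"
  shows "((\<lambda>s. resolvent \<Phi> \<Omega> lam g u (\<Phi> y (- s))) \<longlongrightarrow> resolvent \<Phi> \<Omega> lam g u y) (at_right 0)"
proof -
  let ?R = "resolvent \<Phi> \<Omega> lam g u"
  obtain c where c: "0 < c" "ereal c < \<tau>m y"
    using pos by (metis ereal_dense2 ereal_less(2))
  define q where "q t = indicator (behind y) t *\<^sub>R (exp (- lam * t) * g (\<Phi> y (- t)))" for t
  have q: "integrable lborel q" using int by (simp add: past_integrable_def set_integrable_def q_def[abs_def])
  have lt: "ereal s < \<tau>m y" if "s < c" for s
    using c(2) that by (meson ereal_less_eq(3) le_less_trans less_imp_le)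
  have "?R (\<Phi> y (- s)) = exp (lam * s) * (?R y - (LINT t:{0<..s}|lborel. q t))" if s: "0 < s" "s < c" for s
  proof -
    have "(LINT t:{0<..s}|lborel. exp (- lam * t) * g (\<Phi> y (- t))) = (LINT t:{0<..s}|lborel. q t)"
      using lt s by (intro set_lebesgue_integral_cong) (auto simp: q_def)
    then have "?R y = exp (- lam * s) * ?R (\<Phi> y (- s)) + (LINT t:{0<..s}|lborel. q t)"
      using Duhamel(3)[OF s(1) lt[OF s(2)] int, of u] by simp
    then show ?thesis by (simp add: algebra_simps mult.assoc[symmetric] exp_add[symmetric])
  qed
  then have "eventually (\<lambda>s. exp (lam * s) * (?R y - (LINT t:{0<..s}|lborel. q t)) = ?R (\<Phi> y (- s))) (at_right 0)"
    using c(1) by (intro eventually_at_rightI[of 0 c]) auto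
  moreover have "((\<lambda>s. exp (lam * s) * (?R y - (LINT t:{0<..s}|lborel. q t))) \<longlongrightarrow>
      exp (lam * 0) * (?R y - (LINT t:{0<..0}|lborel. q t))) (at_right 0)"
    using isCont_integral_upper_limit[OF q, of 0]
    by (intro tendsto_intros) (auto simp: isCont_def intro: tendsto_within_subset)
  ultimately show ?thesis
    by (auto simp: set_lebesgue_integral_def elim: Lim_transform_eventually[rotated])
qed

text \<open>Seen from the fixed later point \<open>\<Phi> y b\<close>, the part of the integral between the entry and time \<open>s\<close>
  tends to \<open>0\<close>, so that only the boundary value remains.\<close>

lemma resolvent_incoming_limit:
  assumes y: "y \<in> Gamma_m \<Phi> \<Omega>" and b: "0 < b" "ereal b < \<tau>p y"
    and int: "past_integrable \<Phi> \<Omega> lam g (\<Phi> y b)"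
  shows "((\<lambda>s. resolvent \<Phi> \<Omega> lam g u (\<Phi> y s)) \<longlongrightarrow> u y) (at_right 0)"
proof -
  let ?R = "resolvent \<Phi> \<Omega> lam g u"
  let ?z = "\<Phi> y b"
  have y': "y \<notin> \<Omega>" using y by (simp add: Gamma_m_eq)
  have tau: "\<tau>m ?z = ereal b" using tau_m_shift_boundary[OF y' b] .
  define q where "q t = indicator {0<..<b} t *\<^sub>R (exp (- lam * t) * g (\<Phi> ?z (- t)))" for t
  have S: "(behind ?z) = {0<..<b}" by (auto simp: tau)
  have q: "integrable lborel q"
    using int unfolding past_integrable_def S set_integrable_def q_def[abs_def] .
  have Rz: "?R ?z = (LINT t:{0<..b}|lborel. q t) + exp (- lam * b) * u y"
  proof -
    have "(LINT t:{0<..<b}|lborel. exp (- lam * t) * g (\<Phi> ?z (- t))) = (LINT t:{0<..b}|lborel. q t)"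
      unfolding set_lebesgue_integral_def q_def
      by (intro Bochner_Integration.integral_cong) (auto split: split_indicator)
    then show ?thesis
      unfolding resolvent_def S using entry_point_shift[OF y b] by (simp add: tau)
  qed
  have "?R (\<Phi> y s) = exp (lam * (b - s)) * (?R ?z - (LINT t:{0<..b - s}|lborel. q t))" if s: "0 < s" "s < b" for s
  proof -
    have "(LINT t:{0<..b - s}|lborel. exp (- lam * t) * g (\<Phi> ?z (- t))) = (LINT t:{0<..b - s}|lborel. q t)"
      using s by (intro set_lebesgue_integral_cong) (auto simp: q_def)
    then have "?R ?z = exp (- lam * (b - s)) * ?R (\<Phi> y s) + (LINT t:{0<..b - s}|lborel. q t)"
      using Duhamel(3)[of "b - s" ?z lam g u] s int by (simp add: tau)
    then show ?thesis by (simp add: mult.assoc[symmetric] exp_add[symmetric])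
  qed
  then have "eventually (\<lambda>s. exp (lam * (b - s)) * (?R ?z - (LINT t:{0<..b - s}|lborel. q t)) = ?R (\<Phi> y s)) (at_right 0)"
    using b(1) by (intro eventually_at_rightI[of 0 b]) auto
  moreover have "((\<lambda>s. exp (lam * (b - s)) * (?R ?z - (LINT t:{0<..b - s}|lborel. q t))) \<longlongrightarrow>
      exp (lam * (b - 0)) * (?R ?z - (LINT t:{0<..b - 0}|lborel. q t))) (at_right 0)"
  proof (intro tendsto_intros)
    have "isCont (\<lambda>c. LINT t:{0<..c}|lborel. q t) (b - 0)"
      by (rule isCont_integral_upper_limit[OF q])
    then show "((\<lambda>s. LINT t:{0<..b - s}|lborel. q t) \<longlongrightarrow> (LINT t:{0<..b - 0}|lborel. q t)) (at_right 0)"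
      by (rule isCont_tendsto_compose) (intro tendsto_intros)
  qed
  ultimately have "((\<lambda>s. ?R (\<Phi> y s)) \<longlongrightarrow> exp (lam * b) * (?R ?z - (LINT t:{0<..b}|lborel. q t))) (at_right 0)"
    by (auto elim: Lim_transform_eventually[rotated])
  also have "exp (lam * b) * (?R ?z - (LINT t:{0<..b}|lborel. q t)) = u y"
    by (simp add: Rz mult.assoc[symmetric] exp_add[symmetric])
  finally show ?thesis .
qed

end

context flow_with_boundary
begin

lemma AE_past:
  assumes "AE x in \<nu>. x \<in> \<Omega> \<longrightarrow> P x"
  shows "AE x in \<nu>. x \<in> \<Omega> \<longrightarrow> (AE t in lborel. 0 < t \<and> ereal t < \<tau>m x \<longrightarrow> P (\<Phi> x (- t)))"
proof -
  have "AE x in \<nu>. AE t in lborel. \<Phi> x (- t) \<in> \<Omega> \<longrightarrow> P (\<Phi> x (- t))"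
    using invariant_flow.AE_along_orbits[OF invariant_flow_reversed assms] .
  then show ?thesis
  proof eventually_elim
    case (elim x)
    show ?case
    proof
      show "AE t in lborel. 0 < t \<and> ereal t < \<tau>m x \<longrightarrow> P (\<Phi> x (- t))"
        using elim by eventually_elim (use before_tau_m in blast)
    qed
  qed
qed

lemma AE_entry_point_outgoing:
  assumes "AE y in \<mu>m. Q y"
  shows "AE y in \<mu>p. \<tau>m y < \<infinity> \<longrightarrow> Q (entry_point \<Phi> \<Omega> y)"
proof -
  obtain N where N: "{y \<in> space \<mu>m. \<not> Q y} \<subseteq> N" "emeasure \<mu>m N = 0" "N \<in> sets \<mu>m"
    using AE_E[OF assms] by blast
  have [measurable]: "N \<in> sets borel" using N(3) by (rule sets_\<mu>m_imp_borel)
  have meas: "(\<lambda>y. indicator N (entry_point \<Phi> \<Omega> y) * indicator {y. \<tau>m y < \<infinity>} y :: ennreal) \<in> borel_measurable \<mu>p"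
    by (rule measurable_\<mu>p) measurable
  have "(\<integral>\<^sup>+y\<in>{y. \<tau>m y < \<infinity>}. indicator N (entry_point \<Phi> \<Omega> y) \<partial>\<mu>p) = (\<integral>\<^sup>+y\<in>{y. \<tau>p y < \<infinity>}. indicator N y \<partial>\<mu>m)"
    by (rule boundary_transfer[symmetric]) measurable
  also have "\<dots> \<le> (\<integral>\<^sup>+y. indicator N y \<partial>\<mu>m)"
    by (intro nn_integral_mono) (auto split: split_indicator)
  also have "\<dots> = 0" using N by simp
  finally have "AE y in \<mu>p. indicator N (entry_point \<Phi> \<Omega> y) * indicator {y. \<tau>m y < \<infinity>} y = (0::ennreal)"
    using nn_integral_0_iff_AE[OF meas] by simp
  with AE_space show ?thesis
  proof eventually_elim
    case (elim y)
    show ?case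
    proof
      assume y: "\<tau>m y < \<infinity>"
      then have "entry_point \<Phi> \<Omega> y \<notin> N" using elim by (auto split: split_indicator_asm)
      moreover have "entry_point \<Phi> \<Omega> y \<in> space \<mu>m"
        using elim y tau_p_entry_of_exit(2)[of y] by (auto simp: space_\<mu>m space_\<mu>p Gamma_p_eq)
      ultimately show "Q (entry_point \<Phi> \<Omega> y)" using N(1) by auto
    qed
  qed
qed

end

section \<open>The resolvent of integrable data\<close>

context continuous_flow
begin

lemma resolvent_measurable [measurable]:
  assumes [measurable]: "g \<in> borel_measurable borel" "u \<in> borel_measurable borel"
  shows "resolvent \<Phi> \<Omega> lam g u \<in> borel_measurable borel"
  unfolding resolvent_def[abs_def] set_lebesgue_integral_def by measurable

lemma past_integrable_iff:
  assumes [measurable]: "g \<in> borel_measurable borel"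
  shows "past_integrable \<Phi> \<Omega> lam g x \<longleftrightarrow>
    (\<integral>\<^sup>+t\<in>behind x. ennreal (exp (- lam * t)) * ennreal \<bar>g (\<Phi> x (- t))\<bar> \<partial>lborel) < \<infinity>"
proof -
  have "(\<integral>\<^sup>+t. ennreal (norm (indicator (behind x) t *\<^sub>R (exp (- lam * t) * g (\<Phi> x (- t))))) \<partial>lborel) =
     (\<integral>\<^sup>+t\<in>behind x. ennreal (exp (- lam * t)) * ennreal \<bar>g (\<Phi> x (- t))\<bar> \<partial>lborel)"
    by (intro nn_integral_cong) (auto simp: ennreal_mult'[symmetric] abs_mult split: split_indicator)
  moreover have "(\<lambda>t. indicator (behind x) t *\<^sub>R (exp (- lam * t) * g (\<Phi> x (- t)))) \<in> borel_measurable lborel"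
    by measurable
  ultimately show ?thesis
    unfolding past_integrable_def set_integrable_def integrable_iff_bounded by simp
qed

lemma past_integrable_of_resolvent_nn:
  assumes "g \<in> borel_measurable borel"
    and "resolvent_nn \<Phi> \<Omega> lam (\<lambda>x. ennreal \<bar>g x\<bar>) u x < \<infinity>"
  shows "past_integrable \<Phi> \<Omega> lam g x"
  using assms(2) unfolding past_integrable_iff[OF assms(1)] resolvent_nn_def by (simp add: ennreal_add_eq_top less_top)

lemma abs_resolvent_le:
  assumes g [measurable]: "g \<in> borel_measurable borel"
  shows "ennreal \<bar>resolvent \<Phi> \<Omega> lam g u x\<bar> \<le> resolvent_nn \<Phi> \<Omega> lam (\<lambda>x. ennreal \<bar>g x\<bar>) (\<lambda>x. ennreal \<bar>u x\<bar>) x"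
proof -
  let ?S = "(behind x)"
  let ?I = "LINT t:?S|lborel. exp (- lam * t) * g (\<Phi> x (- t))"
  let ?B = "if \<tau>m x < \<infinity> then exp (- lam * real_of_ereal (\<tau>m x)) * u (entry_point \<Phi> \<Omega> x) else 0"
  have "ennreal \<bar>?I\<bar> \<le> (\<integral>\<^sup>+t\<in>?S. ennreal (exp (- lam * t)) * ennreal \<bar>g (\<Phi> x (- t))\<bar> \<partial>lborel)"
  proof (cases "past_integrable \<Phi> \<Omega> lam g x")
    case True
    then have "ennreal (norm ?I) \<le> (\<integral>\<^sup>+t. ennreal (norm (indicator ?S t *\<^sub>R (exp (- lam * t) * g (\<Phi> x (- t))))) \<partial>lborel)"
      unfolding past_integrable_def set_integrable_def set_lebesgue_integral_def by (rule integral_norm_bound_ennreal)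
    also have "\<dots> = (\<integral>\<^sup>+t\<in>?S. ennreal (exp (- lam * t)) * ennreal \<bar>g (\<Phi> x (- t))\<bar> \<partial>lborel)"
      by (intro nn_integral_cong) (auto simp: ennreal_mult'[symmetric] abs_mult split: split_indicator)
    finally show ?thesis by simp
  next
    case False
    then have "?I = 0"
      unfolding past_integrable_def set_integrable_def set_lebesgue_integral_def by (rule not_integrable_integral_eq)
    then show ?thesis by simp
  qed
  moreover have "ennreal \<bar>?B\<bar> \<le> (if \<tau>m x < \<infinity> then ennreal (exp (- lam * real_of_ereal (\<tau>m x))) * ennreal \<bar>u (entry_point \<Phi> \<Omega> x)\<bar> else 0)"
    by (simp add: abs_mult ennreal_mult'[symmetric])
  moreover have "ennreal \<bar>?I + ?B\<bar> \<le> ennreal \<bar>?I\<bar> + ennreal \<bar>?B\<bar>"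
    by (simp add: ennreal_plus[symmetric] del: ennreal_plus)
  ultimately show ?thesis
    unfolding resolvent_def resolvent_nn_def by (meson add_mono order_trans)
qed

lemma resolvent_eq_resolvent_nn:
  assumes g [measurable]: "g \<in> borel_measurable borel" and nonneg: "\<And>x. 0 \<le> g x" "\<And>x. 0 \<le> u x"
    and int: "past_integrable \<Phi> \<Omega> lam g x"
  shows "ennreal (resolvent \<Phi> \<Omega> lam g u x) = resolvent_nn \<Phi> \<Omega> lam (\<lambda>x. ennreal (g x)) (\<lambda>x. ennreal (u x)) x"
    and "0 \<le> resolvent \<Phi> \<Omega> lam g u x"
proof -
  let ?S = "(behind x)"
  let ?I = "LINT t:?S|lborel. exp (- lam * t) * g (\<Phi> x (- t))"
  have I: "0 \<le> ?I"
    unfolding set_lebesgue_integral_def using nonneg by (intro integral_nonneg_AE) auto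
  then show "0 \<le> resolvent \<Phi> \<Omega> lam g u x"
    unfolding resolvent_def using nonneg by auto
  have "(\<integral>\<^sup>+t. ennreal (indicator ?S t *\<^sub>R (exp (- lam * t) * g (\<Phi> x (- t)))) \<partial>lborel) = ennreal ?I"
    using int nonneg unfolding past_integrable_def set_integrable_def set_lebesgue_integral_def
    by (intro nn_integral_eq_integral) auto
  moreover have "(\<integral>\<^sup>+t. ennreal (indicator ?S t *\<^sub>R (exp (- lam * t) * g (\<Phi> x (- t)))) \<partial>lborel) =
      (\<integral>\<^sup>+t\<in>?S. ennreal (exp (- lam * t)) * ennreal (g (\<Phi> x (- t))) \<partial>lborel)"
    by (intro nn_integral_cong) (auto simp: ennreal_mult'[symmetric] split: split_indicator)
  moreover define B where "B = (if \<tau>m x < \<infinity> then exp (- lam * real_of_ereal (\<tau>m x)) * u (entry_point \<Phi> \<Omega> x) else 0)"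
  moreover have "ennreal B = (if \<tau>m x < \<infinity> then ennreal (exp (- lam * real_of_ereal (\<tau>m x))) * ennreal (u (entry_point \<Phi> \<Omega> x)) else 0)"
    by (simp add: B_def ennreal_mult'[symmetric])
  moreover have "ennreal (?I + B) = ennreal ?I + ennreal B"
    using I nonneg by (intro ennreal_plus) (auto simp: B_def)
  ultimately show "ennreal (resolvent \<Phi> \<Omega> lam g u x) = resolvent_nn \<Phi> \<Omega> lam (\<lambda>x. ennreal (g x)) (\<lambda>x. ennreal (u x)) x"
    unfolding resolvent_def resolvent_nn_def by simp
qed

lemma resolvent_cong:
  assumes [measurable]: "g \<in> borel_measurable borel" "g' \<in> borel_measurable borel"
    and "AE t in lborel. 0 < t \<and> ereal t < \<tau>m x \<longrightarrow> g (\<Phi> x (- t)) = g' (\<Phi> x (- t))"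
    and "\<tau>m x < \<infinity> \<longrightarrow> u (entry_point \<Phi> \<Omega> x) = u' (entry_point \<Phi> \<Omega> x)"
  shows "resolvent \<Phi> \<Omega> lam g u x = resolvent \<Phi> \<Omega> lam g' u' x"
proof -
  have "(LINT t:behind x|lborel. exp (- lam * t) * g (\<Phi> x (- t))) =
      (LINT t:behind x|lborel. exp (- lam * t) * g' (\<Phi> x (- t)))"
    using assms(3) by (intro set_lebesgue_integral_cong_AE) (auto elim: AE_mp intro!: AE_I2)
  then show ?thesis unfolding resolvent_def using assms(4) by auto
qed

lemma resolvent_diff:
  assumes "past_integrable \<Phi> \<Omega> lam g x" "past_integrable \<Phi> \<Omega> lam g' x"
  shows "resolvent \<Phi> \<Omega> lam (\<lambda>x. g x - g' x) (\<lambda>x. u x - u' x) x =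
    resolvent \<Phi> \<Omega> lam g u x - resolvent \<Phi> \<Omega> lam g' u' x"
  using set_integral_diff(2)[OF assms[unfolded past_integrable_def]]
  unfolding resolvent_def by (simp add: right_diff_distrib)

lemma past_integrable_earlier:
  assumes x: "x \<in> \<Omega>" and s: "- \<tau>m x < ereal s" "s < s'" "ereal s' < \<tau>p x"
    and int: "past_integrable \<Phi> \<Omega> lam g (\<Phi> x s')"
  shows "past_integrable \<Phi> \<Omega> lam g (\<Phi> x s)"
proof -
  have "- \<tau>m x < ereal s'" using s by (meson less_ereal.simps(1) less_trans)
  then have "\<tau>m (\<Phi> x s') = \<tau>m x + ereal s'" using orbit_shift x s by blast
  then have "ereal (s' - s) < \<tau>m (\<Phi> x s')" using s by (cases "\<tau>m x") auto
  from Duhamel(1)[OF _ this int] s show ?thesis by simp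
qed

end

locale transport_data = flow_with_boundary \<Phi> \<Omega> \<nu> \<mu>m \<mu>p
  for \<Phi> :: "'a::euclidean_space \<Rightarrow> real \<Rightarrow> 'a" and \<Omega> :: "'a set" and \<nu> \<mu>m \<mu>p :: "'a measure" +
  fixes lam :: real and g u :: "'a \<Rightarrow> real"
  assumes lam_pos: "0 < lam"
    and g_measurable [measurable]: "g \<in> borel_measurable borel"
    and u_measurable [measurable]: "u \<in> borel_measurable borel"
    and g_integrable: "set_integrable \<nu> \<Omega> g"
    and u_integrable: "integrable \<mu>m u"
begin

abbreviation "R \<equiv> resolvent \<Phi> \<Omega> lam g u"
abbreviation "RN \<equiv> resolvent_nn \<Phi> \<Omega> lam (\<lambda>x. ennreal \<bar>g x\<bar>) (\<lambda>x. ennreal \<bar>u x\<bar>)"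

lemma nn_norm_g: "(\<integral>\<^sup>+x\<in>\<Omega>. ennreal \<bar>g x\<bar> \<partial>\<nu>) = ennreal (LINT x:\<Omega>|\<nu>. \<bar>g x\<bar>)"
proof -
  have "(\<integral>\<^sup>+x\<in>\<Omega>. ennreal \<bar>g x\<bar> \<partial>\<nu>) = (\<integral>\<^sup>+x. ennreal (indicator \<Omega> x *\<^sub>R \<bar>g x\<bar>) \<partial>\<nu>)"
    by (intro nn_integral_cong) (auto split: split_indicator)
  also have "\<dots> = ennreal (LINT x:\<Omega>|\<nu>. \<bar>g x\<bar>)"
    unfolding set_lebesgue_integral_def using set_integrable_abs[OF g_integrable]
    by (intro nn_integral_eq_integral) (auto simp: set_integrable_def)
  finally show ?thesis .
qed

lemma nn_norm_u: "(\<integral>\<^sup>+y. ennreal \<bar>u y\<bar> \<partial>\<mu>m) = ennreal (LINT y|\<mu>m. \<bar>u y\<bar>)"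
  using u_integrable by (intro nn_integral_eq_integral) auto

lemma balance: "ennreal lam * (\<integral>\<^sup>+x\<in>\<Omega>. RN x \<partial>\<nu>) + (\<integral>\<^sup>+y. RN y \<partial>\<mu>p) =
    ennreal ((LINT y|\<mu>m. \<bar>u y\<bar>) + (LINT x:\<Omega>|\<nu>. \<bar>g x\<bar>))"
proof -
  have "0 \<le> (LINT x:\<Omega>|\<nu>. \<bar>g x\<bar>)"
    unfolding set_lebesgue_integral_def by (intro integral_nonneg_AE) auto
  moreover have "0 \<le> (LINT y|\<mu>m. \<bar>u y\<bar>)" by (intro integral_nonneg_AE) auto
  ultimately show ?thesis
    by (subst resolvent_balance[OF lam_pos]) (auto simp: nn_norm_g nn_norm_u ennreal_plus[symmetric] add.commute simp del: ennreal_plus)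
qed

lemma RN_finite: "(\<integral>\<^sup>+x\<in>\<Omega>. RN x \<partial>\<nu>) < \<infinity>" "(\<integral>\<^sup>+y. RN y \<partial>\<mu>p) < \<infinity>"
proof -
  have "ennreal lam * (\<integral>\<^sup>+x\<in>\<Omega>. RN x \<partial>\<nu>) + (\<integral>\<^sup>+y. RN y \<partial>\<mu>p) < \<infinity>"
    unfolding balance by simp
  then show "(\<integral>\<^sup>+x\<in>\<Omega>. RN x \<partial>\<nu>) < \<infinity>" "(\<integral>\<^sup>+y. RN y \<partial>\<mu>p) < \<infinity>"
    using lam_pos by (auto simp: ennreal_mult_less_top)
qed

lemma AE_RN_finite: "AE x in \<nu>. x \<in> \<Omega> \<longrightarrow> RN x < \<infinity>"
proof -
  have "AE x in \<nu>. RN x * indicator \<Omega> x \<noteq> \<infinity>"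
    using RN_finite(1) by (intro nn_integral_PInf_AE) auto
  then show ?thesis by eventually_elim (auto simp: less_top)
qed

lemma AE_RN_finite_outgoing: "AE y in \<mu>p. RN y < \<infinity>"
proof -
  have "AE y in \<mu>p. RN y \<noteq> \<infinity>"
    using RN_finite(2) by (intro nn_integral_PInf_AE measurable_\<mu>p) auto
  then show ?thesis by eventually_elim (auto simp: less_top)
qed

lemma AE_past_integrable: "AE x in \<nu>. x \<in> \<Omega> \<longrightarrow> past_integrable \<Phi> \<Omega> lam g x"
  using AE_RN_finite by eventually_elim (blast intro: past_integrable_of_resolvent_nn g_measurable)

lemma AE_past_integrable_outgoing: "AE y in \<mu>p. past_integrable \<Phi> \<Omega> lam g y"
  using AE_RN_finite_outgoing by eventually_elim (blast intro: past_integrable_of_resolvent_nn g_measurable)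

text \<open>Along almost every orbit the past is integrable at almost every time, hence at times arbitrarily close to the
  exit, and integrability passes to earlier points of the orbit.\<close>

lemma AE_good_orbit: "AE x in \<nu>. x \<in> \<Omega> \<longrightarrow> good_orbit lam g x"
  using AE_along_orbits[OF AE_past_integrable]
proof eventually_elim
  case (elim x)
  show ?case
    unfolding good_orbit_def
  proof (intro impI allI)
    fix s assume x: "x \<in> \<Omega>" and s: "on_orbit x s"
    then obtain c where c: "ereal s < ereal c" "ereal c < \<tau>p x" by (metis ereal_dense2)
    have "s < c" using c(1) by simp
    then obtain s' where s': "s < s'" "s' < c" "\<Phi> x s' \<in> \<Omega> \<longrightarrow> past_integrable \<Phi> \<Omega> lam g (\<Phi> x s')"
      using AE_lborel_ex_between[OF elim] by blast
    have "ereal s' < \<tau>p x" using s'(2) c(2) by (meson less_ereal.simps(1) less_trans)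
    moreover have "- \<tau>m x < ereal s'" using s s'(1) by (meson less_ereal.simps(1) less_trans)
    ultimately show "past_integrable \<Phi> \<Omega> lam g (\<Phi> x s)"
      using past_integrable_earlier[OF x _ s'(1)] s s'(3) orbit_shift(1)[OF x] by blast
  qed
qed

lemma nn_norm_R_le: "(\<integral>\<^sup>+x. ennreal (norm (indicator \<Omega> x *\<^sub>R R x)) \<partial>\<nu>) \<le> (\<integral>\<^sup>+x\<in>\<Omega>. RN x \<partial>\<nu>)"
  using abs_resolvent_le[OF g_measurable] by (intro nn_integral_mono) (auto split: split_indicator)

lemma R_integrable: "set_integrable \<nu> \<Omega> R"
  unfolding set_integrable_def
proof (rule integrableI_bounded)
  show "(\<integral>\<^sup>+x. ennreal (norm (indicator \<Omega> x *\<^sub>R R x)) \<partial>\<nu>) < \<infinity>"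
    using nn_norm_R_le RN_finite(1) by (rule le_less_trans)
qed measurable

lemma nn_norm_R_outgoing_le: "(\<integral>\<^sup>+y. ennreal (norm (R y)) \<partial>\<mu>p) \<le> (\<integral>\<^sup>+y. RN y \<partial>\<mu>p)"
  using abs_resolvent_le[OF g_measurable] by (intro nn_integral_mono) auto

lemma R_integrable_outgoing: "integrable \<mu>p R"
proof (rule integrableI_bounded)
  show "(\<integral>\<^sup>+y. ennreal (norm (R y)) \<partial>\<mu>p) < \<infinity>"
    using nn_norm_R_outgoing_le RN_finite(2) by (rule le_less_trans)
qed (rule measurable_\<mu>p, measurable)

lemma nn_norms_R:
  "ennreal lam * (\<integral>\<^sup>+x. ennreal (norm (indicator \<Omega> x *\<^sub>R R x)) \<partial>\<nu>) + (\<integral>\<^sup>+y. ennreal (norm (R y)) \<partial>\<mu>p) =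
    ennreal ((LINT y|\<mu>p. \<bar>R y\<bar>) + lam * (LINT x:\<Omega>|\<nu>. \<bar>R x\<bar>))"
proof -
  have "(\<integral>\<^sup>+x. ennreal (norm (indicator \<Omega> x *\<^sub>R R x)) \<partial>\<nu>) = ennreal (LINT x:\<Omega>|\<nu>. \<bar>R x\<bar>)"
  proof -
    have "(\<integral>\<^sup>+x. ennreal (norm (indicator \<Omega> x *\<^sub>R R x)) \<partial>\<nu>) = ennreal (LINT x|\<nu>. norm (indicator \<Omega> x *\<^sub>R R x))"
      using R_integrable by (intro nn_integral_eq_integral) (auto simp: set_integrable_def)
    also have "(LINT x|\<nu>. norm (indicator \<Omega> x *\<^sub>R R x)) = (LINT x:\<Omega>|\<nu>. \<bar>R x\<bar>)"
      unfolding set_lebesgue_integral_def by (intro Bochner_Integration.integral_cong) (auto split: split_indicator)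
    finally show ?thesis .
  qed
  moreover have "(\<integral>\<^sup>+y. ennreal (norm (R y)) \<partial>\<mu>p) = ennreal (LINT y|\<mu>p. \<bar>R y\<bar>)"
    using R_integrable_outgoing by (subst nn_integral_eq_integral) auto
  moreover have "0 \<le> (LINT x:\<Omega>|\<nu>. \<bar>R x\<bar>)"
    unfolding set_lebesgue_integral_def by (intro integral_nonneg_AE) auto
  moreover have "0 \<le> (LINT y|\<mu>p. \<bar>R y\<bar>)" by (intro integral_nonneg_AE) auto
  ultimately show ?thesis
    using lam_pos by (simp add: ennreal_mult'[symmetric] ennreal_plus[symmetric] add.commute del: ennreal_plus)
qed

lemma norm_estimate:
  "(LINT y|\<mu>p. \<bar>R y\<bar>) + lam * (LINT x:\<Omega>|\<nu>. \<bar>R x\<bar>) \<le> (LINT y|\<mu>m. \<bar>u y\<bar>) + (LINT x:\<Omega>|\<nu>. \<bar>g x\<bar>)"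
proof -
  have "ennreal ((LINT y|\<mu>p. \<bar>R y\<bar>) + lam * (LINT x:\<Omega>|\<nu>. \<bar>R x\<bar>)) \<le> ennreal ((LINT y|\<mu>m. \<bar>u y\<bar>) + (LINT x:\<Omega>|\<nu>. \<bar>g x\<bar>))"
    unfolding nn_norms_R[symmetric] balance[symmetric]
    using nn_norm_R_le nn_norm_R_outgoing_le by (intro add_mono mult_left_mono) auto
  moreover have "0 \<le> (LINT x:\<Omega>|\<nu>. \<bar>g x\<bar>)"
    unfolding set_lebesgue_integral_def by (intro integral_nonneg_AE) auto
  moreover have "0 \<le> (LINT y|\<mu>m. \<bar>u y\<bar>)" by (intro integral_nonneg_AE) auto
  ultimately show ?thesis by (simp add: ennreal_le_iff del: ennreal_plus)
qed

text \<open>For nonnegative data nothing cancels in the formula for the solution.\<close>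

lemma norm_equality:
  assumes g_nonneg: "AE x in \<nu>. x \<in> \<Omega> \<longrightarrow> 0 \<le> g x" and u_nonneg: "AE y in \<mu>m. 0 \<le> u y"
  shows "(LINT y|\<mu>p. \<bar>R y\<bar>) + lam * (LINT x:\<Omega>|\<nu>. \<bar>R x\<bar>) = (LINT y|\<mu>m. \<bar>u y\<bar>) + (LINT x:\<Omega>|\<nu>. \<bar>g x\<bar>)"
proof -
  have g_abs: "AE x in \<nu>. x \<in> \<Omega> \<longrightarrow> g x = \<bar>g x\<bar>"
    using g_nonneg by eventually_elim auto
  have u_abs: "AE y in \<mu>m. u y = \<bar>u y\<bar>"
    using u_nonneg by eventually_elim auto
  have eq: "ennreal (norm (R x)) = RN x"
    if "AE t in lborel. 0 < t \<and> ereal t < \<tau>m x \<longrightarrow> g (\<Phi> x (- t)) = \<bar>g (\<Phi> x (- t))\<bar>"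
      "\<tau>m x < \<infinity> \<longrightarrow> u (entry_point \<Phi> \<Omega> x) = \<bar>u (entry_point \<Phi> \<Omega> x)\<bar>" "RN x < \<infinity>" for x
  proof -
    have "past_integrable \<Phi> \<Omega> lam (\<lambda>x. \<bar>g x\<bar>) x"
      using that(3) by (intro past_integrable_of_resolvent_nn) auto
    moreover have "R x = resolvent \<Phi> \<Omega> lam (\<lambda>x. \<bar>g x\<bar>) (\<lambda>x. \<bar>u x\<bar>) x"
      using that by (intro resolvent_cong) auto
    ultimately show ?thesis
      using resolvent_eq_resolvent_nn[of "\<lambda>x. \<bar>g x\<bar>" "\<lambda>x. \<bar>u x\<bar>" lam x] by simp
  qed
  have "AE x in \<nu>. ennreal (norm (indicator \<Omega> x *\<^sub>R R x)) = RN x * indicator \<Omega> x"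
    using AE_past[OF g_abs] AE_entry_point[OF u_abs] AE_RN_finite
  proof eventually_elim
    case (elim x)
    then show ?case using eq[of x] by (auto split: split_indicator)
  qed
  then have 1: "(\<integral>\<^sup>+x. ennreal (norm (indicator \<Omega> x *\<^sub>R R x)) \<partial>\<nu>) = (\<integral>\<^sup>+x\<in>\<Omega>. RN x \<partial>\<nu>)"
    by (rule nn_integral_cong_AE)
  have "AE y in \<mu>p. ennreal (norm (R y)) = RN y"
    using AE_outgoing_orbits[OF g_abs] AE_entry_point_outgoing[OF u_abs] AE_RN_finite_outgoing
  proof eventually_elim
    case (elim y)
    then show ?case using eq[of y] by auto
  qed
  then have 2: "(\<integral>\<^sup>+y. ennreal (norm (R y)) \<partial>\<mu>p) = (\<integral>\<^sup>+y. RN y \<partial>\<mu>p)"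
    by (rule nn_integral_cong_AE)
  have "ennreal ((LINT y|\<mu>p. \<bar>R y\<bar>) + lam * (LINT x:\<Omega>|\<nu>. \<bar>R x\<bar>)) = ennreal ((LINT y|\<mu>m. \<bar>u y\<bar>) + (LINT x:\<Omega>|\<nu>. \<bar>g x\<bar>))"
    unfolding nn_norms_R[symmetric] balance[symmetric] 1 2 ..
  moreover have "0 \<le> (LINT x:\<Omega>|\<nu>. \<bar>g x\<bar>)" "0 \<le> (LINT x:\<Omega>|\<nu>. \<bar>R x\<bar>)"
    unfolding set_lebesgue_integral_def by (intro integral_nonneg_AE; simp)+
  moreover have "0 \<le> (LINT y|\<mu>m. \<bar>u y\<bar>)" "0 \<le> (LINT y|\<mu>p. \<bar>R y\<bar>)" by (intro integral_nonneg_AE; simp)+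
  ultimately show ?thesis using lam_pos by (simp del: ennreal_plus)
qed

end

section \<open>Test functions along the orbits\<close>

lemma integrable_mult_bounded:
  fixes f p :: "'b \<Rightarrow> real"
  assumes "integrable M f" "p \<in> borel_measurable M" "AE x in M. \<bar>p x\<bar> \<le> C"
  shows "integrable M (\<lambda>x. f x * p x)"
proof (rule Bochner_Integration.integrable_bound)
  show "integrable M (\<lambda>x. C * f x)" using assms(1) by simp
  show "AE x in M. norm (f x * p x) \<le> norm (C * f x)"
    using assms(3)
  proof eventually_elim
    case (elim x)
    then have "\<bar>f x\<bar> * \<bar>p x\<bar> \<le> \<bar>f x\<bar> * \<bar>C\<bar>" by (intro mult_left_mono) auto
    then show ?case by (simp add: abs_mult mult.commute)
  qed
qed (use assms in auto)

lemma set_integrable_mult_bounded: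
  fixes f p :: "'b \<Rightarrow> real"
  assumes "set_integrable M A f" "p \<in> borel_measurable M" "AE x in M. x \<in> A \<longrightarrow> \<bar>p x\<bar> \<le> C" "A \<in> sets M"
  shows "set_integrable M A (\<lambda>x. f x * p x)"
proof -
  have "AE x in M. \<bar>indicator A x * p x\<bar> \<le> \<bar>C\<bar>"
    using assms(3) by eventually_elim (auto split: split_indicator)
  then have "integrable M (\<lambda>x. (indicator A x *\<^sub>R f x) * (indicator A x * p x))"
    using assms by (intro integrable_mult_bounded[where C = "\<bar>C\<bar>"]) (auto simp: set_integrable_def)
  then show ?thesis
    unfolding set_integrable_def
    by (rule Bochner_Integration.integrable_cong[THEN iffD1, rotated -1]) (auto split: split_indicator)
qed

context invariant_flow
begin

text \<open>The starting point \<open>x\<close> may lie outside \<open>\<Omega>\<close>, in particular on \<open>\<Gamma>\<^sub>-\<close>: near time \<open>t\<close> its orbit is the orbit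
  of the point \<open>\<Phi> x t\<close> of \<open>\<Omega>\<close>, to which the definition of a test function applies.\<close>

lemma test_function_deriv:
  assumes \<psi>: "\<psi> \<in> test_functions \<mu> \<Phi> \<Omega>" and t: "\<Phi> x t \<in> \<Omega>"
  shows "((\<lambda>s. \<psi> (\<Phi> x s)) has_real_derivative flow_deriv \<Phi> \<psi> (\<Phi> x t)) (at t)"
    and "isCont (\<lambda>s. flow_deriv \<Phi> \<psi> (\<Phi> x s)) t"
proof -
  let ?z = "\<Phi> x t"
  let ?I = "{s. - \<tau>m ?z < ereal s \<and> ereal s < \<tau>p ?z}"
  have I_eq: "?I = {s. ereal (- s) < \<tau>m ?z} \<inter> {s. ereal s < \<tau>p ?z}"
    by (auto simp: ereal_uminus_less_reorder)
  have "open {s. ereal s < c}" for c :: ereal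
    by (cases c) (auto simp: lessThan_def[symmetric])
  moreover have "open {s. ereal (- s) < c}" for c :: ereal
  proof (cases c)
    case (real r)
    then have "{s. ereal (- s) < c} = {- r<..}" by auto
    then show ?thesis by simp
  qed auto
  ultimately have I_open: "open ?I" unfolding I_eq by blast
  have I0: "0 \<in> ?I" using tau_m_pos[OF t] tau_p_pos[OF t] by (cases "\<tau>m ?z") (auto simp: zero_ereal_def)
  have "(\<lambda>s. \<psi> (\<Phi> ?z s)) C1_differentiable_on ?I"
    using \<psi> t unfolding test_functions_def by blast
  then obtain D where D: "\<And>r. r \<in> ?I \<Longrightarrow> ((\<lambda>s. \<psi> (\<Phi> ?z s)) has_vector_derivative D r) (at r)"
    "continuous_on ?I D"
    unfolding C1_differentiable_on_def by blast
  have D': "((\<lambda>s. \<psi> (\<Phi> ?z s)) has_real_derivative D r) (at r)" if "r \<in> ?I" for r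
    using D(1)[OF that] by (simp add: has_real_derivative_iff_has_vector_derivative)
  have fd: "flow_deriv \<Phi> \<psi> (\<Phi> ?z r) = D r" if "r \<in> ?I" for r
  proof -
    have "((\<lambda>s. \<psi> (\<Phi> ?z (s + r))) has_real_derivative D r) (at 0)"
      using DERIV_shift[of "\<lambda>s. \<psi> (\<Phi> ?z s)" "D r" 0 r] D'[OF that] by simp
    then show ?thesis
      unfolding flow_deriv_def by (intro DERIV_imp_deriv) (simp add: ac_simps)
  qed
  have "((\<lambda>s. \<psi> (\<Phi> ?z (s + (- t)))) has_real_derivative D 0) (at t)"
    using DERIV_shift[of "\<lambda>s. \<psi> (\<Phi> ?z s)" "D 0" t "- t"] D'[OF I0] by simp
  then show "((\<lambda>s. \<psi> (\<Phi> x s)) has_real_derivative flow_deriv \<Phi> \<psi> (\<Phi> x t)) (at t)"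
    using fd[OF I0] by simp
  have cD: "isCont D 0"
    using D(2) I_open I0 by (simp add: continuous_on_eq_continuous_at)
  have ev: "eventually (\<lambda>r. flow_deriv \<Phi> \<psi> (\<Phi> ?z r) = D r) (nhds 0)"
    using eventually_nhds_in_open[OF I_open I0] by eventually_elim (rule fd)
  have "isCont (\<lambda>r. flow_deriv \<Phi> \<psi> (\<Phi> ?z r)) 0"
    by (rule iffD2[OF isCont_cong[OF ev] cD])
  then have "isCont (\<lambda>r. flow_deriv \<Phi> \<psi> (\<Phi> ?z r)) (t - t)" by simp
  from isCont_o2[of t "\<lambda>s. s - t" "\<lambda>r. flow_deriv \<Phi> \<psi> (\<Phi> ?z r)", OF _ this]
  show "isCont (\<lambda>s. flow_deriv \<Phi> \<psi> (\<Phi> x s)) t" by simp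
qed

lemma AE_of_completion:
  "\<mu> = \<nu> \<or> \<mu> = completion \<nu> \<Longrightarrow> (AE x in \<mu>. P x) \<longleftrightarrow> (AE x in \<nu>. P x)"
  by (auto simp: AE_completion_iff)

lemma test_function_support:
  assumes \<mu>: "\<mu> = \<nu> \<or> \<mu> = completion \<nu>" and \<psi>: "\<psi> \<in> test_functions \<mu> \<Phi> \<Omega>"
  shows "compact (ess_support \<mu> \<Omega> \<psi>)" "ess_support \<mu> \<Omega> \<psi> \<subseteq> \<Omega>"
    "AE x in \<nu>. x \<in> \<Omega> - ess_support \<mu> \<Omega> \<psi> \<longrightarrow> \<psi> x = 0"
proof -
  show "compact (ess_support \<mu> \<Omega> \<psi>)" using \<psi> by (simp add: test_functions_def)
  show "ess_support \<mu> \<Omega> \<psi> \<subseteq> \<Omega>" by (auto simp: ess_support_def)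
  let ?\<W> = "{W. open W \<and> W \<subseteq> \<Omega> \<and> (AE x\<in>W in \<mu>. \<psi> x = 0)}"
  obtain \<F> where \<F>: "\<F> \<subseteq> ?\<W>" "countable \<F>" "\<Union>\<F> = \<Union>?\<W>"
    by (rule Lindelof[of ?\<W>]) auto
  have "AE x in \<nu>. \<forall>W\<in>\<F>. x \<in> W \<longrightarrow> \<psi> x = 0"
    using \<F>(1) AE_of_completion[OF \<mu>] by (subst AE_ball_countable[OF \<F>(2)]) auto
  then show "AE x in \<nu>. x \<in> \<Omega> - ess_support \<mu> \<Omega> \<psi> \<longrightarrow> \<psi> x = 0"
  proof eventually_elim
    case (elim x)
    have "\<Omega> - ess_support \<mu> \<Omega> \<psi> \<subseteq> \<Union>\<F>" unfolding \<F>(3) ess_support_def by auto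
    then show ?case using elim by blast
  qed
qed

text \<open>Almost everywhere statements about \<open>\<psi>\<close> hold along almost every orbit at almost every time, and
  by continuity along the orbit at every time.\<close>

definition vanishes_off_support :: "'a measure \<Rightarrow> ('a \<Rightarrow> real) \<Rightarrow> 'a \<Rightarrow> bool" where
  "vanishes_off_support \<mu> \<psi> x \<longleftrightarrow> (\<forall>t. \<Phi> x t \<in> \<Omega> - ess_support \<mu> \<Omega> \<psi> \<longrightarrow> \<psi> (\<Phi> x t) = 0)"

lemma AE_vanishes_off_support:
  assumes \<mu>: "\<mu> = \<nu> \<or> \<mu> = completion \<nu>" and \<psi>: "\<psi> \<in> test_functions \<mu> \<Phi> \<Omega>"
  shows "AE x in \<nu>. vanishes_off_support \<mu> \<psi> x"
  using AE_along_orbits[OF test_function_support(3)[OF assms]]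
proof eventually_elim
  case (elim x)
  let ?W = "\<Omega> - ess_support \<mu> \<Omega> \<psi>"
  have W: "open ?W" using test_function_support(1)[OF assms] domain_open compact_imp_closed by blast
  show ?case
    unfolding vanishes_off_support_def
  proof (intro allI impI, rule ccontr)
    fix t assume t: "\<Phi> x t \<in> ?W" "\<psi> (\<Phi> x t) \<noteq> 0"
    have "isCont (\<lambda>s. \<psi> (\<Phi> x s)) t"
      using DERIV_isCont[OF test_function_deriv(1)[OF \<psi>]] t by blast
    then have "eventually (\<lambda>s. \<psi> (\<Phi> x s) \<noteq> 0) (nhds t)"
      using t(2) by (simp add: isCont_def tendsto_imp_eventually_ne eventually_nhds_conv_at)
    moreover have "eventually (\<lambda>s. s \<in> {s. \<Phi> x s \<in> ?W}) (nhds t)"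
      using open_times_in[OF W] t by (intro eventually_nhds_in_open) auto
    ultimately have "eventually (\<lambda>s. \<Phi> x s \<in> ?W \<and> \<psi> (\<Phi> x s) \<noteq> 0) (nhds t)"
      by eventually_elim auto
    then obtain e where e: "0 < e" "\<And>s. dist s t < e \<Longrightarrow> \<Phi> x s \<in> ?W \<and> \<psi> (\<Phi> x s) \<noteq> 0"
      unfolding eventually_nhds_metric by blast
    have "t < t + e" using e(1) by simp
    then obtain s where "t < s" "s < t + e" "\<Phi> x s \<in> ?W \<longrightarrow> \<psi> (\<Phi> x s) = 0"
      using AE_lborel_ex_between[OF elim] by blast
    then show False using e(2)[of s] by (auto simp: dist_real_def)
  qed
qed

lemma vanishes_off_support_flow:
  "vanishes_off_support \<mu> \<psi> (\<Phi> x s) \<Longrightarrow> vanishes_off_support \<mu> \<psi> x"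
  unfolding vanishes_off_support_def flow_flow by (metis add_diff_cancel_left' add.commute diff_add_cancel)

end

context flow_with_boundary
begin

text \<open>Comparison with the constant test function, for which \<open>survival_plus_absorption\<close> gives at most one.\<close>

lemma adjoint_resolvent_nn_le:
  assumes lam: "0 < lam" and x: "0 < \<tau>p x" and C: "0 \<le> C" "\<And>x. \<phi> x \<le> ennreal C"
  shows "adjoint_resolvent_nn \<Phi> \<Omega> lam \<phi> x \<le> ennreal (C / lam)"
proof -
  have "adjoint_resolvent_nn \<Phi> \<Omega> lam \<phi> x \<le>
      (\<integral>\<^sup>+t. ennreal (C / lam) * (ennreal (exp (- lam * t)) * ennreal lam * indicator (ahead x) t) \<partial>lborel)"
    unfolding adjoint_resolvent_nn_def
  proof (rule nn_integral_mono)
    fix t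
    have "ennreal (exp (- lam * t)) * \<phi> (\<Phi> x t) \<le> ennreal (exp (- lam * t)) * ennreal C"
      using C by (intro mult_left_mono) auto
    also have "\<dots> = ennreal (C / lam) * (ennreal (exp (- lam * t)) * ennreal lam)"
      using lam C by (simp add: ennreal_mult'[symmetric])
    finally show "ennreal (exp (- lam * t)) * \<phi> (\<Phi> x t) * indicator (ahead x) t \<le>
        ennreal (C / lam) * (ennreal (exp (- lam * t)) * ennreal lam * indicator (ahead x) t)"
      by (auto split: split_indicator)
  qed
  also have "\<dots> = ennreal (C / lam) * adjoint_resolvent_nn \<Phi> \<Omega> lam (\<lambda>_. ennreal lam) x"
    unfolding adjoint_resolvent_nn_def by (rule nn_integral_cmult) measurable
  also have "\<dots> \<le> ennreal (C / lam) * 1"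
    using survival_plus_absorption[OF lam x] by (intro mult_left_mono) (auto simp: le_iff_add)
  finally show ?thesis by simp
qed

lemma bounded_future_integrable:
  assumes lam: "0 < lam" and x: "0 < \<tau>p x"
    and meas: "set_borel_measurable lborel (ahead x) \<phi>"
    and bound: "\<And>t. 0 < t \<Longrightarrow> ereal t < \<tau>p x \<Longrightarrow> \<bar>\<phi> t\<bar> \<le> C"
  shows "set_integrable lborel (ahead x) (\<lambda>t. exp (- lam * t) * \<phi> t)"
  unfolding set_integrable_def
proof (rule integrableI_bounded)
  let ?S = "ahead x"
  have [measurable]: "(\<lambda>t. indicator ?S t *\<^sub>R \<phi> t) \<in> borel_measurable lborel"
    using meas by (simp add: set_borel_measurable_def)
  have "(\<lambda>t. exp (- lam * t) *\<^sub>R (indicator ?S t *\<^sub>R \<phi> t)) \<in> borel_measurable lborel"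
    by measurable
  then show "(\<lambda>t. indicator ?S t *\<^sub>R (exp (- lam * t) * \<phi> t)) \<in> borel_measurable lborel"
    by (simp add: ac_simps)
  have "(\<integral>\<^sup>+t. ennreal (norm (indicator ?S t *\<^sub>R (exp (- lam * t) * \<phi> t))) \<partial>lborel) \<le>
      adjoint_resolvent_nn \<Phi> \<Omega> lam (\<lambda>_. ennreal \<bar>C\<bar>) x"
    unfolding adjoint_resolvent_nn_def
  proof (rule nn_integral_mono)
    fix t
    have "exp (- lam * t) * \<bar>\<phi> t\<bar> \<le> exp (- lam * t) * \<bar>C\<bar>" if "t \<in> ?S"
      using bound[of t] that by (intro mult_left_mono) auto
    then show "ennreal (norm (indicator ?S t *\<^sub>R (exp (- lam * t) * \<phi> t))) \<le>
        ennreal (exp (- lam * t)) * ennreal \<bar>C\<bar> * indicator ?S t"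
      by (auto simp: ennreal_mult'[symmetric] abs_mult split: split_indicator)
  qed
  also have "\<dots> \<le> ennreal (\<bar>C\<bar> / lam)"
    using lam x by (intro adjoint_resolvent_nn_le) auto
  finally show "(\<integral>\<^sup>+t. ennreal (norm (indicator ?S t *\<^sub>R (exp (- lam * t) * \<phi> t))) \<partial>lborel) < \<infinity>"
    by (rule le_less_trans) simp
qed

text \<open>The adjoint resolvent inverts \<open>\<psi> \<mapsto> lam \<psi> - d\<psi>/ds\<close>: the integrand is the derivative of
  \<open>- exp (- lam t) \<psi>(\<Phi> x t)\<close>, which vanishes at the end of the orbit because the support of \<open>\<psi>\<close> stays
  away from the boundary, or because of the exponential.\<close>

lemma test_function_orbit_integral:
  assumes lam: "0 < lam" and \<mu>: "\<mu> = \<nu> \<or> \<mu> = completion \<nu>" and \<psi>: "\<psi> \<in> test_functions \<mu> \<Phi> \<Omega>"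
    and van: "vanishes_off_support \<mu> \<psi> x" and x: "0 < \<tau>p x"
    and L: "((\<lambda>t. \<psi> (\<Phi> x t)) \<longlongrightarrow> L) (at_right 0)"
  shows "(LINT t:ahead x|lborel.
      exp (- lam * t) * (lam * \<psi> (\<Phi> x t) - flow_deriv \<Phi> \<psi> (\<Phi> x t))) = L"
proof -
  let ?S = "ahead x"
  let ?\<phi> = "\<lambda>t. lam * \<psi> (\<Phi> x t) - flow_deriv \<Phi> \<psi> (\<Phi> x t)"
  let ?f = "\<lambda>t. - (exp (- lam * t) * ?\<phi> t)"
  have S: "einterval 0 (\<tau>p x) = ?S" by (auto simp: einterval_def)
  have S_open: "open ?S" unfolding S[symmetric] by simp
  have in_\<Omega>: "\<Phi> x t \<in> \<Omega>" if "t \<in> ?S" for t using that before_tau_p by auto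
  have deriv: "((\<lambda>t. exp (- lam * t) * \<psi> (\<Phi> x t)) has_real_derivative ?f t) (at t)" if "t \<in> ?S" for t
    by (rule derivative_eq_intros test_function_deriv(1)[OF \<psi> in_\<Omega>[OF that]] refl)+ (simp add: algebra_simps)
  have cont: "isCont ?\<phi> t" if "t \<in> ?S" for t
    using test_function_deriv(2)[OF \<psi> in_\<Omega>[OF that]] DERIV_isCont[OF test_function_deriv(1)[OF \<psi> in_\<Omega>[OF that]]]
    by (intro continuous_intros)
  have "bounded (\<psi> ` \<Omega>)" "bounded (flow_deriv \<Phi> \<psi> ` \<Omega>)"
    using \<psi> by (auto simp: test_functions_def)
  then obtain M M' where M: "\<And>z. z \<in> \<Omega> \<Longrightarrow> \<bar>\<psi> z\<bar> \<le> M" "\<And>z. z \<in> \<Omega> \<Longrightarrow> \<bar>flow_deriv \<Phi> \<psi> z\<bar> \<le> M'"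
    unfolding bounded_iff by auto
  have int: "set_integrable lborel ?S (\<lambda>t. exp (- lam * t) * ?\<phi> t)"
  proof (rule bounded_future_integrable[OF lam x])
    have "continuous_on ?S ?\<phi>"
      using cont continuous_on_eq_continuous_at[OF S_open] by blast
    then have "(\<lambda>t. indicator ?S t *\<^sub>R ?\<phi> t) \<in> borel_measurable borel"
      using S_open by (intro borel_measurable_continuous_on_indicator) auto
    then show "set_borel_measurable lborel ?S ?\<phi>"
      unfolding set_borel_measurable_def by simp
    fix t assume "0 < t" "ereal t < \<tau>p x"
    then have z: "\<Phi> x t \<in> \<Omega>" using before_tau_p by blast
    have "\<bar>?\<phi> t\<bar> \<le> lam * \<bar>\<psi> (\<Phi> x t)\<bar> + \<bar>flow_deriv \<Phi> \<psi> (\<Phi> x t)\<bar>"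
      using lam by (metis abs_mult abs_of_pos abs_triangle_ineq4)
    also have "\<dots> \<le> lam * M + M'"
      using M[OF z] lam by (intro add_mono mult_left_mono) auto
    finally show "\<bar>?\<phi> t\<bar> \<le> lam * M + M'" .
  qed
  have A: "(((\<lambda>t. exp (- lam * t) * \<psi> (\<Phi> x t)) \<circ> real_of_ereal) \<longlongrightarrow> L) (at_right 0)"
  proof -
    have "((\<lambda>t. exp (- lam * t) * \<psi> (\<Phi> x t)) \<longlongrightarrow> exp (- lam * 0) * L) (at_right 0)"
      by (intro tendsto_intros L)
    then show ?thesis unfolding zero_ereal_def ereal_tendsto_simps1 by simp
  qed
  have B: "(((\<lambda>t. exp (- lam * t) * \<psi> (\<Phi> x t)) \<circ> real_of_ereal) \<longlongrightarrow> 0) (at_left (\<tau>p x))"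
  proof (cases "\<tau>p x")
    case (real c)
    then have c: "0 < c" using x by simp
    have "\<Phi> x c \<notin> ess_support \<mu> \<Omega> \<psi>"
      using exit_point_not_in[OF x] real test_function_support(2)[OF \<mu> \<psi>] by auto
    then have "eventually (\<lambda>t. t \<in> {t. \<Phi> x t \<in> - ess_support \<mu> \<Omega> \<psi>}) (nhds c)"
      using test_function_support(1)[OF \<mu> \<psi>]
      by (intro eventually_nhds_in_open open_times_in) (auto simp: compact_imp_closed)
    then have "eventually (\<lambda>t. \<Phi> x t \<notin> ess_support \<mu> \<Omega> \<psi>) (at_left c)"
      by (auto simp: eventually_at_filter elim: eventually_mono)
    moreover have "eventually (\<lambda>t. t \<in> {0<..<c}) (at_left c)"
      using c by (auto intro: eventually_at_leftI)
    ultimately have "eventually (\<lambda>t. 0 = exp (- lam * t) * \<psi> (\<Phi> x t)) (at_left c)"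
    proof eventually_elim
      case (elim t)
      then have "\<Phi> x t \<in> \<Omega>" using before_tau_p[of t x] real by auto
      then show ?case using van elim unfolding vanishes_off_support_def by simp
    qed
    then have "((\<lambda>t. exp (- lam * t) * \<psi> (\<Phi> x t)) \<longlongrightarrow> 0) (at_left c)"
      by (rule Lim_transform_eventually[OF tendsto_const])
    then show ?thesis unfolding real ereal_tendsto_simps1 .
  next
    case PInf
    have "((\<lambda>t. exp (- (lam * t)) * M) \<longlongrightarrow> 0 * M) at_top"
      using lam
      by (intro tendsto_mult tendsto_const filterlim_compose[OF exp_at_bot] filterlim_uminus_at_bot[THEN iffD2])
         (auto intro!: filterlim_tendsto_pos_mult_at_top[OF tendsto_const] filterlim_ident)
    then have lim: "((\<lambda>t. exp (- lam * t) * M) \<longlongrightarrow> 0) at_top" by simp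
    have "eventually (\<lambda>t. norm (exp (- lam * t) * \<psi> (\<Phi> x t)) \<le> exp (- lam * t) * M) at_top"
      using eventually_gt_at_top[of "0::real"]
    proof eventually_elim
      case (elim t)
      then have "\<Phi> x t \<in> \<Omega>" using before_tau_p[of t x] PInf by auto
      then show ?case using M(1) by (simp add: abs_mult)
    qed
    then have "((\<lambda>t. exp (- lam * t) * \<psi> (\<Phi> x t)) \<longlongrightarrow> 0) at_top"
      by (rule Lim_null_comparison[OF _ lim])
    then show ?thesis unfolding PInf ereal_tendsto_simps1 .
  qed (use x in auto)
  have "(LBINT t=0..\<tau>p x. ?f t) = 0 - L"
  proof (rule interval_integral_FTC_integrable[OF x _ _ _ A B])
    fix t assume "0 < ereal t" "ereal t < \<tau>p x"
    then have t: "t \<in> ?S" by simp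
    show "((\<lambda>t. exp (- lam * t) * \<psi> (\<Phi> x t)) has_vector_derivative ?f t) (at t)"
      using deriv[OF t] by (simp add: has_real_derivative_iff_has_vector_derivative)
    have "isCont (\<lambda>t. exp (- lam * t)) t" by (intro continuous_intros)
    from isCont_minus[OF isCont_mult[OF this cont[OF t]]] show "isCont ?f t" .
  next
    show "set_integrable lborel (einterval 0 (\<tau>p x)) ?f"
      unfolding S using int unfolding set_integrable_def scaleR_minus_right by (rule integrable_minus)
  qed
  moreover have "(LBINT t=0..\<tau>p x. ?f t) = (LINT t:?S|lborel. ?f t)"
    using less_imp_le[OF x] unfolding interval_lebesgue_integral_def S by simp
  ultimately show ?thesis
    using set_integral_uminus[OF int] by simp
qed

end

section \<open>The weak form of the resolvent equation\<close>

context transport_data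
begin

definition adjoint :: "('a \<Rightarrow> real) \<Rightarrow> 'a \<Rightarrow> real" where
  "adjoint \<phi> x = (LINT t:ahead x|lborel. exp (- lam * t) * \<phi> (\<Phi> x t))"

lemma adjoint_measurable [measurable]:
  assumes [measurable]: "\<phi> \<in> borel_measurable borel"
  shows "adjoint \<phi> \<in> borel_measurable borel"
  unfolding adjoint_def[abs_def] set_lebesgue_integral_def by measurable

lemma adjoint_integrable:
  assumes [measurable]: "\<phi> \<in> borel_measurable borel" and "\<And>x. \<bar>\<phi> x\<bar> \<le> C" and "0 < \<tau>p x"
  shows "set_integrable lborel (ahead x) (\<lambda>t. exp (- lam * t) * \<phi> (\<Phi> x t))"
  using assms
  by (intro bounded_future_integrable[OF lam_pos, of _ _ C]) (auto simp: set_borel_measurable_def)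

lemma adjoint_eq_nn:
  assumes [measurable]: "\<phi> \<in> borel_measurable borel" and "\<And>x. 0 \<le> \<phi> x" and "\<And>x. \<phi> x \<le> C" and "0 < \<tau>p x"
  shows "ennreal (adjoint \<phi> x) = adjoint_resolvent_nn \<Phi> \<Omega> lam (\<lambda>x. ennreal (\<phi> x)) x"
    and "0 \<le> adjoint \<phi> x" and "adjoint \<phi> x \<le> C / lam"
proof -
  let ?S = "ahead x"
  have C: "0 \<le> C" using assms(2,3) order_trans by blast
  have int: "integrable lborel (\<lambda>t. indicator ?S t *\<^sub>R (exp (- lam * t) * \<phi> (\<Phi> x t)))"
    using adjoint_integrable[of \<phi> C x] assms by (auto simp: set_integrable_def abs_le_iff intro: order_trans)
  show nonneg: "0 \<le> adjoint \<phi> x"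
    unfolding adjoint_def set_lebesgue_integral_def using assms by (intro integral_nonneg_AE) auto
  have "ennreal (adjoint \<phi> x) = (\<integral>\<^sup>+t. ennreal (indicator ?S t *\<^sub>R (exp (- lam * t) * \<phi> (\<Phi> x t))) \<partial>lborel)"
    unfolding adjoint_def set_lebesgue_integral_def using assms int
    by (intro nn_integral_eq_integral[symmetric]) auto
  also have "\<dots> = adjoint_resolvent_nn \<Phi> \<Omega> lam (\<lambda>x. ennreal (\<phi> x)) x"
    unfolding adjoint_resolvent_nn_def
    by (intro nn_integral_cong) (auto simp: ennreal_mult'[symmetric] split: split_indicator)
  finally show eq: "ennreal (adjoint \<phi> x) = adjoint_resolvent_nn \<Phi> \<Omega> lam (\<lambda>x. ennreal (\<phi> x)) x" .
  have "ennreal (adjoint \<phi> x) \<le> ennreal (C / lam)"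
    unfolding eq using assms C by (intro adjoint_resolvent_nn_le lam_pos) (auto simp: ennreal_leI)
  then show "adjoint \<phi> x \<le> C / lam" using C lam_pos by (simp add: ennreal_le_iff)
qed

text \<open>The dual pairing in terms of real integrals, extended below to signed test functions and then to signed
  data by taking positive and negative parts.\<close>

lemma duality_nonneg:
  assumes [measurable]: "\<phi> \<in> borel_measurable borel"
    and g: "\<And>x. 0 \<le> g x" and u: "\<And>x. 0 \<le> u x" and \<phi>: "\<And>x. 0 \<le> \<phi> x" "\<And>x. \<phi> x \<le> C"
  shows "(LINT x:\<Omega>|\<nu>. R x * \<phi> x) = (LINT x:\<Omega>|\<nu>. g x * adjoint \<phi> x) + (LINT y|\<mu>m. u y * adjoint \<phi> y)"
proof -
  let ?A = "adjoint_resolvent_nn \<Phi> \<Omega> lam (\<lambda>x. ennreal (\<phi> x))"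
  have C: "0 \<le> C" using \<phi> order_trans by blast
  have RN: "AE x in \<nu>. x \<in> \<Omega> \<longrightarrow> 0 \<le> R x \<and> ennreal (R x) = RN x"
    using AE_past_integrable
    by eventually_elim (use resolvent_eq_resolvent_nn[OF g_measurable g u] g u in auto)
  have R_nonneg: "AE x in \<nu>. 0 \<le> indicator \<Omega> x *\<^sub>R (R x * \<phi> x)"
    using RN by eventually_elim (auto simp: \<phi> split: split_indicator)
  have pos_g: "0 \<le> indicator \<Omega> x *\<^sub>R (g x * adjoint \<phi> x)" for x
    using adjoint_eq_nn(2)[of \<phi> C x] g \<phi> tau_p_pos[of x] by (auto split: split_indicator)
  have pos_u: "AE y in \<mu>m. 0 \<le> u y * adjoint \<phi> y"
    using AE_space by eventually_elim (use adjoint_eq_nn(2)[of \<phi> C] u \<phi> in \<open>auto simp: space_\<mu>m Gamma_m_eq\<close>)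
  have g_int: "set_integrable \<nu> \<Omega> (\<lambda>x. g x * adjoint \<phi> x)"
    using adjoint_eq_nn(2,3)[of \<phi> C] \<phi> tau_p_pos
    by (intro set_integrable_mult_bounded[OF g_integrable, of _ "C / lam"]) (auto simp: abs_le_iff sets_\<nu> intro!: AE_I2 order_trans[of "- _" 0])
  have u_int: "integrable \<mu>m (\<lambda>y. u y * adjoint \<phi> y)"
  proof (rule integrable_mult_bounded[OF u_integrable, of _ "C / lam"])
    show "AE y in \<mu>m. \<bar>adjoint \<phi> y\<bar> \<le> C / lam"
      using AE_space by eventually_elim
        (use adjoint_eq_nn(2,3)[of \<phi> C] \<phi> in \<open>auto simp: space_\<mu>m Gamma_m_eq\<close>)
  qed (rule measurable_\<mu>m, measurable)
  have "(LINT x:\<Omega>|\<nu>. R x * \<phi> x) = enn2real (\<integral>\<^sup>+x. ennreal (indicator \<Omega> x *\<^sub>R (R x * \<phi> x)) \<partial>\<nu>)"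
    unfolding set_lebesgue_integral_def by (intro integral_eq_nn_integral R_nonneg) measurable
  also have "(\<integral>\<^sup>+x. ennreal (indicator \<Omega> x *\<^sub>R (R x * \<phi> x)) \<partial>\<nu>) = (\<integral>\<^sup>+x\<in>\<Omega>. RN x * ennreal (\<phi> x) \<partial>\<nu>)"
  proof (rule nn_integral_cong_AE)
    show "AE x in \<nu>. ennreal (indicator \<Omega> x *\<^sub>R (R x * \<phi> x)) = RN x * ennreal (\<phi> x) * indicator \<Omega> x"
      using RN by eventually_elim (auto simp: ennreal_mult[symmetric] \<phi> ennreal_mult' split: split_indicator)
  qed
  also have "\<dots> = (\<integral>\<^sup>+x\<in>\<Omega>. ennreal \<bar>g x\<bar> * ?A x \<partial>\<nu>) + (\<integral>\<^sup>+y. ennreal \<bar>u y\<bar> * ?A y \<partial>\<mu>m)"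
    by (rule resolvent_duality) measurable
  also have "(\<integral>\<^sup>+x\<in>\<Omega>. ennreal \<bar>g x\<bar> * ?A x \<partial>\<nu>) = (\<integral>\<^sup>+x. ennreal (indicator \<Omega> x *\<^sub>R (g x * adjoint \<phi> x)) \<partial>\<nu>)"
    using adjoint_eq_nn(1)[of \<phi> C, symmetric] \<phi> tau_p_pos g
    by (intro nn_integral_cong) (auto simp: ennreal_mult' split: split_indicator)
  also have "\<dots> = ennreal (LINT x:\<Omega>|\<nu>. g x * adjoint \<phi> x)"
    unfolding set_lebesgue_integral_def
    using g_int pos_g by (intro nn_integral_eq_integral) (auto simp: set_integrable_def)
  also have "(\<integral>\<^sup>+y. ennreal \<bar>u y\<bar> * ?A y \<partial>\<mu>m) = (\<integral>\<^sup>+y. ennreal (u y * adjoint \<phi> y) \<partial>\<mu>m)"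
    using adjoint_eq_nn(1)[of \<phi> C, symmetric] \<phi> u
    by (intro nn_integral_cong) (auto simp: ennreal_mult' space_\<mu>m Gamma_m_eq)
  also have "\<dots> = ennreal (LINT y|\<mu>m. u y * adjoint \<phi> y)"
    using u_int pos_u by (intro nn_integral_eq_integral) auto
  finally have eq: "(LINT x:\<Omega>|\<nu>. R x * \<phi> x) =
      enn2real (ennreal (LINT x:\<Omega>|\<nu>. g x * adjoint \<phi> x) + ennreal (LINT y|\<mu>m. u y * adjoint \<phi> y))" .
  have "0 \<le> (LINT x:\<Omega>|\<nu>. g x * adjoint \<phi> x)"
    unfolding set_lebesgue_integral_def using pos_g by (intro integral_nonneg_AE) auto
  moreover have "0 \<le> (LINT y|\<mu>m. u y * adjoint \<phi> y)"
    using pos_u by (rule integral_nonneg_AE)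
  ultimately show ?thesis
    unfolding eq by (simp add: ennreal_plus[symmetric] del: ennreal_plus)
qed

lemma adjoint_bound:
  assumes [measurable]: "\<phi> \<in> borel_measurable borel" and "\<And>x. \<bar>\<phi> x\<bar> \<le> C" and "0 < \<tau>p x"
  shows "\<bar>adjoint \<phi> x\<bar> \<le> C / lam"
proof -
  let ?S = "ahead x"
  have "\<bar>adjoint \<phi> x\<bar> \<le> (LINT t|lborel. \<bar>indicator ?S t *\<^sub>R (exp (- lam * t) * \<phi> (\<Phi> x t))\<bar>)"
    unfolding adjoint_def set_lebesgue_integral_def by (rule integral_abs_bound)
  also have "\<dots> = adjoint (\<lambda>x. \<bar>\<phi> x\<bar>) x"
    unfolding adjoint_def set_lebesgue_integral_def
    by (intro Bochner_Integration.integral_cong) (auto simp: abs_mult split: split_indicator)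
  also have "\<dots> \<le> C / lam"
    using assms by (intro adjoint_eq_nn(3)) auto
  finally show ?thesis .
qed

lemma duality_bounded:
  assumes \<phi>_meas [measurable]: "\<phi> \<in> borel_measurable borel"
    and g: "\<And>x. 0 \<le> g x" and u: "\<And>x. 0 \<le> u x" and \<phi>: "\<And>x. \<bar>\<phi> x\<bar> \<le> C"
  shows "(LINT x:\<Omega>|\<nu>. R x * \<phi> x) = (LINT x:\<Omega>|\<nu>. g x * adjoint \<phi> x) + (LINT y|\<mu>m. u y * adjoint \<phi> y)"
proof -
  define a where "a x = max (\<phi> x) 0" for x
  define b where "b x = max (- \<phi> x) 0" for x
  have [measurable]: "a \<in> borel_measurable borel" "b \<in> borel_measurable borel"
    unfolding a_def[abs_def] b_def[abs_def] by measurable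
  have C: "0 \<le> C" using \<phi> abs_ge_zero order_trans by blast
  have a: "0 \<le> a x" "a x \<le> C" "\<bar>a x\<bar> \<le> C" and b: "0 \<le> b x" "b x \<le> C" "\<bar>b x\<bar> \<le> C" for x
    using \<phi>[of x] C by (auto simp: a_def b_def)
  have ab: "\<phi> x = a x - b x" for x by (simp add: a_def b_def)
  have adj: "adjoint \<phi> x = adjoint a x - adjoint b x" if "0 < \<tau>p x" for x
  proof -
    have "set_integrable lborel (ahead x) (\<lambda>t. exp (- lam * t) * a (\<Phi> x t))"
      "set_integrable lborel (ahead x) (\<lambda>t. exp (- lam * t) * b (\<Phi> x t))"
      by (rule adjoint_integrable[OF _ a(3) that] adjoint_integrable[OF _ b(3) that], measurable)+
    from set_integral_diff(2)[OF this] show ?thesis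
      unfolding adjoint_def ab right_diff_distrib by simp
  qed
  have bd: "\<bar>adjoint a x\<bar> \<le> C / lam" "\<bar>adjoint b x\<bar> \<le> C / lam" if "0 < \<tau>p x" for x
    using adjoint_eq_nn(2,3)[of a C x] adjoint_eq_nn(2,3)[of b C x] a b that by auto
  have bd_m: "AE y in \<mu>m. \<bar>adjoint a y\<bar> \<le> C / lam" "AE y in \<mu>m. \<bar>adjoint b y\<bar> \<le> C / lam"
    using bd by (auto intro!: AE_I2 simp: space_\<mu>m Gamma_m_eq)
  have u_int: "integrable \<mu>m (\<lambda>y. u y * adjoint a y)" "integrable \<mu>m (\<lambda>y. u y * adjoint b y)"
    by (rule integrable_mult_bounded[OF u_integrable _ bd_m(1)] integrable_mult_bounded[OF u_integrable _ bd_m(2)],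
        rule measurable_\<mu>m, measurable)+
  have g_int: "set_integrable \<nu> \<Omega> (\<lambda>x. g x * adjoint a x)" "set_integrable \<nu> \<Omega> (\<lambda>x. g x * adjoint b x)"
    using bd tau_p_pos by (auto intro!: set_integrable_mult_bounded[OF g_integrable, of _ "C / lam"] simp: sets_\<nu>)
  have R_int: "set_integrable \<nu> \<Omega> (\<lambda>x. R x * a x)" "set_integrable \<nu> \<Omega> (\<lambda>x. R x * b x)"
    using a b by (auto intro!: set_integrable_mult_bounded[OF R_integrable, of _ C] simp: sets_\<nu>)
  have "(LINT x:\<Omega>|\<nu>. R x * \<phi> x) = (LINT x:\<Omega>|\<nu>. R x * a x) - (LINT x:\<Omega>|\<nu>. R x * b x)"
    unfolding ab right_diff_distrib by (rule set_integral_diff(2)[OF R_int])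
  also have "\<dots> = ((LINT x:\<Omega>|\<nu>. g x * adjoint a x) - (LINT x:\<Omega>|\<nu>. g x * adjoint b x)) +
      ((LINT y|\<mu>m. u y * adjoint a y) - (LINT y|\<mu>m. u y * adjoint b y))"
    using duality_nonneg[of a C] duality_nonneg[of b C] a b g u by simp
  also have "(LINT x:\<Omega>|\<nu>. g x * adjoint a x) - (LINT x:\<Omega>|\<nu>. g x * adjoint b x) = (LINT x:\<Omega>|\<nu>. g x * adjoint \<phi> x)"
    unfolding set_integral_diff(2)[OF g_int, symmetric]
    using adj tau_p_pos by (intro set_lebesgue_integral_cong) (auto simp: sets_\<nu> right_diff_distrib)
  also have "(LINT y|\<mu>m. u y * adjoint a y) - (LINT y|\<mu>m. u y * adjoint b y) = (LINT y|\<mu>m. u y * adjoint \<phi> y)"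
    unfolding Bochner_Integration.integral_diff[OF u_int, symmetric]
    using adj by (intro Bochner_Integration.integral_cong) (auto simp: space_\<mu>m Gamma_m_eq right_diff_distrib)
  finally show ?thesis .
qed

lemma duality:
  assumes \<phi>_meas [measurable]: "\<phi> \<in> borel_measurable borel" and \<phi>: "\<And>x. \<bar>\<phi> x\<bar> \<le> C"
  shows "(LINT x:\<Omega>|\<nu>. R x * \<phi> x) = (LINT x:\<Omega>|\<nu>. g x * adjoint \<phi> x) + (LINT y|\<mu>m. u y * adjoint \<phi> y)"
proof -
  have max_int: "set_integrable \<nu> \<Omega> (\<lambda>x. max (h x) 0)" if "set_integrable \<nu> \<Omega> h" for h :: "'a \<Rightarrow> real"
  proof -
    have "integrable \<nu> (\<lambda>x. max (indicator \<Omega> x *\<^sub>R h x) 0)"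
      using that by (intro integrable_max) (auto simp: set_integrable_def)
    then show ?thesis
      unfolding set_integrable_def
      by (rule Bochner_Integration.integrable_cong[THEN iffD1, rotated -1]) (auto split: split_indicator)
  qed
  have neg_int: "set_integrable \<nu> \<Omega> (\<lambda>x. - g x)"
    using g_integrable by (simp add: set_integrable_def)
  interpret P: transport_data \<Phi> \<Omega> \<nu> \<mu>m \<mu>p lam "\<lambda>x. max (g x) 0" "\<lambda>x. max (u x) 0"
    by unfold_locales (use lam_pos u_integrable max_int[OF g_integrable] in \<open>auto intro!: integrable_max\<close>)
  interpret N: transport_data \<Phi> \<Omega> \<nu> \<mu>m \<mu>p lam "\<lambda>x. max (- g x) 0" "\<lambda>x. max (- u x) 0"
    by unfold_locales (use lam_pos u_integrable max_int[OF neg_int] in \<open>auto intro!: integrable_max\<close>)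
  have g_split: "max (g x) 0 - max (- g x) 0 = g x" and u_split: "max (u x) 0 - max (- u x) 0 = u x" for x
    by auto
  have R_split: "AE x in \<nu>. x \<in> \<Omega> \<longrightarrow> R x = P.R x - N.R x"
    using P.AE_past_integrable N.AE_past_integrable
  proof eventually_elim
    case (elim x)
    then show ?case
      using resolvent_diff[of lam "\<lambda>x. max (g x) 0" x "\<lambda>x. max (- g x) 0" "\<lambda>x. max (u x) 0" "\<lambda>x. max (- u x) 0"]
      by (simp add: g_split u_split)
  qed
  note bd = adjoint_bound[OF \<phi>_meas \<phi>]
  have bd_m: "AE y in \<mu>m. \<bar>adjoint \<phi> y\<bar> \<le> C / lam"
    using bd by (auto intro!: AE_I2 simp: space_\<mu>m Gamma_m_eq)
  have bd_\<Omega>: "AE x in \<nu>. x \<in> \<Omega> \<longrightarrow> \<bar>adjoint \<phi> x\<bar> \<le> C / lam"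
    using bd tau_p_pos by auto
  have adj_m: "adjoint \<phi> \<in> borel_measurable \<mu>m" by (rule measurable_\<mu>m) measurable
  have "(LINT x:\<Omega>|\<nu>. R x * \<phi> x) = (LINT x:\<Omega>|\<nu>. P.R x * \<phi> x - N.R x * \<phi> x)"
  proof (rule set_lebesgue_integral_cong_AE)
    show "AE x\<in>\<Omega> in \<nu>. R x * \<phi> x = P.R x * \<phi> x - N.R x * \<phi> x"
      using R_split by eventually_elim (auto simp: left_diff_distrib)
  qed measurable
  also have "\<dots> = (LINT x:\<Omega>|\<nu>. P.R x * \<phi> x) - (LINT x:\<Omega>|\<nu>. N.R x * \<phi> x)"
    using \<phi> by (intro set_integral_diff(2) set_integrable_mult_bounded[OF P.R_integrable, of _ C]
        set_integrable_mult_bounded[OF N.R_integrable, of _ C]) (auto simp: sets_\<nu>)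
  also have "\<dots> = ((LINT x:\<Omega>|\<nu>. max (g x) 0 * adjoint \<phi> x) - (LINT x:\<Omega>|\<nu>. max (- g x) 0 * adjoint \<phi> x)) +
      ((LINT y|\<mu>m. max (u y) 0 * adjoint \<phi> y) - (LINT y|\<mu>m. max (- u y) 0 * adjoint \<phi> y))"
    by (subst P.duality_bounded[OF \<phi>_meas _ _ \<phi>], simp, simp, subst N.duality_bounded[OF \<phi>_meas _ _ \<phi>], simp, simp)
       (rule add_diff_add)
  also have "(LINT x:\<Omega>|\<nu>. max (g x) 0 * adjoint \<phi> x) - (LINT x:\<Omega>|\<nu>. max (- g x) 0 * adjoint \<phi> x) =
      (LINT x:\<Omega>|\<nu>. max (g x) 0 * adjoint \<phi> x - max (- g x) 0 * adjoint \<phi> x)"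
    by (intro set_integral_diff(2)[symmetric] set_integrable_mult_bounded[OF P.g_integrable _ bd_\<Omega>]
        set_integrable_mult_bounded[OF N.g_integrable _ bd_\<Omega>]) (auto simp: sets_\<nu>)
  also have "(LINT y|\<mu>m. max (u y) 0 * adjoint \<phi> y) - (LINT y|\<mu>m. max (- u y) 0 * adjoint \<phi> y) =
      (LINT y|\<mu>m. max (u y) 0 * adjoint \<phi> y - max (- u y) 0 * adjoint \<phi> y)"
    by (intro Bochner_Integration.integral_diff[symmetric] integrable_mult_bounded[OF P.u_integrable adj_m bd_m]
        integrable_mult_bounded[OF N.u_integrable adj_m bd_m])
  finally show ?thesis
    by (simp add: left_diff_distrib[symmetric] g_split u_split)
qed

text \<open>The functions \<open>p\<close> and \<open>d\<close> are bounded Borel versions of \<open>\<psi>\<close> and its derivative along the flow. The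
  claim is the duality for \<open>\<phi> = lam p - d\<close>, whose adjoint is \<open>\<psi>\<close> inside \<open>\<Omega>\<close> and vanishes
  on \<open>\<Gamma>\<^sub>-\<close>, because the support of \<open>\<psi>\<close> does not reach the boundary.\<close>

lemma resolvent_equation_weak:
  assumes \<mu>: "\<mu> = \<nu> \<or> \<mu> = completion \<nu>" and \<psi>: "\<psi> \<in> test_functions \<mu> \<Phi> \<Omega>"
    and p [measurable]: "p \<in> borel_measurable borel" and p_bd: "\<And>x. \<bar>p x\<bar> \<le> C"
    and p_eq: "AE x in \<nu>. x \<in> \<Omega> \<longrightarrow> \<psi> x = p x"
    and d [measurable]: "d \<in> borel_measurable borel" and d_bd: "\<And>x. \<bar>d x\<bar> \<le> C"
    and d_eq: "AE x in \<nu>. x \<in> \<Omega> \<longrightarrow> flow_deriv \<Phi> \<psi> x = d x"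
  shows "(LINT x:\<Omega>|\<nu>. (lam * R x - g x) * p x) = (LINT x:\<Omega>|\<nu>. R x * d x)"
proof -
  define \<phi> where "\<phi> x = lam * p x - d x" for x
  have [measurable]: "\<phi> \<in> borel_measurable borel" unfolding \<phi>_def[abs_def] by measurable
  have \<phi>_bd: "\<bar>\<phi> x\<bar> \<le> lam * C + C" for x
  proof -
    have "\<bar>\<phi> x\<bar> \<le> lam * \<bar>p x\<bar> + \<bar>d x\<bar>"
      unfolding \<phi>_def using lam_pos by (metis abs_mult abs_of_pos abs_triangle_ineq4)
    also have "\<dots> \<le> lam * C + C"
      using p_bd d_bd lam_pos by (intro add_mono mult_left_mono) auto
    finally show ?thesis .
  qed
  have adj: "adjoint \<phi> x = L"
    if "vanishes_off_support \<mu> \<psi> x" "0 < \<tau>p x" "((\<lambda>t. \<psi> (\<Phi> x t)) \<longlongrightarrow> L) (at_right 0)"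
      and eq: "AE t in lborel. 0 < t \<and> ereal t < \<tau>p x \<longrightarrow> \<psi> (\<Phi> x t) = p (\<Phi> x t) \<and> flow_deriv \<Phi> \<psi> (\<Phi> x t) = d (\<Phi> x t)" for x L
  proof -
    let ?S = "ahead x"
    let ?h = "\<lambda>t. exp (- lam * t) * (lam * \<psi> (\<Phi> x t) - flow_deriv \<Phi> \<psi> (\<Phi> x t))"
    have "continuous_on ?S ?h"
    proof (intro continuous_at_imp_continuous_on ballI)
      fix t assume "t \<in> ?S"
      then have t: "\<Phi> x t \<in> \<Omega>" using before_tau_p by auto
      show "isCont ?h t"
        using test_function_deriv(2)[OF \<psi> t] DERIV_isCont[OF test_function_deriv(1)[OF \<psi> t]]
        by (intro continuous_intros)
    qed
    then have h: "(\<lambda>t. indicator ?S t *\<^sub>R ?h t) \<in> borel_measurable lborel"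
      by (subst measurable_lborel2, intro borel_measurable_continuous_on_indicator) auto
    have \<phi>': "(\<lambda>t. indicator ?S t *\<^sub>R (exp (- lam * t) * \<phi> (\<Phi> x t))) \<in> borel_measurable lborel"
      by measurable
    have "(LINT t|lborel. indicator ?S t *\<^sub>R ?h t) = (LINT t|lborel. indicator ?S t *\<^sub>R (exp (- lam * t) * \<phi> (\<Phi> x t)))"
    proof (rule integral_cong_AE[OF h \<phi>'])
      show "AE t in lborel. indicator ?S t *\<^sub>R ?h t = indicator ?S t *\<^sub>R (exp (- lam * t) * \<phi> (\<Phi> x t))"
        using eq by eventually_elim (auto simp: \<phi>_def split: split_indicator)
    qed
    then show ?thesis
      using test_function_orbit_integral[OF lam_pos \<mu> \<psi> that(1-3)]
      unfolding adjoint_def set_lebesgue_integral_def by simp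
  qed
  have both: "AE x in \<nu>. x \<in> \<Omega> \<longrightarrow> \<psi> x = p x \<and> flow_deriv \<Phi> \<psi> x = d x"
    using p_eq d_eq by eventually_elim auto
  have inner: "AE x in \<nu>. x \<in> \<Omega> \<longrightarrow> adjoint \<phi> x = p x"
    using AE_vanishes_off_support[OF \<mu> \<psi>] AE_along_orbits[OF both] p_eq
  proof eventually_elim
    case (elim x)
    show ?case
    proof
      assume x: "x \<in> \<Omega>"
      have "AE t in lborel. 0 < t \<and> ereal t < \<tau>p x \<longrightarrow> \<psi> (\<Phi> x t) = p (\<Phi> x t) \<and> flow_deriv \<Phi> \<psi> (\<Phi> x t) = d (\<Phi> x t)"
        using elim(2) by eventually_elim (use before_tau_p in auto)
      moreover have "isCont (\<lambda>t. \<psi> (\<Phi> x t)) 0"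
        using DERIV_isCont[OF test_function_deriv(1)[OF \<psi>, of x 0]] x by simp
      then have "((\<lambda>t. \<psi> (\<Phi> x t)) \<longlongrightarrow> \<psi> (\<Phi> x 0)) (at_right 0)"
        unfolding isCont_def by (rule tendsto_within_subset) simp
      ultimately show "adjoint \<phi> x = p x"
        using adj[OF elim(1) tau_p_pos[OF x], of "\<psi> x"] elim(3) x by simp
    qed
  qed
  have "AE x in \<nu>. x \<in> \<Omega> \<longrightarrow> vanishes_off_support \<mu> \<psi> x"
    using AE_vanishes_off_support[OF \<mu> \<psi>] by eventually_elim simp
  from AE_incoming_orbits_ex[OF this] AE_incoming_orbits[OF both] AE_space
  have boundary: "AE y in \<mu>m. adjoint \<phi> y = 0"
  proof eventually_elim
    case (elim y)
    have y: "y \<notin> \<Omega>" "0 < \<tau>p y" using elim(3) by (auto simp: space_\<mu>m Gamma_m_eq)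
    have van: "vanishes_off_support \<mu> \<psi> y" using elim(1) vanishes_off_support_flow by blast
    have "\<Phi> y 0 \<in> - ess_support \<mu> \<Omega> \<psi>" using y test_function_support(2)[OF \<mu> \<psi>] by auto
    then have "eventually (\<lambda>t. t \<in> {t. \<Phi> y t \<in> - ess_support \<mu> \<Omega> \<psi>}) (nhds 0)"
      using test_function_support(1)[OF \<mu> \<psi>]
      by (intro eventually_nhds_in_open open_times_in) (auto simp: compact_imp_closed)
    then have "eventually (\<lambda>t. \<Phi> y t \<notin> ess_support \<mu> \<Omega> \<psi>) (at_right 0)"
      by (auto simp: eventually_at_filter elim: eventually_mono)
    moreover obtain c where c: "0 < c" "ereal c < \<tau>p y"
      using y(2) by (metis ereal_dense2 ereal_less(2))
    have "eventually (\<lambda>t. t \<in> {0<..<c}) (at_right 0)"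
      using c(1) by (auto intro: eventually_at_rightI)
    ultimately have "eventually (\<lambda>t. 0 = \<psi> (\<Phi> y t)) (at_right 0)"
    proof eventually_elim
      case (elim t)
      then have "ereal t < \<tau>p y" using c(2) by (auto elim: less_trans[rotated])
      then have "\<Phi> y t \<in> \<Omega>" using before_tau_p elim by auto
      then show ?case using van elim unfolding vanishes_off_support_def by simp
    qed
    then have "((\<lambda>t. \<psi> (\<Phi> y t)) \<longlongrightarrow> 0) (at_right 0)"
      by (rule Lim_transform_eventually[OF tendsto_const])
    from adj[OF van y(2) this elim(2)] show ?case .
  qed
  have Rp: "set_integrable \<nu> \<Omega> (\<lambda>x. R x * p x)" and Rd: "set_integrable \<nu> \<Omega> (\<lambda>x. R x * d x)"
    and gp: "set_integrable \<nu> \<Omega> (\<lambda>x. g x * p x)"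
    using p_bd d_bd by (auto intro!: set_integrable_mult_bounded[of _ _ _ _ C] R_integrable g_integrable simp: sets_\<nu>)
  have "(LINT x:\<Omega>|\<nu>. R x * \<phi> x) = (LINT x:\<Omega>|\<nu>. g x * adjoint \<phi> x) + (LINT y|\<mu>m. u y * adjoint \<phi> y)"
    by (rule duality[OF _ \<phi>_bd]) measurable
  also have "(LINT x:\<Omega>|\<nu>. g x * adjoint \<phi> x) = (LINT x:\<Omega>|\<nu>. g x * p x)"
  proof (rule set_lebesgue_integral_cong_AE)
    show "AE x\<in>\<Omega> in \<nu>. g x * adjoint \<phi> x = g x * p x"
      using inner by eventually_elim auto
  qed measurable
  also have "(LINT y|\<mu>m. u y * adjoint \<phi> y) = 0"
    by (intro integral_eq_zero_AE, use boundary in eventually_elim) simp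
  finally have "(LINT x:\<Omega>|\<nu>. R x * \<phi> x) = (LINT x:\<Omega>|\<nu>. g x * p x)" by simp
  moreover have "(LINT x:\<Omega>|\<nu>. R x * \<phi> x) = lam * (LINT x:\<Omega>|\<nu>. R x * p x) - (LINT x:\<Omega>|\<nu>. R x * d x)"
  proof -
    have "(LINT x:\<Omega>|\<nu>. R x * \<phi> x) = (LINT x:\<Omega>|\<nu>. lam * (R x * p x) - R x * d x)"
      unfolding \<phi>_def by (simp add: algebra_simps)
    also have "\<dots> = (LINT x:\<Omega>|\<nu>. lam * (R x * p x)) - (LINT x:\<Omega>|\<nu>. R x * d x)"
      using Rp Rd by (intro set_integral_diff(2)) auto
    finally show ?thesis by simp
  qed
  moreover have "(LINT x:\<Omega>|\<nu>. (lam * R x - g x) * p x) = lam * (LINT x:\<Omega>|\<nu>. R x * p x) - (LINT x:\<Omega>|\<nu>. g x * p x)"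
  proof -
    have "(LINT x:\<Omega>|\<nu>. (lam * R x - g x) * p x) = (LINT x:\<Omega>|\<nu>. lam * (R x * p x) - g x * p x)"
      by (simp add: algebra_simps)
    also have "\<dots> = (LINT x:\<Omega>|\<nu>. lam * (R x * p x)) - (LINT x:\<Omega>|\<nu>. g x * p x)"
      using Rp gp by (intro set_integral_diff(2)) auto
    finally show ?thesis by simp
  qed
  ultimately show ?thesis by simp
qed

end

section \<open>Functions with vanishing integrals and Borel representatives\<close>

text \<open>The closed sets are an intersection stable generator, so that the integral over every Borel set vanishes, in
  particular over the sets where \<open>h\<close> is positive or negative.\<close>

lemma AE_zero_of_closed_integrals_zero:
  fixes h :: "'a::topological_space \<Rightarrow> real"
  assumes sets: "sets M = sets borel" and int: "integrable M h"
    and zero: "\<And>A. closed A \<Longrightarrow> (LINT x:A|M. h x) = 0"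
  shows "AE x in M. h x = 0"
proof -
  have [measurable_cong]: "sets M = sets borel" by (rule sets)
  have [measurable]: "h \<in> borel_measurable M" using int by auto
  have sub: "set_integrable M A h" if "A \<in> sets borel" for A
    unfolding set_integrable_def using int that by (intro integrable_mult_indicator) (auto simp: sets)
  have all: "(LINT x:A|M. h x) = 0" if "A \<in> sets borel" for A
  proof -
    have "Int_stable (Collect closed :: 'a set set)" by (auto simp: Int_stable_def)
    moreover have "Collect closed \<subseteq> Pow (UNIV :: 'a set)" by auto
    moreover have "A \<in> sigma_sets UNIV (Collect closed)" using that by (simp add: borel_eq_closed)
    ultimately show ?thesis
    proof (induction A rule: sigma_sets_induct_disjoint)
      case (compl A)
      have A: "A \<in> sets borel" using compl(1) by (simp add: borel_eq_closed)
      then have "(LINT x:A \<union> (UNIV - A)|M. h x) = (LINT x:A|M. h x) + (LINT x:UNIV - A|M. h x)"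
        by (intro set_integral_Un sub) auto
      moreover have "(LINT x:A \<union> (UNIV - A)|M. h x) = 0"
        using zero[of UNIV] by simp
      ultimately show ?case using compl by simp
    next
      case (union A)
      have A: "A i \<in> sets borel" for i using union(2) by (auto simp: borel_eq_closed)
      then have "(LINT x:(\<Union>i. A i)|M. h x) = (\<Sum>i. (LINT x:A i|M. h x))"
        using union(1) by (intro lebesgue_integral_countable_add sub) (auto simp: disjoint_family_on_def sets)
      then show ?case using union by simp
    qed (auto simp: zero)
  qed
  have half: "AE x in M. \<not> 0 < s * h x" for s :: real
  proof -
    let ?A = "{x \<in> space M. 0 < s * h x}"
    have A: "?A \<in> sets borel"
      unfolding sets[symmetric] by measurable
    have "(LINT x|M. s * (indicator ?A x *\<^sub>R h x)) = 0"
      using all[OF A] by (simp add: set_lebesgue_integral_def)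
    moreover have "integrable M (\<lambda>x. s * (indicator ?A x *\<^sub>R h x))"
      using sub[OF A] unfolding set_integrable_def by (rule integrable_mult_right)
    ultimately have "AE x in M. s * (indicator ?A x *\<^sub>R h x) = 0"
      by (subst (asm) integral_nonneg_eq_0_iff_AE) (auto split: split_indicator)
    with AE_space show ?thesis by eventually_elim (auto split: split_indicator_asm)
  qed
  show ?thesis
    using half[of 1, simplified] half[of "-1", simplified] by eventually_elim auto
qed

context invariant_flow
begin

text \<open>For a completed measure, equality almost everywhere with a Borel function implies measurability. If \<open>\<mu>\<close> is \<open>\<nu>\<close>
  itself it does not, and the representative is chosen equal to \<open>f\<close> everywhere on \<open>\<Omega>\<close>.\<close>

lemma borel_representative:
  assumes \<mu>: "\<mu> = \<nu> \<or> \<mu> = completion \<nu>" and f: "set_borel_measurable \<mu> \<Omega> (f :: 'a \<Rightarrow> real)"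
  obtains q where "q \<in> borel_measurable borel" "AE x in \<nu>. x \<in> \<Omega> \<longrightarrow> f x = q x"
    "\<mu> = \<nu> \<Longrightarrow> (\<And>x. x \<in> \<Omega> \<Longrightarrow> f x = q x)"
proof (cases "\<mu> = \<nu>")
  case True
  show ?thesis
  proof (rule that[of "\<lambda>x. indicator \<Omega> x *\<^sub>R f x"])
    show "(\<lambda>x. indicator \<Omega> x *\<^sub>R f x) \<in> borel_measurable borel"
      using f True borel_\<nu> by (simp add: set_borel_measurable_def)
  qed (auto split: split_indicator)
next
  case False
  then have "(\<lambda>x. indicator \<Omega> x *\<^sub>R f x) \<in> borel_measurable (completion \<nu>)"
    using f \<mu> by (simp add: set_borel_measurable_def)
  then obtain q where "q \<in> borel_measurable \<nu>" "AE x in \<nu>. indicator \<Omega> x *\<^sub>R f x = q x"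
    using completion_ex_borel_measurable_real by blast
  moreover from this(2) have "AE x in \<nu>. x \<in> \<Omega> \<longrightarrow> f x = q x"
    by eventually_elim auto
  ultimately show ?thesis using that[of q] False borel_\<nu> by blast
qed

lemma measurable_of_representative:
  assumes \<mu>: "\<mu> = \<nu> \<or> \<mu> = completion \<nu>" and q [measurable]: "q \<in> borel_measurable borel"
    and eq: "AE x in \<nu>. x \<in> \<Omega> \<longrightarrow> f x = (q x :: real)" "\<mu> = \<nu> \<Longrightarrow> (\<And>x. x \<in> \<Omega> \<Longrightarrow> f x = q x)"
  shows "set_borel_measurable \<mu> \<Omega> f"
proof -
  let ?f = "\<lambda>x. indicator \<Omega> x *\<^sub>R f x" and ?q = "\<lambda>x. indicator \<Omega> x *\<^sub>R q x"
  have q': "?q \<in> borel_measurable \<mu>"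
    by (rule borel_measurable_of_completion[OF \<mu>]) measurable
  show ?thesis
  proof (cases "\<mu> = \<nu>")
    case True
    then have "?f = ?q" using eq(2) by (auto split: split_indicator)
    then show ?thesis using q' by (simp add: set_borel_measurable_def)
  next
    case False
    interpret C: complete_measure \<mu>
      using \<mu> False completion.complete_measure_axioms by blast
    have "AE x in \<mu>. ?f x = ?q x"
      unfolding AE_of_completion[OF \<mu>] using eq(1) by eventually_elim (auto split: split_indicator)
    show ?thesis
      unfolding set_borel_measurable_def
    proof (rule measurableI)
      fix A :: "real set" assume A: "A \<in> sets borel"
      have "AE x in \<mu>. x \<in> ?q -` A \<inter> space \<mu> \<longleftrightarrow> x \<in> ?f -` A \<inter> space \<mu>"
        using \<open>AE x in \<mu>. ?f x = ?q x\<close> by eventually_elim (simp only: Int_iff vimage_eq)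
      then show "?f -` A \<inter> space \<mu> \<in> sets \<mu>"
        using measurable_sets[OF q' A] by (rule C.in_sets_AE) auto
    qed auto
  qed
qed

lemma set_integral_of_representative:
  assumes \<mu>: "\<mu> = \<nu> \<or> \<mu> = completion \<nu>" and q [measurable]: "q \<in> borel_measurable borel"
    and f: "set_borel_measurable \<mu> \<Omega> f" and eq: "AE x in \<nu>. x \<in> \<Omega> \<longrightarrow> f x = (q x :: real)"
  shows "set_integrable \<mu> \<Omega> f \<longleftrightarrow> set_integrable \<nu> \<Omega> q"
    and "(LINT x:\<Omega>|\<mu>. f x) = (LINT x:\<Omega>|\<nu>. q x)"
proof -
  let ?f = "\<lambda>x. indicator \<Omega> x *\<^sub>R f x" and ?q = "\<lambda>x. indicator \<Omega> x *\<^sub>R q x"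
  have q': "?q \<in> borel_measurable \<mu>"
    by (rule borel_measurable_of_completion[OF \<mu>]) measurable
  have f': "?f \<in> borel_measurable \<mu>" using f by (simp add: set_borel_measurable_def)
  have ae: "AE x in \<mu>. ?f x = ?q x"
    unfolding AE_of_completion[OF \<mu>] using eq(1) by eventually_elim (auto split: split_indicator)
  have q\<nu>: "?q \<in> borel_measurable \<nu>" by measurable
  have "integrable \<mu> ?q \<longleftrightarrow> integrable \<nu> ?q" "integral\<^sup>L \<mu> ?q = integral\<^sup>L \<nu> ?q"
    using \<mu> integrable_completion[OF q\<nu>] integral_completion[OF q\<nu>] by auto
  then show "set_integrable \<mu> \<Omega> f \<longleftrightarrow> set_integrable \<nu> \<Omega> q" "(LINT x:\<Omega>|\<mu>. f x) = (LINT x:\<Omega>|\<nu>. q x)"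
    unfolding set_integrable_def set_lebesgue_integral_def
    using integrable_cong_AE[OF f' q' ae] integral_cong_AE[OF f' q' ae] by auto
qed

lemma set_borel_measurable_of_borel:
  assumes \<mu>: "\<mu> = \<nu> \<or> \<mu> = completion \<nu>" and "(q :: 'a \<Rightarrow> real) \<in> borel_measurable borel"
  shows "set_borel_measurable \<mu> \<Omega> q"
  using assms by (intro measurable_of_representative[of \<mu> q]) auto

section \<open>Uniqueness of the weak derivative\<close>

text \<open>By uniform continuity, a short time does not move \<open>K\<close> as far as the complement of \<open>\<Omega>\<close>.\<close>

lemma compact_stays_in_domain:
  assumes K: "compact K" "K \<subseteq> \<Omega>"
  obtains \<epsilon> where "0 < \<epsilon>" "\<And>y s. y \<in> K \<Longrightarrow> 0 \<le> s \<Longrightarrow> s \<le> \<epsilon> \<Longrightarrow> \<Phi> y (- s) \<in> \<Omega>"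
proof (cases "K = {}")
  case True
  then show ?thesis using that[of 1] by auto
next
  case False
  obtain e where e: "e > 0" "{x. infdist x K \<le> e} \<subseteq> \<Omega>"
    using compact_in_open_separated[OF False K(1) domain_open K(2)] by metis
  have "uniformly_continuous_on (K \<times> {0..1::real}) (\<lambda>z. \<Phi> (fst z) (- snd z))"
    using K(1) by (intro compact_uniformly_continuous compact_Times continuous_intros) auto
  then obtain \<delta> where \<delta>: "\<delta> > 0" "\<And>z z'. z \<in> K \<times> {0..1} \<Longrightarrow> z' \<in> K \<times> {0..1} \<Longrightarrow> dist z' z < \<delta> \<Longrightarrow>
      dist (\<Phi> (fst z') (- snd z')) (\<Phi> (fst z) (- snd z)) < e"
    using e(1) unfolding uniformly_continuous_on_def by metis
  show ?thesis
  proof (rule that[of "min 1 (\<delta>/2)"])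
    fix y s assume y: "y \<in> K" "0 \<le> s" "s \<le> min 1 (\<delta>/2)"
    then have "dist (y, s) (y, 0) < \<delta>" using \<delta>(1) by (simp add: dist_Pair_Pair)
    then have "dist (\<Phi> y (- s)) y < e"
      using \<delta>(2)[of "(y, 0)" "(y, s)"] y by auto
    then have "infdist (\<Phi> y (- s)) K \<le> e"
      using infdist_le[OF y(1), of "\<Phi> y (- s)"] by simp
    then show "\<Phi> y (- s) \<in> \<Omega>" using e(2) by blast
  qed (use \<delta> in auto)
qed

text \<open>By the fundamental theorem of calculus the derivative of such an average along the flow is the difference
  quotient \<open>(\<phi>(\<Phi> x \<epsilon>) - \<phi> x) / \<epsilon>\<close>, which is continuous along orbits and bounded. The support moves
  by the flow for a time at most \<open>\<epsilon>\<close>.\<close>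

lemma forward_average_test_function:
  assumes \<mu>: "\<mu> = \<nu> \<or> \<mu> = completion \<nu>"
    and \<phi>: "continuous_on UNIV (\<phi> :: 'a \<Rightarrow> real)" "\<And>x. \<bar>\<phi> x\<bar> \<le> C"
    and K: "compact K" "\<And>x. \<phi> x \<noteq> 0 \<Longrightarrow> x \<in> K"
    and \<epsilon>: "0 < \<epsilon>" "\<And>y s. y \<in> K \<Longrightarrow> 0 \<le> s \<Longrightarrow> s \<le> \<epsilon> \<Longrightarrow> \<Phi> y (- s) \<in> \<Omega>"
  defines "\<psi> \<equiv> \<lambda>x. integral {0..\<epsilon>} (\<lambda>s. \<phi> (\<Phi> x s)) / \<epsilon>"
  shows "\<psi> \<in> test_functions \<mu> \<Phi> \<Omega>" "\<psi> \<in> borel_measurable borel" "\<bar>\<psi> x\<bar> \<le> C"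
proof -
  have q_cont: "continuous_on S (\<lambda>s. \<phi> (\<Phi> x s))" for x S
    by (rule continuous_on_compose2[OF \<phi>(1)]) (auto intro!: continuous_intros)
  have [measurable]: "\<phi> \<in> borel_measurable borel"
    using \<phi>(1) by (rule borel_measurable_continuous_onI)
  have lint: "integral {0..\<epsilon>} (\<lambda>s. \<phi> (\<Phi> x s)) = (LINT s:{0..\<epsilon>}|lborel. \<phi> (\<Phi> x s))" for x
    using set_borel_integral_eq_integral(2)[OF borel_integrable_atLeastAtMost'[OF q_cont]] by simp
  show \<psi>_meas: "\<psi> \<in> borel_measurable borel"
    unfolding \<psi>_def lint set_lebesgue_integral_def by measurable
  show bound: "\<bar>\<psi> x\<bar> \<le> C" for x
  proof -
    have "norm (integral {0..\<epsilon>} (\<lambda>s. \<phi> (\<Phi> x s))) \<le> C * (\<epsilon> - 0)"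
      using \<epsilon> \<phi>(2) by (intro integral_bound q_cont) auto
    then show ?thesis using \<epsilon> by (simp add: \<psi>_def field_simps)
  qed
  have deriv: "((\<lambda>t. \<psi> (\<Phi> x t)) has_real_derivative (\<phi> (\<Phi> x (t + \<epsilon>)) - \<phi> (\<Phi> x t)) / \<epsilon>) (at t)" for x t
  proof -
    let ?q = "\<lambda>s. \<phi> (\<Phi> x s)"
    let ?I = "{t - 1..t + \<epsilon> + 1}"
    obtain Q where Q: "\<And>s. s \<in> ?I \<Longrightarrow> (Q has_vector_derivative ?q s) (at s within ?I)"
      using antiderivative_continuous[OF q_cont] by blast
    have Q': "(Q has_real_derivative ?q s) (at s)" if "s \<in> {t - 1<..<t + \<epsilon> + 1}" for s
      using Q[of s] that at_within_Icc_at[of "t - 1" s "t + \<epsilon> + 1"]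
      by (simp add: has_real_derivative_iff_has_vector_derivative)
    have eq: "\<psi> (\<Phi> x r) = (Q (r + \<epsilon>) - Q r) / \<epsilon>" if r: "r \<in> ball t 1" for r
    proof -
      have r': "t - 1 < r" "r < t + 1" using r by (auto simp: dist_real_def)
      have "(?q has_integral (Q (r + \<epsilon>) - Q r)) {r..r + \<epsilon>}"
      proof (rule fundamental_theorem_of_calculus)
        fix s assume "s \<in> {r..r + \<epsilon>}"
        then have "s \<in> {t - 1<..<t + \<epsilon> + 1}" using r' by auto
        from Q'[OF this] show "(Q has_vector_derivative ?q s) (at s within {r..r + \<epsilon>})"
          by (simp add: has_real_derivative_iff_has_vector_derivative has_vector_derivative_at_within)
      qed (use \<epsilon> in auto)
      then show ?thesis
        using integral_shift_Icc_real[of 0 \<epsilon> ?q r] by (simp add: \<psi>_def integral_unique o_def add.commute)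
    qed
    have "((\<lambda>r. Q (r + \<epsilon>)) has_real_derivative ?q (t + \<epsilon>)) (at t)"
      using Q'[of "t + \<epsilon>"] \<epsilon> by (subst DERIV_shift[symmetric]) auto
    then have "((\<lambda>r. (Q (r + \<epsilon>) - Q r) / \<epsilon>) has_real_derivative (?q (t + \<epsilon>) - ?q t) / \<epsilon>) (at t)"
      using Q'[of t] \<epsilon>(1) by (intro DERIV_cdivide DERIV_diff) auto
    then show ?thesis
      by (rule has_field_derivative_transform_within_open[of _ _ _ "ball t 1"]) (auto simp: eq)
  qed
  have fd: "flow_deriv \<Phi> \<psi> x = (\<phi> (\<Phi> x \<epsilon>) - \<phi> x) / \<epsilon>" for x
    unfolding flow_deriv_def using DERIV_imp_deriv[OF deriv[of x 0]] by simp
  define K' where "K' = (\<lambda>z. \<Phi> (fst z) (- snd z)) ` (K \<times> {0..\<epsilon>})"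
  have K': "compact K'" unfolding K'_def
    using K(1) by (intro compact_continuous_image compact_Times continuous_intros) auto
  have K'_sub: "K' \<subseteq> \<Omega>" unfolding K'_def using \<epsilon>(2) by auto
  have off: "\<psi> x = 0" if "x \<notin> K'" for x
  proof -
    have "\<phi> (\<Phi> x s) = 0" if s: "s \<in> {0..\<epsilon>}" for s
    proof (rule ccontr)
      assume "\<phi> (\<Phi> x s) \<noteq> 0"
      then have "x \<in> K'"
        unfolding K'_def using s K(2) by (intro image_eqI[of _ _ "(\<Phi> x s, s)"]) auto
      with \<open>x \<notin> K'\<close> show False ..
    qed
    then have "integral {0..\<epsilon>} (\<lambda>s. \<phi> (\<Phi> x s)) = integral {0..\<epsilon>} (\<lambda>s. 0)"
      by (intro integral_cong) auto
    then show ?thesis by (simp add: \<psi>_def)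
  qed
  have "ess_support \<mu> \<Omega> \<psi> = K' - \<Union>{W. open W \<and> W \<subseteq> \<Omega> \<and> (AE x\<in>W in \<mu>. \<psi> x = 0)}"
  proof -
    have "\<Omega> - K' \<in> {W. open W \<and> W \<subseteq> \<Omega> \<and> (AE x\<in>W in \<mu>. \<psi> x = 0)}"
      using domain_open K' compact_imp_closed off by (auto intro!: AE_I2)
    then show ?thesis using K'_sub unfolding ess_support_def by blast
  qed
  also have "compact \<dots>" using K' by (intro compact_diff open_Union) auto
  finally have support: "compact (ess_support \<mu> \<Omega> \<psi>)" .
  have "(\<lambda>s. \<psi> (\<Phi> x s)) C1_differentiable_on S" for x S
    unfolding C1_differentiable_on_def
  proof (intro exI conjI ballI)
    show "((\<lambda>s. \<psi> (\<Phi> x s)) has_vector_derivative (\<phi> (\<Phi> x (t + \<epsilon>)) - \<phi> (\<Phi> x t)) / \<epsilon>) (at t)" for t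
      using deriv[of x t] by (simp add: has_real_derivative_iff_has_vector_derivative)
    have "continuous_on S (\<lambda>t. \<phi> (\<Phi> x (t + \<epsilon>)))"
      by (rule continuous_on_compose2[OF \<phi>(1)]) (auto intro!: continuous_intros)
    then show "continuous_on S (\<lambda>t. (\<phi> (\<Phi> x (t + \<epsilon>)) - \<phi> (\<Phi> x t)) / \<epsilon>)"
      using q_cont \<epsilon> by (intro continuous_intros) auto
  qed
  moreover have "(\<lambda>x. flow_deriv \<Phi> \<psi> x) \<in> borel_measurable borel"
    unfolding fd by measurable
  moreover have "\<bar>flow_deriv \<Phi> \<psi> x\<bar> \<le> (C + C) / \<epsilon>" for x
  proof -
    have "\<bar>\<phi> (\<Phi> x \<epsilon>) - \<phi> x\<bar> \<le> C + C"
      using \<phi>(2)[of x] \<phi>(2)[of "\<Phi> x \<epsilon>"] by linarith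
    then show ?thesis unfolding fd using \<epsilon> by (simp add: divide_right_mono)
  qed
  moreover have "bounded (\<psi> ` \<Omega>)"
    unfolding bounded_iff using bound by auto
  ultimately show "\<psi> \<in> test_functions \<mu> \<Phi> \<Omega>"
    using support set_borel_measurable_of_borel[OF \<mu>] \<psi>_meas
    unfolding test_functions_def bounded_iff by auto
qed

lemma forward_average_tendsto:
  assumes "continuous_on UNIV (\<phi> :: 'a \<Rightarrow> real)" and "X \<longlonglongrightarrow> 0" "\<And>n. 0 < X n" "\<And>n. X n \<le> 1"
  shows "(\<lambda>n. integral {0..X n} (\<lambda>s. \<phi> (\<Phi> x s)) / X n) \<longlonglongrightarrow> \<phi> x"
proof -
  have "continuous_on {0..1} (\<lambda>s. \<phi> (\<Phi> x s))"
    by (rule continuous_on_compose2[OF assms(1)]) (auto intro!: continuous_intros)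
  from integral_has_real_derivative[OF this, of 0]
  have "((\<lambda>y. integral {0..y} (\<lambda>s. \<phi> (\<Phi> x s)) / y) \<longlongrightarrow> \<phi> x) (at 0 within {0..1})"
    by (simp add: has_field_derivative_iff)
  moreover have "filterlim X (at 0 within {0..1}) sequentially"
    using assms by (auto simp: filterlim_at less_imp_le less_imp_neq[THEN not_sym] intro!: always_eventually)
  ultimately show ?thesis by (rule filterlim_compose)
qed

text \<open>Forward averages over shrinking times converge to \<open>\<phi>\<close>, so that test functions may be replaced by
  continuous functions with compact support; these approximate indicator functions of compact sets by
  means of the distance to the set.\<close>

lemma integral_against_test_functions_zero:
  assumes \<mu>: "\<mu> = \<nu> \<or> \<mu> = completion \<nu>"
    and d [measurable]: "d \<in> borel_measurable borel" and d_int: "set_integrable \<nu> \<Omega> d"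
    and zero: "\<And>\<psi>. \<psi> \<in> test_functions \<mu> \<Phi> \<Omega> \<Longrightarrow> \<psi> \<in> borel_measurable borel \<Longrightarrow> (LINT x:\<Omega>|\<nu>. d x * \<psi> x) = 0"
  shows "AE x in \<nu>. x \<in> \<Omega> \<longrightarrow> d x = (0::real)"
proof -
  define d' where "d' x = indicator \<Omega> x * d x" for x
  have d'_int: "integrable \<nu> d'" using d_int by (simp add: set_integrable_def d'_def[abs_def])
  have [measurable]: "d' \<in> borel_measurable borel" unfolding d'_def[abs_def] by measurable
  have zero': "(LINT x|\<nu>. d' x * \<psi> x) = 0" if "\<psi> \<in> test_functions \<mu> \<Phi> \<Omega>" "\<psi> \<in> borel_measurable borel" for \<psi>
    using zero[OF that] by (simp add: set_lebesgue_integral_def d'_def mult.assoc)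
  have cont_zero: "(LINT x|\<nu>. d' x * \<phi> x) = 0"
    if \<phi>: "continuous_on UNIV \<phi>" "\<And>x. \<bar>\<phi> x\<bar> \<le> 1" and K: "compact K" "K \<subseteq> \<Omega>" "\<And>x. \<phi> x \<noteq> 0 \<Longrightarrow> x \<in> K" for \<phi> K
  proof -
    obtain \<epsilon> where \<epsilon>: "0 < \<epsilon>" "\<And>y s. y \<in> K \<Longrightarrow> 0 \<le> s \<Longrightarrow> s \<le> \<epsilon> \<Longrightarrow> \<Phi> y (- s) \<in> \<Omega>"
      using compact_stays_in_domain[OF K(1,2)] by blast
    define X where "X n = min 1 \<epsilon> / Suc n" for n
    have "min 1 \<epsilon> / real (Suc n) \<le> min 1 \<epsilon> / 1" for n
      using \<epsilon>(1) by (intro divide_left_mono) auto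
    then have X: "0 < X n" "X n \<le> 1" "X n \<le> \<epsilon>" for n
      using \<epsilon>(1) unfolding X_def by (simp, (metis div_by_1 min.boundedE)+)
    have "X \<longlonglongrightarrow> 0" unfolding X_def by (rule LIMSEQ_Suc[OF lim_const_over_n])
    define \<psi> where "\<psi> n x = integral {0..X n} (\<lambda>s. \<phi> (\<Phi> x s)) / X n" for n x
    have \<psi>: "\<psi> n \<in> test_functions \<mu> \<Phi> \<Omega>" "\<psi> n \<in> borel_measurable borel" "\<bar>\<psi> n x\<bar> \<le> 1" for n x
      unfolding \<psi>_def[abs_def] using X[of n] \<epsilon>(2)
      by (intro forward_average_test_function[OF \<mu> \<phi> K(1,3)]; force)+
    have [measurable]: "\<phi> \<in> borel_measurable borel" "\<psi> n \<in> borel_measurable borel" for n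
      using \<phi>(1) \<psi>(2) by (auto intro: borel_measurable_continuous_onI)
    have "(\<lambda>n. LINT x|\<nu>. d' x * \<psi> n x) \<longlonglongrightarrow> (LINT x|\<nu>. d' x * \<phi> x)"
    proof (rule integral_dominated_convergence[where w = "\<lambda>x. norm (d' x)"])
      show "AE x in \<nu>. (\<lambda>n. d' x * \<psi> n x) \<longlonglongrightarrow> d' x * \<phi> x"
        unfolding \<psi>_def using forward_average_tendsto[OF \<phi>(1) \<open>X \<longlonglongrightarrow> 0\<close> X(1,2)]
        by (intro AE_I2 tendsto_mult tendsto_const)
      show "AE x in \<nu>. norm (d' x * \<psi> n x) \<le> norm (d' x)" for n
        using \<psi>(3) by (intro AE_I2) (auto simp: abs_mult intro: mult_left_le)
    qed (use d'_int in auto)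
    then show ?thesis using zero'[OF \<psi>(1,2)] by (simp add: LIMSEQ_const_iff)
  qed
  have compact_zero: "(LINT x|\<nu>. d' x * indicator C x) = 0" if C: "compact C" "C \<subseteq> \<Omega>" for C
  proof (cases "C = {}")
    case False
    obtain e where e: "e > 0" "{x. infdist x C \<le> e} \<subseteq> \<Omega>"
      using compact_in_open_separated[OF False C(1) domain_open C(2)] by metis
    define \<phi> where "\<phi> n x = max 0 (1 - (1 + real n) / e * infdist x C)" for n x
    have \<phi>_cont: "continuous_on UNIV (\<phi> n)" for n
      unfolding \<phi>_def[abs_def] by (intro continuous_intros)
    have \<phi>_bound: "\<bar>\<phi> n x\<bar> \<le> 1" for n x
      using e(1) infdist_nonneg[of x C] by (auto simp: \<phi>_def)
    have \<phi>_supp: "x \<in> {x. infdist x C \<le> e}" if "\<phi> n x \<noteq> 0" for n x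
    proof -
      have "(1 + real n) / e * infdist x C < 1"
      proof (rule ccontr)
        assume "\<not> ?thesis"
        then have "\<phi> n x = 0" by (simp add: \<phi>_def)
        with that show False ..
      qed
      then have "(1 + real n) * infdist x C < e" using e(1) by (simp add: field_simps)
      moreover have "1 * infdist x C \<le> (1 + real n) * infdist x C"
        by (intro mult_right_mono infdist_nonneg) auto
      ultimately show ?thesis by simp
    qed
    have [measurable]: "\<phi> n \<in> borel_measurable borel" for n
      using \<phi>_cont by (intro borel_measurable_continuous_onI)
    have [measurable]: "C \<in> sets borel" using C(1) by (intro borel_compact)
    have "(\<lambda>n. LINT x|\<nu>. d' x * \<phi> n x) \<longlonglongrightarrow> (LINT x|\<nu>. d' x * indicator C x)"
    proof (rule integral_dominated_convergence[where w = "\<lambda>x. norm (d' x)"])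
      have "(\<lambda>n. \<phi> n x) \<longlonglongrightarrow> indicator C x" for x
      proof (cases "x \<in> C")
        case True
        then show ?thesis by (simp add: \<phi>_def)
      next
        case False
        then have pos: "0 < infdist x C"
          using C(1) \<open>C \<noteq> {}\<close> infdist_pos_not_in_closed compact_imp_closed by blast
        obtain N where N: "e / infdist x C < real N" using reals_Archimedean2 by blast
        have "\<phi> n x = 0" if "n \<ge> N" for n
        proof -
          have "e / infdist x C < 1 + real n" using N that by linarith
          then have "1 < (1 + real n) / e * infdist x C"
            using pos e(1) by (simp add: field_simps)
          then show ?thesis by (simp add: \<phi>_def)
        qed
        then have "eventually (\<lambda>n. \<phi> n x = indicator C x) sequentially"
          unfolding eventually_sequentially using False by auto
        then show ?thesis by (rule tendsto_eventually)
      qed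
      then show "AE x in \<nu>. (\<lambda>n. d' x * \<phi> n x) \<longlonglongrightarrow> d' x * indicator C x"
        by (intro AE_I2 tendsto_mult tendsto_const)
      show "AE x in \<nu>. norm (d' x * \<phi> n x) \<le> norm (d' x)" for n
        using \<phi>_bound by (intro AE_I2) (auto simp: abs_mult intro: mult_left_le)
    qed (use d'_int in auto)
    moreover have "(LINT x|\<nu>. d' x * \<phi> n x) = 0" for n
      using compact_infdist_le[OF False C(1) e(1)] e(2) \<phi>_supp by (intro cont_zero[OF \<phi>_cont \<phi>_bound]) auto
    ultimately show ?thesis by (simp add: LIMSEQ_const_iff)
  qed simp
  have on_compact: "AE x in \<nu>. x \<in> U \<longrightarrow> d' x = 0" if U: "compact U" "U \<subseteq> \<Omega>" for U
  proof -
    have [measurable]: "U \<in> sets borel" using U(1) by (intro borel_compact)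
    define dU where "dU x = d' x * indicator U x" for x
    have dU_int: "integrable \<nu> dU"
      unfolding dU_def[abs_def] using d'_int by (intro integrable_mult_indicator[where 'b = real, simplified] integrable_real_mult_indicator) (auto simp: sets_\<nu>)
    have "(LINT x:A|\<nu>. dU x) = 0" if "closed A" for A
    proof -
      have "(LINT x:A|\<nu>. dU x) = (LINT x|\<nu>. d' x * indicator (A \<inter> U) x)"
        unfolding set_lebesgue_integral_def dU_def
        by (intro Bochner_Integration.integral_cong) (auto split: split_indicator)
      then show ?thesis using compact_zero[of "A \<inter> U"] that U by (auto simp: closed_Int_compact)
    qed
    then have "AE x in \<nu>. dU x = 0"
      by (rule AE_zero_of_closed_integrals_zero[OF sets_\<nu> dU_int])
    then show ?thesis by eventually_elim (auto simp: dU_def split: split_indicator_asm)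
  qed
  obtain C :: "nat \<Rightarrow> 'a set" where C: "\<And>n. compact (C n)" "\<And>n. C n \<subseteq> \<Omega>" "\<Union>(range C) = \<Omega>"
    using open_Union_compact_subsets[OF domain_open] by metis
  have "AE x in \<nu>. \<forall>n. x \<in> C n \<longrightarrow> d' x = 0"
    unfolding AE_all_countable using on_compact[OF C(1,2)] by blast
  then show ?thesis
  proof eventually_elim
    case (elim x)
    have "\<exists>n. x \<in> C n" if "x \<in> \<Omega>" using that C(3) by blast
    then show ?case using elim by (auto simp: d'_def)
  qed
qed

lemma weak_transport_unique:
  assumes \<mu>: "\<mu> = \<nu> \<or> \<mu> = completion \<nu>"
    and w: "weak_transport \<mu> \<Phi> \<Omega> f g1" "weak_transport \<mu> \<Phi> \<Omega> f g2"
  shows "AE x in \<nu>. x \<in> \<Omega> \<longrightarrow> g1 x = g2 x"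
proof -
  let ?d = "\<lambda>x. g1 x - g2 x"
  have g_int: "set_integrable \<mu> \<Omega> g1" "set_integrable \<mu> \<Omega> g2"
    using w by (auto simp: weak_transport_def)
  have d_int: "set_integrable \<mu> \<Omega> ?d" by (rule set_integral_diff(1)[OF g_int])
  then have d_meas: "set_borel_measurable \<mu> \<Omega> ?d"
    by (auto simp: set_integrable_def set_borel_measurable_def)
  obtain q where q [measurable]: "q \<in> borel_measurable borel" and q_eq: "AE x in \<nu>. x \<in> \<Omega> \<longrightarrow> ?d x = q x"
    using borel_representative[OF \<mu> d_meas] by metis
  have "AE x in \<nu>. x \<in> \<Omega> \<longrightarrow> q x = 0"
  proof (rule integral_against_test_functions_zero[OF \<mu> q])
    show "set_integrable \<nu> \<Omega> q"
      using set_integral_of_representative(1)[OF \<mu> q d_meas q_eq] d_int by simp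
    fix \<psi> assume \<psi>: "\<psi> \<in> test_functions \<mu> \<Phi> \<Omega>" and [measurable]: "\<psi> \<in> borel_measurable borel"
    have "bounded (\<psi> ` \<Omega>)" using \<psi> by (simp add: test_functions_def)
    then obtain M where M: "\<And>x. x \<in> \<Omega> \<Longrightarrow> \<bar>\<psi> x\<bar> \<le> M" unfolding bounded_iff by auto
    have int: "set_integrable \<mu> \<Omega> (\<lambda>x. h x * \<psi> x)" if "set_integrable \<mu> \<Omega> h" for h
    proof -
      have "\<psi> \<in> borel_measurable \<mu>" "\<Omega> \<in> sets \<mu>"
        using borel_measurable_of_completion[OF \<mu>, of \<psi>] domain_open \<mu> by (auto simp: sets_\<nu>)
      then show ?thesis using M that by (intro set_integrable_mult_bounded[where C = M]) auto
    qed
    have i: "set_integrable \<mu> \<Omega> (\<lambda>x. ?d x * \<psi> x)" by (rule int[OF d_int])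
    have "(LINT x:\<Omega>|\<nu>. q x * \<psi> x) = (LINT x:\<Omega>|\<mu>. ?d x * \<psi> x)"
    proof (rule set_integral_of_representative(2)[OF \<mu>, symmetric])
      show "set_borel_measurable \<mu> \<Omega> (\<lambda>x. ?d x * \<psi> x)"
        using i by (auto simp: set_integrable_def set_borel_measurable_def)
      show "AE x in \<nu>. x \<in> \<Omega> \<longrightarrow> ?d x * \<psi> x = q x * \<psi> x"
        using q_eq by eventually_elim auto
    qed measurable
    also have "\<dots> = (LINT x:\<Omega>|\<mu>. g1 x * \<psi> x) - (LINT x:\<Omega>|\<mu>. g2 x * \<psi> x)"
      unfolding left_diff_distrib by (rule set_integral_diff(2)[OF int[OF g_int(1)] int[OF g_int(2)]])
    also have "\<dots> = 0" using w \<psi> by (auto simp: weak_transport_def)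
    finally show "(LINT x:\<Omega>|\<nu>. q x * \<psi> x) = 0" .
  qed
  with q_eq show ?thesis by eventually_elim auto
qed

end

section \<open>The boundary value problem\<close>

lemma AE_lborel_affine:
  fixes P :: "real \<Rightarrow> bool"
  assumes "c \<noteq> 0" "AE t in lborel. P t"
  shows "AE t in lborel. P (a + c * t)"
proof -
  obtain N where N: "{t. \<not> P t} \<subseteq> N" "emeasure lborel N = 0" and [measurable]: "N \<in> sets borel"
    using AE_E[OF assms(2)] by auto
  have "AE t in lborel. t \<notin> N" using N by (intro AE_not_in) (auto intro: null_setsI)
  then have "AE t in lborel. a + c * t \<notin> N"
    using assms(1) by (intro AE_borel_affine) measurable
  then show ?thesis by eventually_elim (use N in auto)
qed

lemma lebesgue_integral_of_borel:
  fixes p q :: "real \<Rightarrow> real"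
  assumes [measurable]: "q \<in> borel_measurable borel" "S \<in> sets borel" and eq: "AE t in lborel. t \<in> S \<longrightarrow> p t = q t"
  shows "(LINT t:S|lebesgue. p t) = (LINT t:S|lborel. q t)"
proof -
  have q: "(\<lambda>t. indicator S t *\<^sub>R q t) \<in> borel_measurable lborel" by measurable
  then have q': "(\<lambda>t. indicator S t *\<^sub>R q t) \<in> borel_measurable lebesgue" by (rule measurable_completion)
  have "AE t in lborel. indicator S t *\<^sub>R q t = indicator S t *\<^sub>R p t"
    using eq by eventually_elim (auto split: split_indicator)
  then have ae: "AE t in lebesgue. indicator S t *\<^sub>R q t = indicator S t *\<^sub>R p t"
    by (rule AE_completion)
  have p': "(\<lambda>t. indicator S t *\<^sub>R p t) \<in> borel_measurable lebesgue"
    by (rule borel_measurable_AE[OF q' ae])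
  show ?thesis
    unfolding set_lebesgue_integral_def
    using integral_cong_AE[OF q' p' ae] integral_completion[OF q] by simp
qed

text \<open>Applied to the initial value of the difference of two solutions, on orbits that never entered \<open>\<Omega>\<close>.\<close>

lemma integrable_const_half_line:
  fixes c :: real
  assumes "integrable lborel (\<lambda>t::real. indicator {0<..} t * c)"
  shows "c = 0"
proof (rule ccontr)
  assume "c \<noteq> 0"
  have "(\<integral>\<^sup>+t. ennreal \<bar>c\<bar> * indicator {0<..} (t::real) \<partial>lborel) = (\<integral>\<^sup>+t. ennreal (norm (indicator {0<..} (t::real) * c)) \<partial>lborel)"
    by (intro nn_integral_cong) (auto split: split_indicator)
  also have "\<dots> < \<infinity>" using assms unfolding integrable_iff_bounded by blast
  finally have "ennreal \<bar>c\<bar> * emeasure lborel {0::real<..} < \<infinity>"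
    by (subst (asm) nn_integral_cmult_indicator) auto
  moreover have "emeasure lborel {0::real<..} = \<infinity>"
  proof -
    have "ennreal (real n) \<le> emeasure lborel {0::real<..}" for n
    proof -
      have "emeasure lborel {0<..<real n} \<le> emeasure lborel {0::real<..}" by (intro emeasure_mono) auto
      then show ?thesis by simp
    qed
    then show ?thesis
      by (metis ennreal_Ex_less_of_nat ennreal_of_nat_eq_real_of_nat infinity_ennreal_def less_top not_le)
  qed
  ultimately show False using \<open>c \<noteq> 0\<close> by (simp add: ennreal_mult_top)
qed

context flow_with_boundary
begin

lemma zero_in_orbit_interval: "x \<in> \<Omega> \<Longrightarrow> - \<tau>m x < ereal 0 \<and> ereal 0 < \<tau>p x"
  using tau_m_pos[of x] tau_p_pos[of x] by (cases "\<tau>m x"; cases "\<tau>p x") auto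

text \<open>A property of whole orbits that holds for almost every point of \<open>\<Omega>\<close> holds for the orbit of almost every
  boundary point, since that orbit contains such points.\<close>

lemma incoming_orbits_agree:
  assumes "AE x in \<nu>. x \<in> \<Omega> \<longrightarrow> (\<forall>s. on_orbit x s \<longrightarrow> P (\<Phi> x s))"
  shows "AE y in \<mu>m. \<forall>r. 0 < r \<and> ereal r < \<tau>p y \<longrightarrow> P (\<Phi> y r)"
  using AE_incoming_orbits_ex[OF assms] AE_space
proof eventually_elim
  case (elim y)
  then obtain s where s: "0 < s" "ereal s < \<tau>p y"
    and P: "\<And>r. - \<tau>m (\<Phi> y s) < ereal r \<Longrightarrow> ereal r < \<tau>p (\<Phi> y s) \<Longrightarrow> P (\<Phi> (\<Phi> y s) r)" by blast
  have y: "y \<notin> \<Omega>" using elim by (simp add: space_\<mu>m Gamma_m_eq)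
  show ?case
  proof (intro allI impI)
    fix r assume r: "0 < r \<and> ereal r < \<tau>p y"
    have "- \<tau>m (\<Phi> y s) < ereal (r - s)" using tau_m_shift_boundary[OF y s] r by simp
    moreover have "ereal (r - s) < \<tau>p (\<Phi> y s)"
      using tau_p_shift[OF s] r by (cases "\<tau>p y") auto
    ultimately show "P (\<Phi> y r)" using P[of "r - s"] by simp
  qed
qed

lemma outgoing_orbits_agree:
  assumes "AE x in \<nu>. x \<in> \<Omega> \<longrightarrow> (\<forall>s. on_orbit x s \<longrightarrow> P (\<Phi> x s))"
  shows "AE y in \<mu>p. \<forall>r. 0 < r \<and> ereal r < \<tau>m y \<longrightarrow> P (\<Phi> y (- r))"
proof (rule flow_with_boundary.incoming_orbits_agree[OF boundary_reversed, unfolded tau_reversed])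
  show "AE x in \<nu>. x \<in> \<Omega> \<longrightarrow> (\<forall>s. - \<tau>p x < ereal s \<and> ereal s < \<tau>m x \<longrightarrow> P (\<Phi> x (- s)))"
    using assms
  proof eventually_elim
    case (elim x)
    show ?case
    proof (intro impI allI)
      fix s assume "x \<in> \<Omega>" "- \<tau>p x < ereal s \<and> ereal s < \<tau>m x"
      moreover from this have "- \<tau>m x < ereal (- s) \<and> ereal (- s) < \<tau>p x"
        by (cases "\<tau>p x"; cases "\<tau>m x") auto
      ultimately show "P (\<Phi> x (- s))" using elim by blast
    qed
  qed
qed

end

text \<open>The data \<open>g0\<close>, \<open>u0\<close> of the problem together with Borel representatives \<open>g\<close>, \<open>u\<close>, and the function
  \<open>f\<close> that the solution formula assigns to \<open>g0\<close> and \<open>u0\<close>.\<close>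

locale bvp_data = transport_data \<Phi> \<Omega> \<nu> \<mu>m \<mu>p lam g u
  for \<Phi> :: "'a::euclidean_space \<Rightarrow> real \<Rightarrow> 'a" and \<Omega> :: "'a set" and \<nu> \<mu>m \<mu>p :: "'a measure"
    and lam :: real and g u :: "'a \<Rightarrow> real" +
  fixes \<mu> :: "'a measure" and f g0 u0 :: "'a \<Rightarrow> real"
  assumes \<mu>: "\<mu> = \<nu> \<or> \<mu> = completion \<nu>"
    and g0_integrable: "set_integrable \<mu> \<Omega> g0"
    and g0_eq: "AE x in \<nu>. x \<in> \<Omega> \<longrightarrow> g0 x = g x"
    and g0_eq_borel: "\<mu> = \<nu> \<Longrightarrow> x \<in> \<Omega> \<Longrightarrow> g0 x = g x"
    and u0_integrable: "integrable \<mu>m u0"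
    and u0_eq: "\<And>y. y \<in> Gamma_m \<Phi> \<Omega> \<Longrightarrow> u0 y = u y"
    and f_formula: "\<And>x. x \<in> \<Omega> \<Longrightarrow> f x =
        (LINT t:{t. 0 < t \<and> ereal t < tau_m \<Phi> \<Omega> x}|lebesgue. exp (- lam * t) * g0 (\<Phi> x (- t))) +
        (if tau_m \<Phi> \<Omega> x < \<infinity>
         then exp (- lam * real_of_ereal (tau_m \<Phi> \<Omega> x)) * u0 (entry_point \<Phi> \<Omega> x) else 0)"
begin

lemma f_eq_R_at:
  assumes x: "x \<in> \<Omega>" and eq: "AE t in lborel. 0 < t \<and> ereal t < \<tau>m x \<longrightarrow> g0 (\<Phi> x (- t)) = g (\<Phi> x (- t))"
  shows "f x = R x"
proof -
  have "(LINT t:behind x|lebesgue. exp (- lam * t) * g0 (\<Phi> x (- t))) =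
      (LINT t:behind x|lborel. exp (- lam * t) * g (\<Phi> x (- t)))"
  proof (rule lebesgue_integral_of_borel)
    show "AE t in lborel. t \<in> (behind x) \<longrightarrow> exp (- lam * t) * g0 (\<Phi> x (- t)) = exp (- lam * t) * g (\<Phi> x (- t))"
      using eq by eventually_elim auto
  qed measurable
  moreover have "u0 (entry_point \<Phi> \<Omega> x) = u (entry_point \<Phi> \<Omega> x)" if "\<tau>m x < \<infinity>"
    using u0_eq from_entry_point[OF x that] by metis
  ultimately show ?thesis
    unfolding f_formula[OF x] resolvent_def by auto
qed

text \<open>Almost every orbit meets the set where \<open>g0\<close> and \<open>g\<close> differ only in a null set of times; on such an orbit the
  two formulas agree at every point.\<close>

lemma AE_f_eq_R_orbit:
  "AE x in \<nu>. x \<in> \<Omega> \<longrightarrow> (\<forall>s. on_orbit x s \<longrightarrow> f (\<Phi> x s) = R (\<Phi> x s))"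
  using AE_along_orbits[OF g0_eq]
proof eventually_elim
  case (elim x)
  show ?case
  proof (intro impI allI)
    fix s assume x: "x \<in> \<Omega>" and s: "on_orbit x s"
    show "f (\<Phi> x s) = R (\<Phi> x s)"
    proof (rule f_eq_R_at)
      show "\<Phi> x s \<in> \<Omega>" using orbit_shift(1)[OF x] s by blast
      have "AE t in lborel. \<Phi> x (s + (-1) * t) \<in> \<Omega> \<longrightarrow> g0 (\<Phi> x (s + (-1) * t)) = g (\<Phi> x (s + (-1) * t))"
        by (rule AE_lborel_affine[OF _ elim]) simp
      then show "AE t in lborel. 0 < t \<and> ereal t < \<tau>m (\<Phi> x s) \<longrightarrow> g0 (\<Phi> (\<Phi> x s) (- t)) = g (\<Phi> (\<Phi> x s) (- t))"
      proof eventually_elim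
        case (elim t)
        then show ?case using before_tau_m[of t "\<Phi> x s"] by auto
      qed
    qed
  qed
qed

lemma f_eq_R: "AE x in \<nu>. x \<in> \<Omega> \<longrightarrow> f x = R x" "\<mu> = \<nu> \<Longrightarrow> x \<in> \<Omega> \<Longrightarrow> f x = R x"
proof -
  show "AE x in \<nu>. x \<in> \<Omega> \<longrightarrow> f x = R x"
    using AE_f_eq_R_orbit
  proof eventually_elim
    case (elim x)
    show ?case
    proof
      assume x: "x \<in> \<Omega>"
      show "f x = R x" using elim x zero_in_orbit_interval[OF x] by (metis flow_zero)
    qed
  qed
  show "f x = R x" if "\<mu> = \<nu>" "x \<in> \<Omega>"
    using g0_eq_borel[OF that(1)] before_tau_m[of _ x] by (intro f_eq_R_at that(2) AE_I2) auto
qed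

lemma f_measurable: "set_borel_measurable \<mu> \<Omega> f"
  by (rule measurable_of_representative[OF \<mu> resolvent_measurable f_eq_R]) auto

lemma g0_measurable: "set_borel_measurable \<mu> \<Omega> g0"
  using g0_integrable by (auto simp: set_integrable_def set_borel_measurable_def)

lemma R_meas: "R \<in> borel_measurable borel" by measurable

lemma f_integrable: "set_integrable \<mu> \<Omega> f"
  using set_integral_of_representative(1)[OF \<mu> R_meas f_measurable f_eq_R(1)] R_integrable by simp

lemma f_weak_transport: "weak_transport \<mu> \<Phi> \<Omega> f (\<lambda>x. lam * f x - g0 x)"
  unfolding weak_transport_def
proof (intro conjI ballI f_integrable)
  show "set_integrable \<mu> \<Omega> (\<lambda>x. lam * f x - g0 x)"
    using f_integrable g0_integrable by (intro set_integral_diff) auto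
  fix \<psi> assume \<psi>: "\<psi> \<in> test_functions \<mu> \<Phi> \<Omega>"
  have "bounded (\<psi> ` \<Omega>)" "bounded (flow_deriv \<Phi> \<psi> ` \<Omega>)"
    using \<psi> by (auto simp: test_functions_def)
  then obtain M M' where "\<And>z. z \<in> \<Omega> \<Longrightarrow> \<bar>\<psi> z\<bar> \<le> M" "\<And>z. z \<in> \<Omega> \<Longrightarrow> \<bar>flow_deriv \<Phi> \<psi> z\<bar> \<le> M'"
    unfolding bounded_iff by auto
  then obtain C where C: "0 \<le> C" "\<And>z. z \<in> \<Omega> \<Longrightarrow> \<bar>\<psi> z\<bar> \<le> C" "\<And>z. z \<in> \<Omega> \<Longrightarrow> \<bar>flow_deriv \<Phi> \<psi> z\<bar> \<le> C"
    using that[of "max 0 (max M M')"] by (auto simp: le_max_iff_disj)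
  \<comment> \<open>A representative inherits the bounds only almost everywhere, so it is truncated.\<close>
  have clipped: "\<exists>p\<in>borel_measurable borel. (\<forall>x. \<bar>p x\<bar> \<le> C) \<and> (AE x in \<nu>. x \<in> \<Omega> \<longrightarrow> h x = p x)"
    if h: "set_borel_measurable \<mu> \<Omega> h" "\<And>z. z \<in> \<Omega> \<Longrightarrow> \<bar>h z\<bar> \<le> C" for h
  proof -
    obtain q where [measurable]: "q \<in> borel_measurable borel" and q: "AE x in \<nu>. x \<in> \<Omega> \<longrightarrow> h x = q x"
      using borel_representative[OF \<mu> h(1)] by metis
    have "AE x in \<nu>. x \<in> \<Omega> \<longrightarrow> h x = max (- C) (min C (q x))"
      using q
    proof eventually_elim
      case (elim x)
      then show ?case using h(2)[of x] by auto
    qed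
    moreover have "\<bar>max (- C) (min C (q x))\<bar> \<le> C" for x using C(1) by auto
    ultimately show ?thesis by (intro bexI[of _ "\<lambda>x. max (- C) (min C (q x))"]) auto
  qed
  have meas: "set_borel_measurable \<mu> \<Omega> \<psi>" "set_borel_measurable \<mu> \<Omega> (flow_deriv \<Phi> \<psi>)"
    using \<psi> by (auto simp: test_functions_def)
  obtain p where p [measurable]: "p \<in> borel_measurable borel" and p_bd: "\<And>x. \<bar>p x\<bar> \<le> C"
    and p_eq: "AE x in \<nu>. x \<in> \<Omega> \<longrightarrow> \<psi> x = p x" using clipped[OF meas(1) C(2)] by blast
  obtain d where d [measurable]: "d \<in> borel_measurable borel" and d_bd: "\<And>x. \<bar>d x\<bar> \<le> C"
    and d_eq: "AE x in \<nu>. x \<in> \<Omega> \<longrightarrow> flow_deriv \<Phi> \<psi> x = d x" using clipped[OF meas(2) C(3)] by blast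
  have prod_meas: "set_borel_measurable \<mu> \<Omega> (\<lambda>x. h x * k x)"
    if "set_borel_measurable \<mu> \<Omega> h" "set_borel_measurable \<mu> \<Omega> k" for h k :: "'a \<Rightarrow> real"
  proof -
    have "(\<lambda>x. (indicator \<Omega> x *\<^sub>R h x) * (indicator \<Omega> x *\<^sub>R k x)) \<in> borel_measurable \<mu>"
      using that unfolding set_borel_measurable_def by (rule borel_measurable_times)
    then show ?thesis
      unfolding set_borel_measurable_def by (rule measurable_cong[THEN iffD1, rotated]) (auto split: split_indicator)
  qed
  have lin_meas: "set_borel_measurable \<mu> \<Omega> (\<lambda>x. lam * f x - g0 x)"
    using \<open>set_integrable \<mu> \<Omega> (\<lambda>x. lam * f x - g0 x)\<close> by (auto simp: set_integrable_def set_borel_measurable_def)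
  have "(LINT x:\<Omega>|\<mu>. (lam * f x - g0 x) * \<psi> x) = (LINT x:\<Omega>|\<nu>. (lam * R x - g x) * p x)"
  proof (rule set_integral_of_representative(2)[OF \<mu> _ prod_meas[OF lin_meas meas(1)]])
    show "AE x in \<nu>. x \<in> \<Omega> \<longrightarrow> (lam * f x - g0 x) * \<psi> x = (lam * R x - g x) * p x"
      using f_eq_R(1) g0_eq p_eq by eventually_elim auto
  qed measurable
  also have "\<dots> = (LINT x:\<Omega>|\<nu>. R x * d x)"
    by (rule resolvent_equation_weak[OF \<mu> \<psi> p p_bd p_eq d d_bd d_eq])
  also have "\<dots> = (LINT x:\<Omega>|\<mu>. f x * flow_deriv \<Phi> \<psi> x)"
  proof (rule set_integral_of_representative(2)[OF \<mu> _ prod_meas[OF f_measurable meas(2)], symmetric])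
    show "AE x in \<nu>. x \<in> \<Omega> \<longrightarrow> f x * flow_deriv \<Phi> \<psi> x = R x * d x"
      using f_eq_R(1) d_eq by eventually_elim auto
  qed measurable
  finally show "(LINT x:\<Omega>|\<mu>. (lam * f x - g0 x) * \<psi> x) = (LINT x:\<Omega>|\<mu>. f x * flow_deriv \<Phi> \<psi> x)" .
qed

lemma f_in_domain: "f \<in> dom_Tmax \<mu> \<Phi> \<Omega>"
  using f_weak_transport by (auto simp: dom_Tmax_def)

lemma Tmax_f: "AE x in \<nu>. x \<in> \<Omega> \<longrightarrow> Tmax \<mu> \<Phi> \<Omega> f x = lam * f x - g0 x"
proof (rule weak_transport_unique[OF \<mu> _ f_weak_transport])
  show "weak_transport \<mu> \<Phi> \<Omega> f (Tmax \<mu> \<Phi> \<Omega> f)"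
    unfolding Tmax_def by (rule someI[of "weak_transport \<mu> \<Phi> \<Omega> f"]) (rule f_weak_transport)
qed

lemma f_sharp: "sharp_rep \<mu> \<Phi> \<Omega> f f"
  unfolding sharp_rep_def AE_of_completion[OF \<mu>]
proof (intro conjI f_integrable)
  have T: "AE x in \<nu>. x \<in> \<Omega> \<longrightarrow> Tmax \<mu> \<Phi> \<Omega> f x = lam * R x - g x"
    using Tmax_f f_eq_R(1) g0_eq by eventually_elim auto
  show "AE x in \<nu>. x \<in> \<Omega> \<longrightarrow> (\<forall>t1 t2. - \<tau>m x < ereal t1 \<and> t1 \<le> t2 \<and> ereal t2 < \<tau>p x \<longrightarrow>
      f (\<Phi> x t1) - f (\<Phi> x t2) = (LINT s:{t1..t2}|lebesgue. Tmax \<mu> \<Phi> \<Omega> f (\<Phi> x s)))"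
    using AE_f_eq_R_orbit AE_good_orbit AE_along_orbits[OF T]
  proof eventually_elim
    case (elim x)
    show ?case
    proof (intro impI allI)
      fix t1 t2 assume x: "x \<in> \<Omega>" and t: "- \<tau>m x < ereal t1 \<and> t1 \<le> t2 \<and> ereal t2 < \<tau>p x"
      have I: "on_orbit x s" if "t1 \<le> s" "s \<le> t2" for s
        using t that by (meson ereal_less_eq(3) less_le_trans le_less_trans)
      have "(LINT s:{t1..t2}|lebesgue. Tmax \<mu> \<Phi> \<Omega> f (\<Phi> x s)) = (LINT s:{t1..t2}|lborel. lam * R (\<Phi> x s) - g (\<Phi> x s))"
      proof (rule lebesgue_integral_of_borel)
        show "AE s in lborel. s \<in> {t1..t2} \<longrightarrow> Tmax \<mu> \<Phi> \<Omega> f (\<Phi> x s) = lam * R (\<Phi> x s) - g (\<Phi> x s)"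
          using elim(3) by eventually_elim (use I orbit_shift(1)[OF x] in auto)
      qed measurable
      also have "\<dots> = R (\<Phi> x t1) - R (\<Phi> x t2)"
        using elim(2) x t by (intro resolvent_integrated_equation(3)[OF lam_pos g_measurable x]) auto
      finally show "f (\<Phi> x t1) - f (\<Phi> x t2) = (LINT s:{t1..t2}|lebesgue. Tmax \<mu> \<Phi> \<Omega> f (\<Phi> x s))"
        using elim(1) x I[of t1] I[of t2] t by auto
    qed
  qed
qed simp

lemma tau_pos_limit_eventually:
  assumes "0 < c" "\<And>r. 0 < r \<Longrightarrow> ereal r < c \<Longrightarrow> F r = (G r :: real)"
  shows "eventually (\<lambda>r. F r = G r) (at_right 0)"
proof -
  obtain b where b: "0 < ereal b" "ereal b < c" using assms(1) by (metis ereal_dense2)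
  have "F r = G r" if "0 < r" "r < b" for r
  proof (rule assms(2)[OF that(1)])
    show "ereal r < c" using that(2) b(2) by (meson less_ereal.simps(1) less_trans)
  qed
  then show ?thesis using b by (intro eventually_at_rightI[of 0 b]) auto
qed

lemma AE_incoming_limit: "AE y in \<mu>m. ((\<lambda>r. R (\<Phi> y r)) \<longlongrightarrow> u y) (at_right 0)"
  using AE_incoming_orbits_ex[OF AE_past_integrable] AE_space
  by eventually_elim (auto simp: space_\<mu>m intro: resolvent_incoming_limit)

lemma AE_outgoing_limit: "AE y in \<mu>p. ((\<lambda>r. R (\<Phi> y (- r))) \<longlongrightarrow> R y) (at_right 0)"
  using AE_past_integrable_outgoing AE_space
  by eventually_elim (auto simp: space_\<mu>p Gamma_p_eq intro: resolvent_outgoing_limit)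

lemma f_trace_m: "trace_m \<mu> \<Phi> \<Omega> \<mu>m f u0"
  unfolding trace_m_def
proof (intro conjI exI[of _ f] f_in_domain f_sharp)
  show "u0 \<in> borel_measurable \<mu>m" using u0_integrable by auto
  show "AE y in \<mu>m. ((\<lambda>t. f (\<Phi> y t)) \<longlongrightarrow> u0 y) (at_right 0)"
    using incoming_orbits_agree[OF AE_f_eq_R_orbit] AE_incoming_limit AE_space
  proof eventually_elim
    case (elim y)
    then have y: "y \<in> Gamma_m \<Phi> \<Omega>" "0 < \<tau>p y" by (auto simp: space_\<mu>m Gamma_m_eq)
    have "eventually (\<lambda>r. f (\<Phi> y r) = R (\<Phi> y r)) (at_right 0)"
      using elim(1) by (intro tau_pos_limit_eventually[OF y(2)]) auto
    then show ?case using elim(2) u0_eq[OF y(1)] by (simp add: tendsto_cong)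
  qed
qed

lemma f_solves: "solves_bvp \<mu> \<Phi> \<Omega> \<mu>m lam g0 u0 f"
  unfolding solves_bvp_def AE_of_completion[OF \<mu>]
proof (intro conjI f_in_domain f_trace_m)
  show "AE x in \<nu>. x \<in> \<Omega> \<longrightarrow> lam * f x - Tmax \<mu> \<Phi> \<Omega> f x = g0 x"
    using Tmax_f by eventually_elim auto
qed

lemma trace_p_R: "trace_p \<mu> \<Phi> \<Omega> \<mu>p f R"
  unfolding trace_p_def
proof (intro conjI exI[of _ f] f_in_domain f_sharp)
  show "R \<in> borel_measurable \<mu>p" by (rule measurable_\<mu>p[OF R_meas])
  show "AE y in \<mu>p. ((\<lambda>t. f (\<Phi> y (- t))) \<longlongrightarrow> R y) (at_right 0)"
    using outgoing_orbits_agree[OF AE_f_eq_R_orbit] AE_outgoing_limit AE_space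
  proof eventually_elim
    case (elim y)
    then have y: "0 < \<tau>m y" by (auto simp: space_\<mu>p Gamma_p_eq)
    have "eventually (\<lambda>r. f (\<Phi> y (- r)) = R (\<Phi> y (- r))) (at_right 0)"
      using elim(1) by (intro tau_pos_limit_eventually[OF y]) auto
    then show ?case using elim(2) by (simp add: tendsto_cong)
  qed
qed

text \<open>Two representatives have the same increments along almost every orbit, and they agree at some point of it.\<close>

lemma sharp_rep_f_unique:
  assumes fs: "sharp_rep \<mu> \<Phi> \<Omega> f fs"
  shows "AE x in \<nu>. x \<in> \<Omega> \<longrightarrow> (\<forall>s. on_orbit x s \<longrightarrow> fs (\<Phi> x s) = R (\<Phi> x s))"
proof -
  have eq: "AE x in \<nu>. x \<in> \<Omega> \<longrightarrow> fs x = f x"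
    and incr: "AE x in \<nu>. x \<in> \<Omega> \<longrightarrow> (\<forall>t1 t2. - \<tau>m x < ereal t1 \<and> t1 \<le> t2 \<and> ereal t2 < \<tau>p x \<longrightarrow>
      fs (\<Phi> x t1) - fs (\<Phi> x t2) = (LINT s:{t1..t2}|lebesgue. Tmax \<mu> \<Phi> \<Omega> f (\<Phi> x s)))"
    and incr_f: "AE x in \<nu>. x \<in> \<Omega> \<longrightarrow> (\<forall>t1 t2. - \<tau>m x < ereal t1 \<and> t1 \<le> t2 \<and> ereal t2 < \<tau>p x \<longrightarrow>
      f (\<Phi> x t1) - f (\<Phi> x t2) = (LINT s:{t1..t2}|lebesgue. Tmax \<mu> \<Phi> \<Omega> f (\<Phi> x s)))"
    using fs f_sharp unfolding sharp_rep_def AE_of_completion[OF \<mu>] by auto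
  show ?thesis
    using AE_along_orbits[OF eq] incr incr_f AE_f_eq_R_orbit
  proof eventually_elim
    case (elim x)
    show ?case
    proof
      assume x: "x \<in> \<Omega>"
      let ?I = "\<lambda>s. on_orbit x s"
      obtain c where c: "0 < c" "ereal c < \<tau>p x" using tau_p_pos[OF x] by (metis ereal_dense2 ereal_less(2))
      have I: "?I s" if "0 < s" "s < c" for s
      proof
        show "ereal s < \<tau>p x" using that(2) c(2) by (meson less_ereal.simps(1) less_trans)
        show "- \<tau>m x < ereal s" using tau_m_pos[OF x] that(1) by (cases "\<tau>m x") auto
      qed
      obtain s0 where "0 < s0" "s0 < c" "\<Phi> x s0 \<in> \<Omega> \<longrightarrow> fs (\<Phi> x s0) = f (\<Phi> x s0)"
        using AE_lborel_ex_between[OF elim(1) c(1)] by blast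
      then have s0: "?I s0" "fs (\<Phi> x s0) = f (\<Phi> x s0)"
        using I[of s0] orbit_shift(1)[OF x] by blast+
      show "\<forall>s. ?I s \<longrightarrow> fs (\<Phi> x s) = R (\<Phi> x s)"
      proof (intro allI impI)
        fix s assume s: "?I s"
        have same: "fs (\<Phi> x t1) - fs (\<Phi> x t2) = f (\<Phi> x t1) - f (\<Phi> x t2)" if "?I t1" "?I t2" "t1 \<le> t2" for t1 t2
          using elim(2,3) x that by auto
        have "fs (\<Phi> x s) = f (\<Phi> x s)"
          using same[OF s s0(1)] same[OF s0(1) s] s0(2) by (cases "s \<le> s0") auto
        then show "fs (\<Phi> x s) = R (\<Phi> x s)" using elim(4) x s by auto
      qed
    qed
  qed
qed

lemma trace_p_unique:
  assumes v: "trace_p \<mu> \<Phi> \<Omega> \<mu>p f v"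
  shows "AE y in \<mu>p. v y = R y"
proof -
  obtain fs where fs: "sharp_rep \<mu> \<Phi> \<Omega> f fs" and lim: "AE y in \<mu>p. ((\<lambda>t. fs (\<Phi> y (- t))) \<longlongrightarrow> v y) (at_right 0)"
    using v by (auto simp: trace_p_def)
  show ?thesis
    using outgoing_orbits_agree[OF sharp_rep_f_unique[OF fs]] AE_outgoing_limit lim AE_space
  proof eventually_elim
    case (elim y)
    then have y: "0 < \<tau>m y" by (auto simp: space_\<mu>p Gamma_p_eq)
    have "eventually (\<lambda>r. fs (\<Phi> y (- r)) = R (\<Phi> y (- r))) (at_right 0)"
      using elim(1) by (intro tau_pos_limit_eventually[OF y]) auto
    then have "((\<lambda>r. fs (\<Phi> y (- r))) \<longlongrightarrow> R y) (at_right 0)"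
      using elim(2) by (simp add: tendsto_cong)
    then show ?case using elim(3) tendsto_unique[OF trivial_limit_at_right_real] by blast
  qed
qed

lemma trace_p_estimates:
  assumes v: "trace_p \<mu> \<Phi> \<Omega> \<mu>p f v"
  shows "integrable \<mu>p v"
    and "(LINT y|\<mu>p. \<bar>v y\<bar>) + lam * (LINT x:\<Omega>|\<mu>. \<bar>f x\<bar>) \<le> (LINT y|\<mu>m. \<bar>u0 y\<bar>) + (LINT x:\<Omega>|\<mu>. \<bar>g0 x\<bar>)"
    and "(AE x\<in>\<Omega> in \<mu>. 0 \<le> g0 x) \<and> (AE y in \<mu>m. 0 \<le> u0 y) \<longrightarrow>
      (LINT y|\<mu>p. \<bar>v y\<bar>) + lam * (LINT x:\<Omega>|\<mu>. \<bar>f x\<bar>) = (LINT y|\<mu>m. \<bar>u0 y\<bar>) + (LINT x:\<Omega>|\<mu>. \<bar>g0 x\<bar>)"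
proof -
  have v_meas: "v \<in> borel_measurable \<mu>p" using v by (simp add: trace_p_def)
  have R_p: "R \<in> borel_measurable \<mu>p" by (rule measurable_\<mu>p[OF R_meas])
  show "integrable \<mu>p v"
    using integrable_cong_AE[OF v_meas R_p trace_p_unique[OF v]] R_integrable_outgoing by simp
  have abs_v: "(LINT y|\<mu>p. \<bar>v y\<bar>) = (LINT y|\<mu>p. \<bar>R y\<bar>)"
  proof (rule integral_cong_AE)
    show "AE y in \<mu>p. \<bar>v y\<bar> = \<bar>R y\<bar>" using trace_p_unique[OF v] by eventually_elim simp
  qed (use v_meas R_p in auto)
  have abs_meas: "set_borel_measurable \<mu> \<Omega> (\<lambda>x. \<bar>h x\<bar>)" if "set_borel_measurable \<mu> \<Omega> h" for h :: "'a \<Rightarrow> real"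
  proof -
    have "(\<lambda>x. \<bar>indicator \<Omega> x *\<^sub>R h x\<bar>) \<in> borel_measurable \<mu>"
      using that unfolding set_borel_measurable_def by (rule borel_measurable_abs)
    then show ?thesis
      unfolding set_borel_measurable_def by (rule measurable_cong[THEN iffD1, rotated]) (auto split: split_indicator)
  qed
  have abs_f: "(LINT x:\<Omega>|\<mu>. \<bar>f x\<bar>) = (LINT x:\<Omega>|\<nu>. \<bar>R x\<bar>)"
  proof (rule set_integral_of_representative(2)[OF \<mu> _ abs_meas[OF f_measurable]])
    show "AE x in \<nu>. x \<in> \<Omega> \<longrightarrow> \<bar>f x\<bar> = \<bar>R x\<bar>" using f_eq_R(1) by eventually_elim auto
  qed measurable
  have abs_g: "(LINT x:\<Omega>|\<mu>. \<bar>g0 x\<bar>) = (LINT x:\<Omega>|\<nu>. \<bar>g x\<bar>)"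
  proof (rule set_integral_of_representative(2)[OF \<mu> _ abs_meas[OF g0_measurable]])
    show "AE x in \<nu>. x \<in> \<Omega> \<longrightarrow> \<bar>g0 x\<bar> = \<bar>g x\<bar>" using g0_eq by eventually_elim auto
  qed measurable
  have abs_u: "(LINT y|\<mu>m. \<bar>u0 y\<bar>) = (LINT y|\<mu>m. \<bar>u y\<bar>)"
    using u0_eq by (intro Bochner_Integration.integral_cong) (auto simp: space_\<mu>m)
  show "(LINT y|\<mu>p. \<bar>v y\<bar>) + lam * (LINT x:\<Omega>|\<mu>. \<bar>f x\<bar>) \<le> (LINT y|\<mu>m. \<bar>u0 y\<bar>) + (LINT x:\<Omega>|\<mu>. \<bar>g0 x\<bar>)"
    unfolding abs_v abs_f abs_g abs_u by (rule norm_estimate)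
  show "(AE x\<in>\<Omega> in \<mu>. 0 \<le> g0 x) \<and> (AE y in \<mu>m. 0 \<le> u0 y) \<longrightarrow>
      (LINT y|\<mu>p. \<bar>v y\<bar>) + lam * (LINT x:\<Omega>|\<mu>. \<bar>f x\<bar>) = (LINT y|\<mu>m. \<bar>u0 y\<bar>) + (LINT x:\<Omega>|\<mu>. \<bar>g0 x\<bar>)"
    unfolding abs_v abs_f abs_g abs_u AE_of_completion[OF \<mu>]
  proof (intro impI, elim conjE)
    assume g_pos: "AE x\<in>\<Omega> in \<nu>. 0 \<le> g0 x" and u_pos: "AE y in \<mu>m. 0 \<le> u0 y"
    show "(LINT y|\<mu>p. \<bar>R y\<bar>) + lam * (LINT x:\<Omega>|\<nu>. \<bar>R x\<bar>) = (LINT y|\<mu>m. \<bar>u y\<bar>) + (LINT x:\<Omega>|\<nu>. \<bar>g x\<bar>)"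
    proof (rule norm_equality)
      show "AE x in \<nu>. x \<in> \<Omega> \<longrightarrow> 0 \<le> g x" using g_pos g0_eq by eventually_elim auto
      show "AE y in \<mu>m. 0 \<le> u y" using u_pos AE_space by eventually_elim (auto simp: space_\<mu>m u0_eq)
    qed
  qed
qed

subsection \<open>Uniqueness\<close>

text \<open>The difference of two solutions decays like \<open>exp (- lam s)\<close> along almost every orbit. Followed
  backwards it must match the vanishing boundary value, or, on orbits without a starting point, grow
  in a way that integrability excludes.\<close>

lemma solution_unique:
  assumes h: "solves_bvp \<mu> \<Phi> \<Omega> \<mu>m lam g0 u0 h"
  shows "AE x in \<nu>. x \<in> \<Omega> \<longrightarrow> h x = f x"
proof -
  let ?T = "Tmax \<mu> \<Phi> \<Omega> h"
  obtain fs where fs: "sharp_rep \<mu> \<Phi> \<Omega> h fs" and lim: "AE y in \<mu>m. ((\<lambda>t. fs (\<Phi> y t)) \<longlongrightarrow> u0 y) (at_right 0)"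
    using h by (auto simp: solves_bvp_def trace_m_def)
  have eqn: "AE x in \<nu>. x \<in> \<Omega> \<longrightarrow> lam * h x - ?T x = g0 x"
    using h unfolding solves_bvp_def AE_of_completion[OF \<mu>] by blast
  have fs_int: "set_integrable \<mu> \<Omega> fs" and fs_h: "AE x in \<nu>. x \<in> \<Omega> \<longrightarrow> fs x = h x"
    and incr: "AE x in \<nu>. x \<in> \<Omega> \<longrightarrow> (\<forall>t1 t2. - \<tau>m x < ereal t1 \<and> t1 \<le> t2 \<and> ereal t2 < \<tau>p x \<longrightarrow>
      fs (\<Phi> x t1) - fs (\<Phi> x t2) = (LINT s:{t1..t2}|lebesgue. ?T (\<Phi> x s)))"
    using fs unfolding sharp_rep_def AE_of_completion[OF \<mu>] by auto
  have fs_meas: "set_borel_measurable \<mu> \<Omega> fs"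
    using fs_int by (auto simp: set_integrable_def set_borel_measurable_def)
  obtain q where q [measurable]: "q \<in> borel_measurable borel" and fs_q: "AE x in \<nu>. x \<in> \<Omega> \<longrightarrow> fs x = q x"
    using borel_representative[OF \<mu> fs_meas] by metis
  have q_int: "set_integrable \<nu> \<Omega> q"
    using set_integral_of_representative(1)[OF \<mu> q fs_meas fs_q] fs_int by simp
  define E where "E x = q x - R x" for x
  have E_meas [measurable]: "E \<in> borel_measurable borel" unfolding E_def[abs_def] by measurable
  \<comment> \<open>Taken as data, \<open>E\<close> is integrable over the past of almost every orbit.\<close>
  interpret E: transport_data \<Phi> \<Omega> \<nu> \<mu>m \<mu>p lam E "\<lambda>_. 0"
    by unfold_locales (use lam_pos set_integral_diff(1)[OF q_int R_integrable] in \<open>auto simp: E_def[abs_def]\<close>)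
  have both: "AE x in \<nu>. x \<in> \<Omega> \<longrightarrow> fs x = q x \<and> ?T x = lam * q x - g x"
    using fs_q fs_h eqn g0_eq by eventually_elim auto
  have boundary: "AE x in \<nu>. x \<in> \<Omega> \<and> \<tau>m x < \<infinity> \<longrightarrow>
      ((\<lambda>r. fs (\<Phi> (entry_point \<Phi> \<Omega> x) r) - R (\<Phi> (entry_point \<Phi> \<Omega> x) r)) \<longlongrightarrow> 0) (at_right 0)"
  proof (rule AE_entry_point)
    show "AE y in \<mu>m. ((\<lambda>r. fs (\<Phi> y r) - R (\<Phi> y r)) \<longlongrightarrow> 0) (at_right 0)"
      using lim AE_incoming_limit AE_space
    proof eventually_elim
      case (elim y)
      have "u0 y = u y" using elim(3) u0_eq by (simp add: space_\<mu>m)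
      then show ?case using tendsto_diff[OF elim(1,2)] by simp
    qed
  qed
  have "AE x in \<nu>. x \<in> \<Omega> \<longrightarrow> fs x = R x"
    using incr AE_good_orbit E.AE_good_orbit AE_along_orbits[OF both] boundary
  proof eventually_elim
    case (elim x)
    show ?case
    proof
      assume x: "x \<in> \<Omega>"
      let ?I = "\<lambda>s. on_orbit x s"
      define D where "D s = fs (\<Phi> x s) - R (\<Phi> x s)" for s
      have I0: "?I 0" by (rule zero_in_orbit_interval[OF x])
      have between: "?I s" if "?I a" "?I b" "a \<le> s" "s \<le> b" for a b s
        using that by (meson ereal_less_eq(3) less_le_trans le_less_trans)
      have E_D: "AE s in lborel. ?I s \<longrightarrow> E (\<Phi> x s) = D s"
        using elim(4) by eventually_elim (use orbit_shift(1)[OF x] in \<open>auto simp: E_def D_def\<close>)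
      have D_incr: "D a - D s = (LINT r:{a..s}|lborel. lam * E (\<Phi> x r))" if "?I a" "?I s" "a \<le> s" for a s
      proof -
        note ab = conjunct1[OF that(1)] that(3) conjunct2[OF that(2)]
        have good: "good_orbit lam g x" "good_orbit lam E x" using elim(2,3) x by auto
        have i: "set_integrable lborel {a..s} (\<lambda>r. g (\<Phi> x r))" "set_integrable lborel {a..s} (\<lambda>r. R (\<Phi> x r))"
          "set_integrable lborel {a..s} (\<lambda>r. E (\<Phi> x r))"
          using resolvent_integrated_equation(1,2)[OF lam_pos g_measurable x good(1) ab]
            resolvent_integrated_equation(1)[OF lam_pos E_meas x good(2) ab] by auto
        have "fs (\<Phi> x a) - fs (\<Phi> x s) = (LINT r:{a..s}|lebesgue. ?T (\<Phi> x r))"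
          using elim(1) x ab by blast
        also have "\<dots> = (LINT r:{a..s}|lborel. lam * q (\<Phi> x r) - g (\<Phi> x r))"
        proof (rule lebesgue_integral_of_borel)
          show "AE r in lborel. r \<in> {a..s} \<longrightarrow> ?T (\<Phi> x r) = lam * q (\<Phi> x r) - g (\<Phi> x r)"
            using elim(4) by eventually_elim (use between[OF that(1,2)] orbit_shift(1)[OF x] in auto)
        qed measurable
        also have "\<dots> = (LINT r:{a..s}|lborel. lam * E (\<Phi> x r) + (lam * R (\<Phi> x r) - g (\<Phi> x r)))"
          by (simp add: E_def right_diff_distrib)
        also have "\<dots> = (LINT r:{a..s}|lborel. lam * E (\<Phi> x r)) + (LINT r:{a..s}|lborel. lam * R (\<Phi> x r) - g (\<Phi> x r))"
          using i by (intro set_integral_add set_integral_diff) auto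
        also have "(LINT r:{a..s}|lborel. lam * R (\<Phi> x r) - g (\<Phi> x r)) = R (\<Phi> x a) - R (\<Phi> x s)"
          by (rule resolvent_integrated_equation(3)[OF lam_pos g_measurable x good(1) ab])
        finally show ?thesis by (simp add: D_def)
      qed
      have decay: "D b = exp (- lam * (b - a)) * D a" if "?I a" "?I b" "a \<le> b" for a b
      proof (rule homogeneous_equation_solution[OF that(3)])
        show "set_integrable lborel {a..b} (\<lambda>r. E (\<Phi> x r))"
          using elim(3) x that by (intro resolvent_integrated_equation(1)[OF lam_pos E_meas x]) auto
        show "AE s in lborel. a \<le> s \<and> s \<le> b \<longrightarrow> E (\<Phi> x s) = D s"
          using E_D by eventually_elim (use between[OF that(1,2)] in auto)
        show "D a - D s = (LINT r:{a..s}|lborel. lam * E (\<Phi> x r))" if "a \<le> s" "s \<le> b" for s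
          using D_incr[OF \<open>?I a\<close> between[OF \<open>?I a\<close> \<open>?I b\<close> that] that(1)] .
      qed
      have "D 0 = 0"
      proof (cases "\<tau>m x < \<infinity>")
        case True
        then obtain c where c: "\<tau>m x = ereal c" "0 < c" using tau_m_pos[OF x] by (cases "\<tau>m x") auto
        have "entry_point \<Phi> \<Omega> x = \<Phi> x (- c)" by (simp add: entry_point_def c)
        then have "((\<lambda>r. fs (\<Phi> (\<Phi> x (- c)) r) - R (\<Phi> (\<Phi> x (- c)) r)) \<longlongrightarrow> 0) (at_right 0)"
          using elim(5) x True by simp
        then have lim0: "((\<lambda>r. D (r - c)) \<longlongrightarrow> 0) (at_right 0)" by (simp add: D_def)
        have "((\<lambda>r. exp (- lam * (c - r)) * D (r - c)) \<longlongrightarrow> exp (- lam * (c - 0)) * 0) (at_right 0)"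
          by (intro tendsto_intros lim0)
        moreover have "eventually (\<lambda>r. exp (- lam * (c - r)) * D (r - c) = D 0) (at_right 0)"
        proof (rule eventually_at_rightI[of 0 c])
          fix r assume r: "r \<in> {0<..<c}"
          have "?I (r - c)"
          proof
            show "- \<tau>m x < ereal (r - c)" using r c by simp
            have "ereal (r - c) < 0" using r by simp
            then show "ereal (r - c) < \<tau>p x" using tau_p_pos[OF x] by (rule less_trans)
          qed
          from decay[OF this I0] r show "exp (- lam * (c - r)) * D (r - c) = D 0" by simp
        qed (use c in simp)
        ultimately have "((\<lambda>r::real. D 0) \<longlongrightarrow> 0) (at_right 0)"
          by (simp add: tendsto_cong)
        then show ?thesis
          using tendsto_unique[OF trivial_limit_at_right_real tendsto_const] by blast
      next
        case False
        then have inf: "\<tau>m x = \<infinity>" by simp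
        have "past_integrable \<Phi> \<Omega> lam E x"
          using elim(3) x I0 unfolding good_orbit_def by (metis flow_zero)
        then have int: "integrable lborel (\<lambda>t. indicator {0<..} t * (exp (- lam * t) * E (\<Phi> x (- t))))"
          unfolding past_integrable_def set_integrable_def inf by (simp add: greaterThan_def)
        have "AE t in lborel. ?I (0 + (- 1) * t) \<longrightarrow> E (\<Phi> x (0 + (- 1) * t)) = D (0 + (- 1) * t)"
          by (rule AE_lborel_affine[OF _ E_D]) simp
        then have ae: "AE t in lborel. indicator {0<..} t * (exp (- lam * t) * E (\<Phi> x (- t))) = indicator {0<..} t * D 0"
        proof eventually_elim
          case (elim t)
          show ?case
          proof (cases "0 < t")
            case True
            have "ereal (- t) < \<tau>p x" using True tau_p_pos[OF x] by (cases "\<tau>p x") auto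
            then have I: "?I (- t)" using inf by simp
            then show ?thesis using elim decay[OF I I0] True by simp
          qed simp
        qed
        have "integrable lborel (\<lambda>t::real. indicator {0<..} t * D 0)"
          by (rule integrable_cong_AE_imp[OF int _ ae]) measurable
        then show ?thesis by (rule integrable_const_half_line)
      qed
      then show "fs x = R x" by (simp add: D_def)
    qed
  qed
  then show ?thesis using fs_h f_eq_R(1) by eventually_elim auto
qed

end

theorem theorem4p2:
  fixes \<mu> \<mu>p \<mu>m :: "'a::euclidean_space measure"
    and F :: "'a \<Rightarrow> 'a" and \<Phi> :: "'a \<Rightarrow> real \<Rightarrow> 'a" and \<Omega> :: "'a set"
    and lam :: real and u g f :: "'a \<Rightarrow> real"
  assumes "radon_measure \<mu>"
    and "globally_lipschitz F"
    and "is_flow_of \<Phi> F"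
    and "flow_invariant \<mu> \<Phi>"
    and "open \<Omega>"
    and "is_outgoing_measure \<mu> \<Phi> \<Omega> \<mu>p"
    and "is_incoming_measure \<mu> \<Phi> \<Omega> \<mu>m"
    and "lam > 0"
    and "integrable \<mu>m u"
    and "set_integrable \<mu> \<Omega> g"
    and f_eq: "\<And>x. x \<in> \<Omega> \<Longrightarrow> f x =
        (LINT t:{t. 0 < t \<and> ereal t < tau_m \<Phi> \<Omega> x}|lebesgue. exp (- lam * t) * g (\<Phi> x (- t))) +
        (if tau_m \<Phi> \<Omega> x < \<infinity>
         then exp (- lam * real_of_ereal (tau_m \<Phi> \<Omega> x)) *
              u (\<Phi> x (- real_of_ereal (tau_m \<Phi> \<Omega> x)))
         else 0)"
  shows "solves_bvp \<mu> \<Phi> \<Omega> \<mu>m lam g u f \<and>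
    (\<forall>h. solves_bvp \<mu> \<Phi> \<Omega> \<mu>m lam g u h \<longrightarrow> (AE x\<in>\<Omega> in \<mu>. h x = f x)) \<and>
    (\<exists>v. trace_p \<mu> \<Phi> \<Omega> \<mu>p f v) \<and>
    (\<forall>v. trace_p \<mu> \<Phi> \<Omega> \<mu>p f v \<longrightarrow>
       integrable \<mu>p v \<and>
       (LINT y|\<mu>p. \<bar>v y\<bar>) + lam * (LINT x:\<Omega>|\<mu>. \<bar>f x\<bar>) \<le>
         (LINT y|\<mu>m. \<bar>u y\<bar>) + (LINT x:\<Omega>|\<mu>. \<bar>g x\<bar>) \<and>
       ((AE x\<in>\<Omega> in \<mu>. 0 \<le> g x) \<and> (AE y in \<mu>m. 0 \<le> u y) \<longrightarrow>
         (LINT y|\<mu>p. \<bar>v y\<bar>) + lam * (LINT x:\<Omega>|\<mu>. \<bar>f x\<bar>) =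
           (LINT y|\<mu>m. \<bar>u y\<bar>) + (LINT x:\<Omega>|\<mu>. \<bar>g x\<bar>)))"
proof -
  obtain \<nu> where \<nu>: "sets \<nu> = sets borel" "\<mu> = \<nu> \<or> \<mu> = completion \<nu>"
    and finite_\<mu>: "\<And>K. compact K \<Longrightarrow> emeasure \<mu> K < \<infinity>"
    using assms(1) unfolding radon_measure_def by blast
  have borel_\<mu>: "A \<in> sets \<mu>" and emeasure_\<mu>: "emeasure \<mu> A = emeasure \<nu> A" if "A \<in> sets borel" for A
    using \<nu> that by (auto simp: sets_completionI_sets main_part_sets)
  interpret continuous_flow \<Phi> \<Omega>
    using flow_jointly_continuous[OF assms(2,3)] flow_add[OF assms(2,3)] assms(3,5)
    by unfold_locales (auto simp: is_flow_of_def)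
  interpret invariant_flow \<Phi> \<Omega> \<nu>
  proof (intro invariant_flow.intro invariant_flow_axioms.intro continuous_flow_axioms)
    show "sets \<nu> = sets borel" by (rule \<nu>(1))
    show "sigma_finite_measure \<nu>"
    proof (intro sigma_finite_measure.intro exI[of _ "range (\<lambda>n. cball 0 (real n))"] conjI ballI)
      have "x \<in> \<Union> (range (\<lambda>n. cball 0 (real n)))" for x :: 'a
        using real_arch_simple[of "norm x"] by auto
      then show "\<Union> (range (\<lambda>n. cball 0 (real n))) = space \<nu>"
        using sets_eq_imp_space_eq[OF \<nu>(1)] by auto
      fix a assume "a \<in> range (\<lambda>n. cball (0::'a) (real n))"
      then show "emeasure \<nu> a \<noteq> \<infinity>"
        using finite_\<mu>[of a] emeasure_\<mu>[of a] by auto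
    qed (auto simp: \<nu>(1))
    fix A :: "'a set" and t assume A: "A \<in> sets borel"
    have "(\<lambda>x. \<Phi> x t) ` A = (\<lambda>x. \<Phi> x (- t)) -` A \<inter> space borel"
    proof safe
      fix x assume "\<Phi> x (- t) \<in> A"
      then show "x \<in> (\<lambda>x. \<Phi> x t) ` A" by (intro image_eqI[of _ _ "\<Phi> x (- t)"]) auto
    qed auto
    also have "\<dots> \<in> sets borel"
      by (rule measurable_sets[OF measurable_flow A]) auto
    finally have "(\<lambda>x. \<Phi> x t) ` A \<in> sets borel" .
    then show "emeasure \<nu> ((\<lambda>x. \<Phi> x t) ` A) = emeasure \<nu> A"
      using assms(4) borel_\<mu>[OF A] emeasure_\<mu> A unfolding flow_invariant_def by metis
  qed
  have out: "is_incoming_measure \<mu> (\<lambda>x t. \<Phi> x (- t)) \<Omega> \<mu>p"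
    by (rule outgoing_reversed[OF assms(6)])
  interpret flow_with_boundary \<Phi> \<Omega> \<nu> \<mu>m \<mu>p
  proof
    show "sets \<mu>m = sets (restrict_space borel (Gamma_m \<Phi> \<Omega>))"
      using assms(7) by (rule sets_incoming)
    show "sets \<mu>p = sets (restrict_space borel (Gamma_p \<Phi> \<Omega>))"
      using assms(6) by (simp add: is_outgoing_measure_def)
  qed (fact incoming_formula[OF \<nu>(2) assms(7)],
       fact invariant_flow.incoming_formula[OF invariant_flow_reversed \<nu>(2) out, unfolded tau_reversed])
  have g_meas: "set_borel_measurable \<mu> \<Omega> g"
    using assms(10) by (auto simp: set_integrable_def set_borel_measurable_def)
  obtain g' where g' [measurable]: "g' \<in> borel_measurable borel" and g_eq: "AE x in \<nu>. x \<in> \<Omega> \<longrightarrow> g x = g' x"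
    and g_eq': "\<And>x. \<mu> = \<nu> \<Longrightarrow> x \<in> \<Omega> \<Longrightarrow> g x = g' x"
    using borel_representative[OF \<nu>(2) g_meas] by metis
  define u' where "u' y = indicator (Gamma_m \<Phi> \<Omega>) y *\<^sub>R u y" for y
  have u_eq: "u y = u' y" if "y \<in> Gamma_m \<Phi> \<Omega>" for y using that by (simp add: u'_def)
  have "u \<in> borel_measurable (restrict_space borel (Gamma_m \<Phi> \<Omega>))"
    using borel_measurable_integrable[OF assms(9)] measurable_cong_sets[OF sets_\<mu>m refl] by blast
  then have u' [measurable]: "u' \<in> borel_measurable borel"
    unfolding u'_def[abs_def] by (subst (asm) borel_measurable_restrict_space_iff) auto
  have "transport_data \<Phi> \<Omega> \<nu> \<mu>m \<mu>p lam g' u'"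
  proof (intro transport_data.intro transport_data_axioms.intro flow_with_boundary_axioms)
    show "set_integrable \<nu> \<Omega> g'"
      using set_integral_of_representative(1)[OF \<nu>(2) g' g_meas g_eq] assms(10) by simp
    show "integrable \<mu>m u'"
      using assms(9) by (rule Bochner_Integration.integrable_cong[THEN iffD1, rotated -1]) (auto simp: space_\<mu>m u_eq)
  qed (use assms(8) g' u' in auto)
  then have data: "bvp_data \<Phi> \<Omega> \<nu> \<mu>m \<mu>p lam g' u' \<mu> f g u"
  proof (rule bvp_data.intro[OF _ bvp_data_axioms.intro])
    show "f x = (LINT t:{t. 0 < t \<and> ereal t < tau_m \<Phi> \<Omega> x}|lebesgue. exp (- lam * t) * g (\<Phi> x (- t))) +
        (if tau_m \<Phi> \<Omega> x < \<infinity>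
         then exp (- lam * real_of_ereal (tau_m \<Phi> \<Omega> x)) * u (entry_point \<Phi> \<Omega> x) else 0)"
      if "x \<in> \<Omega>" for x
      using f_eq[OF that] by (simp add: entry_point_def)
  qed (fact \<nu>(2) assms(9,10) g_eq g_eq' u_eq)+
  show ?thesis
    unfolding AE_of_completion[OF \<nu>(2)]
    using bvp_data.f_solves[OF data] bvp_data.solution_unique[OF data] bvp_data.trace_p_R[OF data]
      bvp_data.trace_p_estimates[OF data, unfolded AE_of_completion[OF \<nu>(2)]] by blast
qed

end
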